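(* Let $\mathscr{B}$ be a closed bicategory with a coshadow $\mathrm{Csh}$, and let $M:R\to S$ and $N:T\to V$ be right dualizable 1-cells in $\mathscr{B}$. Let $Q_1,Q_2:V\to S$ and $P_1,P_2:T\to R$ be 1-cells and let $f:M\triangleright Q_1\to P_1\triangleleft N$ and $g:P_2\odot M\to N\odot Q_2$ be 2-cells. Then $$\theta\circ\mathrm{cotr}_M(g^*f_* )=\mathrm{cotr}_N(f_*g^* )\circ\theta:\ \mathrm{Csh}(Q_1\triangleleft Q_2)\to\mathrm{Csh}(P_2\triangleright P_1),$$ where the $\theta$'s are the coshadow isomorphisms $\mathrm{Csh}(P_1\triangleleft P_2)\cong\mathrm{Csh}(P_2\triangleright P_1)$ and $\mathrm{Csh}(Q_1\triangleleft Q_2)\cong\mathrm{Csh}(Q_2\triangleright Q_1)$, and $g^*f_*$ and $f_*g^*$ denote the composites $$g^*f_*:\ M\triangleright(Q_1\triangleleft Q_2)\xrightarrow{a^{-1}}(M\triangleright Q_1)\triangleleft Q_2\xrightarrow{f_*}(P_1\triangleleft N)\triangleleft Q_2\xrightarrow{t^{-1}}P_1\triangleleft(N\odot Q_2)\xrightarrow{g^*}P_1\triangleleft(P_2\odot M)\xrightarrow{t}(P_1\triangleleft P_2)\triangleleft M,$$ $$f_*g^*:\ N\triangleright(Q_2\triangleright Q_1)\xrightarrow{t^{-1}}(N\odot Q_2)\triangleright Q_1\xrightarrow{g^*}(P_2\odot M)\triangleright Q_1\xrightarrow{t}P_2\triangleright(M\triangleright Q_1)\xrightarrow{f_*}P_2\triangleright(P_1\triangleleft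 N)\xrightarrow{a^{-1}}(P_2\triangleright P_1)\triangleleft N.$$
   Context: **Bicategories.** $\mathscr{B}(R,S)$ is the category of 1-cells $M:R\to S$ and 2-cells between them. Composition of 1-cells $\odot:\mathscr{B}(R,S)\times\mathscr{B}(S,T)\to\mathscr{B}(R,T)$ is written in diagrammatic order; $U_R$ is the identity 1-cell; $l:U_R\odot M\to M$ and $r:M\odot U_S\to M$ are the unitors for $M:R\to S$. Associators for $\odot$ are suppressed. **Closed bicategory.** A bicategory with functors $-\triangleleft-:\mathscr{B}(R,T)\times\mathscr{B}(R,S)^{\mathrm{op}}\to\mathscr{B}(S,T)$ and $-\triangleright-:\mathscr{B}(S,T)^{\mathrm{op}}\times\mathscr{B}(R,T)\to\mathscr{B}(R,S)$ and natural isomorphisms $\mathscr{B}(S,T)(N,P\triangleleft M)\cong\mathscr{B}(R,T)(M\odot N,P)\cong\mathscr{B}(R,S)(M,N\triangleright P)$ for $M:R\to S$, $N:S\to T$, $P:R\to T$. Corresponding 2-cells are called transposes of each other. The evaluations $\mathrm{ev}:(N\triangleright P)\odot N\to P$ and $\mathrm{ev}:M\odot(P\triangleleft M)\to P$ are the transposes of identities. For a 2-cell $h$, $h_*$ (resp. $h^*$) is the map induced on hom-objects by covariance in the target (resp. contravariance in the source). **Canonical isomorphisms.** $t:(M\odot N)\triangleright P\to M\triangleright(N\triangleright P)$ is the transpose of the transpose of $\mathrm{ev}:((M\odot N)\triangleright P)\odot M\odot N\to P$; similarly $t:P\triangleleft(M\odot N)\to(P\triangleleft M)\triangleleft N$.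 The isomorphism $a:(N\triangleright P)\triangleleft M\to N\triangleright(P\triangleleft M)$ is the map whose transpose with respect to both $N$ and $M$ is $M\odot((N\triangleright P)\triangleleft M)\odot N\xrightarrow{\mathrm{ev}\odot1}(N\triangleright P)\odot N\xrightarrow{\mathrm{ev}}P$. For $M:R\to S$, $\overline{l}:M\to M\triangleleft U_R$ is the transpose of $l$ and $\overline{r}:M\to U_S\triangleright M$ is the transpose of $r$; both are isomorphisms. **Duality.** $M\in\mathscr{B}(R,S)$ is right dualizable if there are $M^*\in\mathscr{B}(S,R)$ and 2-cells $\eta:U_R\to M\odot M^*$, $\varepsilon:M^*\odot M\to U_S$ with $(1_M\odot\varepsilon)(\eta\odot 1_M)=1_M$ and $(\varepsilon\odot1_{M^*})(1_{M^*}\odot\eta)=1_{M^*}$; $(M,M^* )$ is then a dual pair. **Coshadow.** A coshadow on a closed bicategory with target category $\mathbf{T}$: functors $\mathrm{Csh}:\mathscr{B}(R,R)\to\mathbf{T}$ for each $R$ and natural isomorphisms $\theta:\mathrm{Csh}(M\triangleright N)\to\mathrm{Csh}(N\triangleleft M)$ for $M,N\in\mathscr{B}(R,S)$ (inverses are also denoted $\theta$), such that for $M:R\to S$, $N:S\to T$, $P:R\to T$ the composites $\mathrm{Csh}((M\odot N)\triangleright P)\xrightarrow{\theta}\mathrm{Csh}(P\triangleleft(M\odot N))\xrightarrow{\mathrm{Csh}(t)}\mathrm{Csh}((P\triangleleft M)\triangleleft N)\xrightarrow{\theta}\mathrm{Csh}(N\triangleright(P\triangleleft M))$ and $\mathrm{Csh}((M\odot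 N)\triangleright P)\xrightarrow{\mathrm{Csh}(t)}\mathrm{Csh}(M\triangleright(N\triangleright P))\xrightarrow{\theta}\mathrm{Csh}((N\triangleright P)\triangleleft M)\xrightarrow{\mathrm{Csh}(a)}\mathrm{Csh}(N\triangleright(P\triangleleft M))$ agree, and for $M\in\mathscr{B}(R,R)$, $\mathrm{Csh}(\overline{l}^{-1})\circ\theta=\mathrm{Csh}(\overline{r}^{-1}):\mathrm{Csh}(U_R\triangleright M)\to\mathrm{Csh}(M)$. **Cotrace.** For a dual pair $(M,M^* )$ with $M:R\to S$ and $f:M\triangleright Q\to P\triangleleft M$ with $Q:S\to S$, $P:R\to R$, $\mathrm{cotr}_M(f):\mathrm{Csh}(Q)\to\mathrm{Csh}(P)$ is the composite of $\mathrm{Csh}$ of the evident maps (and $\theta$): $$Q\xrightarrow{\overline{r}}U_S\triangleright Q\xrightarrow{\varepsilon^*}(M^*\odot M)\triangleright Q\xrightarrow{t}M^*\triangleright(M\triangleright Q)\xrightarrow{f_*}M^*\triangleright(P\triangleleft M),$$ $$\theta:\mathrm{Csh}(M^*\triangleright(P\triangleleft M))\to\mathrm{Csh}((P\triangleleft M)\triangleleft M^* ),$$ $$(P\triangleleft M)\triangleleft M^*\xrightarrow{t^{-1}}P\triangleleft(M\odot M^* )\xrightarrow{\eta^*}P\triangleleft U_R\xrightarrow{\overline{l}^{-1}}P.$$ *)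

theory Defs
  imports Main
begin

section \<open>Categories\<close>

text \<open>Composition \<open>g \<cdot> f\<close> is written in the classical order (first \<open>f\<close>, then \<open>g\<close>).\<close>

record ('a, 'f) cat =
  Obj  :: "'a set"
  Arr  :: "'f set"
  Dom  :: "'f \<Rightarrow> 'a"
  Cod  :: "'f \<Rightarrow> 'a"
  Id   :: "'a \<Rightarrow> 'f" ("\<one>\<index>")
  Comp :: "'f \<Rightarrow> 'f \<Rightarrow> 'f" (infixl "\<cdot>\<index>" 55)

definition Hom :: "('a, 'f, 'z) cat_scheme \<Rightarrow> 'a \<Rightarrow> 'a \<Rightarrow> 'f set" ("Hom\<index>") where
  "Hom\<^bsub>C\<^esub> X Y = {f \<in> Arr C. Dom C f = X \<and> Cod C f = Y}"

locale category =
  fixes C (structure)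
  assumes Dom_in_Obj: "f \<in> Arr C \<Longrightarrow> Dom C f \<in> Obj C"
    and Cod_in_Obj: "f \<in> Arr C \<Longrightarrow> Cod C f \<in> Obj C"
    and Id_in_Hom: "X \<in> Obj C \<Longrightarrow> \<one> X \<in> Hom X X"
    and Comp_in_Hom: "f \<in> Hom X Y \<Longrightarrow> g \<in> Hom Y Z \<Longrightarrow> g \<cdot> f \<in> Hom X Z"
    and Comp_Id: "f \<in> Hom X Y \<Longrightarrow> f \<cdot> \<one> X = f"
    and Id_Comp: "f \<in> Hom X Y \<Longrightarrow> \<one> Y \<cdot> f = f"
    and Comp_assoc: "f \<in> Hom W X \<Longrightarrow> g \<in> Hom X Y \<Longrightarrow> h \<in> Hom Y Z
      \<Longrightarrow> (h \<cdot> g) \<cdot> f = h \<cdot> (g \<cdot> f)"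

definition inverse_arrows :: "('a, 'f, 'z) cat_scheme \<Rightarrow> 'f \<Rightarrow> 'f \<Rightarrow> bool" where
  "inverse_arrows C f g \<longleftrightarrow>
     f \<in> Arr C \<and> g \<in> Hom\<^bsub>C\<^esub> (Cod C f) (Dom C f) \<and>
     g \<cdot>\<^bsub>C\<^esub> f = \<one>\<^bsub>C\<^esub> (Dom C f) \<and> f \<cdot>\<^bsub>C\<^esub> g = \<one>\<^bsub>C\<^esub> (Cod C f)"

definition iso_arrow :: "('a, 'f, 'z) cat_scheme \<Rightarrow> 'f \<Rightarrow> bool" where
  "iso_arrow C f \<longleftrightarrow> (\<exists>g. inverse_arrows C f g)"

definition inv_arrow :: "('a, 'f, 'z) cat_scheme \<Rightarrow> 'f \<Rightarrow> 'f" ("inv\<index> _" [81] 80) where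
  "inv\<^bsub>C\<^esub> f = (THE g. inverse_arrows C f g)"

section \<open>Bicategories\<close>

text \<open>
  The categories of 1-cells \<open>R \<rightarrow> S\<close> and 2-cells between them are presented all at once as
  their disjoint union: a bicategory is in particular one category (under vertical composition)
  whose objects are the 1-cells and whose arrows are the 2-cells. Every 1-cell has a source and
  a target 0-cell, and 2-cells exist only between parallel 1-cells, so the category of
  1-cells \<open>R \<rightarrow> S\<close> is the full subcategory on \<open>Cell1 B R S\<close>.

  Operations in bold are the actions on 2-cells of the functors whose actions on 1-cells are
  written with the corresponding plain symbols. Horizontal composition is in diagrammatic order.
\<close>

record ('o, 'm, 'c) bicat = "('m, 'c) cat" +
  Cell0   :: "'o set"
  Src     :: "'m \<Rightarrow> 'o"
  Trg     :: "'m \<Rightarrow> 'o"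
  Unit    :: "'o \<Rightarrow> 'm" ("U\<index>")
  HComp   :: "'m \<Rightarrow> 'm \<Rightarrow> 'm" (infixl "\<odot>\<index>" 70)
  HComp2  :: "'c \<Rightarrow> 'c \<Rightarrow> 'c" (infixl "\<^bold>\<odot>\<index>" 70)
  LUnitor :: "'m \<Rightarrow> 'c" ("\<l>\<index>")
  RUnitor :: "'m \<Rightarrow> 'c" ("\<r>\<index>")
  Assoc   :: "'m \<Rightarrow> 'm \<Rightarrow> 'm \<Rightarrow> 'c" ("\<alpha>\<index>")

definition Cell1 :: "('o, 'm, 'c, 'z) bicat_scheme \<Rightarrow> 'o \<Rightarrow> 'o \<Rightarrow> 'm set" ("Cell1\<index>") where
  "Cell1\<^bsub>B\<^esub> R S = {M \<in> Obj B. Src B M = R \<and> Trg B M = S}"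

locale bicategory = category B for B (structure) +
  assumes Src_in_Cell0: "M \<in> Obj B \<Longrightarrow> Src B M \<in> Cell0 B"
    and Trg_in_Cell0: "M \<in> Obj B \<Longrightarrow> Trg B M \<in> Cell0 B"
    and Src_parallel: "f \<in> Arr B \<Longrightarrow> Src B (Dom B f) = Src B (Cod B f)"
    and Trg_parallel: "f \<in> Arr B \<Longrightarrow> Trg B (Dom B f) = Trg B (Cod B f)"
    and Unit_in_Cell1: "R \<in> Cell0 B \<Longrightarrow> U R \<in> Cell1 R R"
    and HComp_in_Cell1: "M \<in> Cell1 R S \<Longrightarrow> N \<in> Cell1 S T \<Longrightarrow> M \<odot> N \<in> Cell1 R T"
    and HComp2_in_Hom: "M \<in> Cell1 R S \<Longrightarrow> N \<in> Cell1 S T \<Longrightarrow> m \<in> Hom M M' \<Longrightarrow> n \<in> Hom N N'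
      \<Longrightarrow> m \<^bold>\<odot> n \<in> Hom (M \<odot> N) (M' \<odot> N')"
    and HComp2_Id: "M \<in> Cell1 R S \<Longrightarrow> N \<in> Cell1 S T \<Longrightarrow> \<one> M \<^bold>\<odot> \<one> N = \<one> (M \<odot> N)"
    and HComp2_Comp: "M \<in> Cell1 R S \<Longrightarrow> N \<in> Cell1 S T
      \<Longrightarrow> m \<in> Hom M M' \<Longrightarrow> m' \<in> Hom M' M'' \<Longrightarrow> n \<in> Hom N N' \<Longrightarrow> n' \<in> Hom N' N''
      \<Longrightarrow> (m' \<cdot> m) \<^bold>\<odot> (n' \<cdot> n) = (m' \<^bold>\<odot> n') \<cdot> (m \<^bold>\<odot> n)"
    and LUnitor_in_Hom: "M \<in> Cell1 R S \<Longrightarrow> \<l> M \<in> Hom (U R \<odot> M) M"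
    and LUnitor_iso: "M \<in> Obj B \<Longrightarrow> iso_arrow B (\<l> M)"
    and LUnitor_natural: "M \<in> Cell1 R S \<Longrightarrow> m \<in> Hom M M'
      \<Longrightarrow> \<l> M' \<cdot> (\<one> (U R) \<^bold>\<odot> m) = m \<cdot> \<l> M"
    and RUnitor_in_Hom: "M \<in> Cell1 R S \<Longrightarrow> \<r> M \<in> Hom (M \<odot> U S) M"
    and RUnitor_iso: "M \<in> Obj B \<Longrightarrow> iso_arrow B (\<r> M)"
    and RUnitor_natural: "M \<in> Cell1 R S \<Longrightarrow> m \<in> Hom M M'
      \<Longrightarrow> \<r> M' \<cdot> (m \<^bold>\<odot> \<one> (U S)) = m \<cdot> \<r> M"
    and Assoc_in_Hom: "M \<in> Cell1 R S \<Longrightarrow> N \<in> Cell1 S T \<Longrightarrow> P \<in> Cell1 T V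
      \<Longrightarrow> \<alpha> M N P \<in> Hom ((M \<odot> N) \<odot> P) (M \<odot> (N \<odot> P))"
    and Assoc_iso: "M \<in> Cell1 R S \<Longrightarrow> N \<in> Cell1 S T \<Longrightarrow> P \<in> Cell1 T V
      \<Longrightarrow> iso_arrow B (\<alpha> M N P)"
    and Assoc_natural: "M \<in> Cell1 R S \<Longrightarrow> N \<in> Cell1 S T \<Longrightarrow> P \<in> Cell1 T V
      \<Longrightarrow> m \<in> Hom M M' \<Longrightarrow> n \<in> Hom N N' \<Longrightarrow> p \<in> Hom P P'
      \<Longrightarrow> \<alpha> M' N' P' \<cdot> ((m \<^bold>\<odot> n) \<^bold>\<odot> p) = (m \<^bold>\<odot> (n \<^bold>\<odot> p)) \<cdot> \<alpha> M N P"
    and pentagon: "M \<in> Cell1 R S \<Longrightarrow> N \<in> Cell1 S T \<Longrightarrow> P \<in> Cell1 T V \<Longrightarrow> Q \<in> Cell1 V W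
      \<Longrightarrow> (\<one> M \<^bold>\<odot> \<alpha> N P Q) \<cdot> \<alpha> M (N \<odot> P) Q \<cdot> (\<alpha> M N P \<^bold>\<odot> \<one> Q)
          = \<alpha> M N (P \<odot> Q) \<cdot> \<alpha> (M \<odot> N) P Q"
    and triangle: "M \<in> Cell1 R S \<Longrightarrow> N \<in> Cell1 S T
      \<Longrightarrow> (\<one> M \<^bold>\<odot> \<l> N) \<cdot> \<alpha> M (U S) N = \<r> M \<^bold>\<odot> \<one> N"

section \<open>Closed bicategories\<close>

text \<open>
  \<open>LTr B M N\<close> sends a 2-cell \<open>M \<odot> N \<rightarrow> P\<close> to its transpose \<open>N \<rightarrow> P \<triangleleft> M\<close>, and \<open>RTr B M N\<close> sends
  it to its transpose \<open>M \<rightarrow> N \<triangleright> P\<close>. The factors \<open>M\<close> and \<open>N\<close> have to be passed because they are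
  not determined by the 1-cell \<open>M \<odot> N\<close>.
\<close>

record ('o, 'm, 'c) closed_bicat = "('o, 'm, 'c) bicat" +
  LHom  :: "'m \<Rightarrow> 'm \<Rightarrow> 'm" (infix "\<triangleleft>\<index>" 65)
  LHom2 :: "'c \<Rightarrow> 'c \<Rightarrow> 'c" (infix "\<^bold>\<triangleleft>\<index>" 65)
  RHom  :: "'m \<Rightarrow> 'm \<Rightarrow> 'm" (infix "\<triangleright>\<index>" 65)
  RHom2 :: "'c \<Rightarrow> 'c \<Rightarrow> 'c" (infix "\<^bold>\<triangleright>\<index>" 65)
  LTr   :: "'m \<Rightarrow> 'm \<Rightarrow> 'c \<Rightarrow> 'c"
  RTr   :: "'m \<Rightarrow> 'm \<Rightarrow> 'c \<Rightarrow> 'c"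

locale closed_bicategory = bicategory B for B (structure) +
  assumes LHom_in_Cell1: "P \<in> Cell1 R T \<Longrightarrow> M \<in> Cell1 R S \<Longrightarrow> P \<triangleleft> M \<in> Cell1 S T"
    and LHom2_in_Hom: "P \<in> Cell1 R T \<Longrightarrow> M \<in> Cell1 R S \<Longrightarrow> p \<in> Hom P P' \<Longrightarrow> m \<in> Hom M' M
      \<Longrightarrow> p \<^bold>\<triangleleft> m \<in> Hom (P \<triangleleft> M) (P' \<triangleleft> M')"
    and LHom2_Id: "P \<in> Cell1 R T \<Longrightarrow> M \<in> Cell1 R S \<Longrightarrow> \<one> P \<^bold>\<triangleleft> \<one> M = \<one> (P \<triangleleft> M)"
    and LHom2_Comp: "P \<in> Cell1 R T \<Longrightarrow> M \<in> Cell1 R S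
      \<Longrightarrow> p \<in> Hom P P' \<Longrightarrow> p' \<in> Hom P' P'' \<Longrightarrow> m \<in> Hom M' M \<Longrightarrow> m' \<in> Hom M'' M'
      \<Longrightarrow> (p' \<cdot> p) \<^bold>\<triangleleft> (m \<cdot> m') = (p' \<^bold>\<triangleleft> m') \<cdot> (p \<^bold>\<triangleleft> m)"
    and RHom_in_Cell1: "N \<in> Cell1 S T \<Longrightarrow> P \<in> Cell1 R T \<Longrightarrow> N \<triangleright> P \<in> Cell1 R S"
    and RHom2_in_Hom: "N \<in> Cell1 S T \<Longrightarrow> P \<in> Cell1 R T \<Longrightarrow> n \<in> Hom N' N \<Longrightarrow> p \<in> Hom P P'
      \<Longrightarrow> n \<^bold>\<triangleright> p \<in> Hom (N \<triangleright> P) (N' \<triangleright> P')"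
    and RHom2_Id: "N \<in> Cell1 S T \<Longrightarrow> P \<in> Cell1 R T \<Longrightarrow> \<one> N \<^bold>\<triangleright> \<one> P = \<one> (N \<triangleright> P)"
    and RHom2_Comp: "N \<in> Cell1 S T \<Longrightarrow> P \<in> Cell1 R T
      \<Longrightarrow> n \<in> Hom N' N \<Longrightarrow> n' \<in> Hom N'' N' \<Longrightarrow> p \<in> Hom P P' \<Longrightarrow> p' \<in> Hom P' P''
      \<Longrightarrow> (n \<cdot> n') \<^bold>\<triangleright> (p' \<cdot> p) = (n' \<^bold>\<triangleright> p') \<cdot> (n \<^bold>\<triangleright> p)"
    and LTr_bij: "M \<in> Cell1 R S \<Longrightarrow> N \<in> Cell1 S T \<Longrightarrow> P \<in> Cell1 R T
      \<Longrightarrow> bij_betw (LTr B M N) (Hom (M \<odot> N) P) (Hom N (P \<triangleleft> M))"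
    and LTr_natural: "M \<in> Cell1 R S \<Longrightarrow> N \<in> Cell1 S T \<Longrightarrow> P \<in> Cell1 R T
      \<Longrightarrow> m \<in> Hom M' M \<Longrightarrow> n \<in> Hom N' N \<Longrightarrow> p \<in> Hom P P' \<Longrightarrow> h \<in> Hom (M \<odot> N) P
      \<Longrightarrow> LTr B M' N' (p \<cdot> h \<cdot> (m \<^bold>\<odot> n)) = (p \<^bold>\<triangleleft> m) \<cdot> LTr B M N h \<cdot> n"
    and RTr_bij: "M \<in> Cell1 R S \<Longrightarrow> N \<in> Cell1 S T \<Longrightarrow> P \<in> Cell1 R T
      \<Longrightarrow> bij_betw (RTr B M N) (Hom (M \<odot> N) P) (Hom M (N \<triangleright> P))"
    and RTr_natural: "M \<in> Cell1 R S \<Longrightarrow> N \<in> Cell1 S T \<Longrightarrow> P \<in> Cell1 R T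
      \<Longrightarrow> m \<in> Hom M' M \<Longrightarrow> n \<in> Hom N' N \<Longrightarrow> p \<in> Hom P P' \<Longrightarrow> h \<in> Hom (M \<odot> N) P
      \<Longrightarrow> RTr B M' N' (p \<cdot> h \<cdot> (m \<^bold>\<odot> n)) = (n \<^bold>\<triangleright> p) \<cdot> RTr B M N h \<cdot> m"

section \<open>Canonical 2-cells and dual pairs\<close>

context
  fixes B :: "('o, 'm, 'c, 'z) closed_bicat_scheme" (structure)
begin

text \<open>\<open>M \<odot> (P \<triangleleft> M) \<rightarrow> P\<close> and \<open>(N \<triangleright> P) \<odot> N \<rightarrow> P\<close>: the 2-cells with transpose an identity.\<close>

definition evL :: "'m \<Rightarrow> 'm \<Rightarrow> 'c" where
  "evL M P = the_inv_into (Hom (M \<odot> (P \<triangleleft> M)) P) (LTr B M (P \<triangleleft> M)) (\<one> (P \<triangleleft> M))"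

definition evR :: "'m \<Rightarrow> 'm \<Rightarrow> 'c" where
  "evR N P = the_inv_into (Hom ((N \<triangleright> P) \<odot> N) P) (RTr B (N \<triangleright> P) N) (\<one> (N \<triangleright> P))"

text \<open>\<open>(M \<odot> N) \<triangleright> P \<rightarrow> M \<triangleright> (N \<triangleright> P)\<close>\<close>

definition tR :: "'m \<Rightarrow> 'm \<Rightarrow> 'm \<Rightarrow> 'c" where
  "tR M N P = (let X = (M \<odot> N) \<triangleright> P in
     RTr B X M (RTr B (X \<odot> M) N (evR (M \<odot> N) P \<cdot> \<alpha> X M N)))"

text \<open>\<open>P \<triangleleft> (M \<odot> N) \<rightarrow> (P \<triangleleft> M) \<triangleleft> N\<close>\<close>

definition tL :: "'m \<Rightarrow> 'm \<Rightarrow> 'm \<Rightarrow> 'c" where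
  "tL M N P = (let X = P \<triangleleft> (M \<odot> N) in
     LTr B N X (LTr B M (N \<odot> X) (evL (M \<odot> N) P \<cdot> inv (\<alpha> M N X))))"

text \<open>\<open>(N \<triangleright> P) \<triangleleft> M \<rightarrow> N \<triangleright> (P \<triangleleft> M)\<close>\<close>

definition aLR :: "'m \<Rightarrow> 'm \<Rightarrow> 'm \<Rightarrow> 'c" where
  "aLR N P M = (let X = (N \<triangleright> P) \<triangleleft> M in
     RTr B X N (LTr B M (X \<odot> N) (evR N P \<cdot> (evL M (N \<triangleright> P) \<^bold>\<odot> \<one> N) \<cdot> inv (\<alpha> M X N))))"

definition lbar :: "'m \<Rightarrow> 'c" where
  "lbar M = LTr B (U (Src B M)) M (\<l> M)"

definition rbar :: "'m \<Rightarrow> 'c" where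
  "rbar M = RTr B M (U (Trg B M)) (\<r> M)"

text \<open>
  \<open>Ms\<close> is the dual of \<open>M\<close>. A 1-cell is right dualizable iff it belongs to such a pair.
\<close>

definition dual_pair :: "'m \<Rightarrow> 'm \<Rightarrow> 'c \<Rightarrow> 'c \<Rightarrow> bool" where
  "dual_pair M Ms \<eta> \<epsilon> \<longleftrightarrow> (\<exists>R S. M \<in> Cell1 R S \<and> Ms \<in> Cell1 S R \<and>
     \<eta> \<in> Hom (U R) (M \<odot> Ms) \<and> \<epsilon> \<in> Hom (Ms \<odot> M) (U S) \<and>
     \<r> M \<cdot> (\<one> M \<^bold>\<odot> \<epsilon>) \<cdot> \<alpha> M Ms M \<cdot> (\<eta> \<^bold>\<odot> \<one> M) \<cdot> inv (\<l> M) = \<one> M \<and>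
     \<l> Ms \<cdot> (\<epsilon> \<^bold>\<odot> \<one> Ms) \<cdot> inv (\<alpha> Ms M Ms) \<cdot> (\<one> Ms \<^bold>\<odot> \<eta>) \<cdot> inv (\<r> Ms) = \<one> Ms)"

end

section \<open>Coshadows and the cotrace\<close>

text \<open>
  Endo-1-cells of distinct 0-cells are distinct, so the functors \<open>Csh\<close> on the categories of
  1-cells \<open>R \<rightarrow> R\<close>, one for each \<open>R\<close>, are given by a single action on 1-cells and a single action
  on 2-cells.
\<close>

record ('m, 'c, 'x, 'y) coshadow_data =
  Csh   :: "'m \<Rightarrow> 'x" ("Csh\<index>")
  Csh2  :: "'c \<Rightarrow> 'y" ("Csh2\<index>")
  theta :: "'m \<Rightarrow> 'm \<Rightarrow> 'y" ("\<theta>\<index>")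

locale coshadow = closed_bicategory B + T: category T for B (structure) and T and K +
  assumes Csh_in_Obj: "M \<in> Cell1 R R \<Longrightarrow> Csh\<^bsub>K\<^esub> M \<in> Obj T"
    and Csh2_in_Hom: "M \<in> Cell1 R R \<Longrightarrow> f \<in> Hom M N
      \<Longrightarrow> Csh2\<^bsub>K\<^esub> f \<in> Hom\<^bsub>T\<^esub> (Csh\<^bsub>K\<^esub> M) (Csh\<^bsub>K\<^esub> N)"
    and Csh2_Id: "M \<in> Cell1 R R \<Longrightarrow> Csh2\<^bsub>K\<^esub> (\<one> M) = \<one>\<^bsub>T\<^esub> (Csh\<^bsub>K\<^esub> M)"
    and Csh2_Comp: "M \<in> Cell1 R R \<Longrightarrow> f \<in> Hom M N \<Longrightarrow> g \<in> Hom N P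
      \<Longrightarrow> Csh2\<^bsub>K\<^esub> (g \<cdot> f) = Csh2\<^bsub>K\<^esub> g \<cdot>\<^bsub>T\<^esub> Csh2\<^bsub>K\<^esub> f"
    and theta_in_Hom: "M \<in> Cell1 R S \<Longrightarrow> N \<in> Cell1 R S
      \<Longrightarrow> \<theta>\<^bsub>K\<^esub> M N \<in> Hom\<^bsub>T\<^esub> (Csh\<^bsub>K\<^esub> (M \<triangleright> N)) (Csh\<^bsub>K\<^esub> (N \<triangleleft> M))"
    and theta_iso: "M \<in> Cell1 R S \<Longrightarrow> N \<in> Cell1 R S \<Longrightarrow> iso_arrow T (\<theta>\<^bsub>K\<^esub> M N)"
    and theta_natural: "M \<in> Cell1 R S \<Longrightarrow> N \<in> Cell1 R S \<Longrightarrow> m \<in> Hom M' M \<Longrightarrow> n \<in> Hom N N'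
      \<Longrightarrow> \<theta>\<^bsub>K\<^esub> M' N' \<cdot>\<^bsub>T\<^esub> Csh2\<^bsub>K\<^esub> (m \<^bold>\<triangleright> n) = Csh2\<^bsub>K\<^esub> (n \<^bold>\<triangleleft> m) \<cdot>\<^bsub>T\<^esub> \<theta>\<^bsub>K\<^esub> M N"
    and theta_HComp: "M \<in> Cell1 R S \<Longrightarrow> N \<in> Cell1 S V \<Longrightarrow> P \<in> Cell1 R V
      \<Longrightarrow> inv\<^bsub>T\<^esub> (\<theta>\<^bsub>K\<^esub> N (P \<triangleleft> M)) \<cdot>\<^bsub>T\<^esub> Csh2\<^bsub>K\<^esub> (tL B M N P) \<cdot>\<^bsub>T\<^esub> \<theta>\<^bsub>K\<^esub> (M \<odot> N) P
          = Csh2\<^bsub>K\<^esub> (aLR B N P M) \<cdot>\<^bsub>T\<^esub> \<theta>\<^bsub>K\<^esub> M (N \<triangleright> P) \<cdot>\<^bsub>T\<^esub> Csh2\<^bsub>K\<^esub> (tR B M N P)"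
    and theta_Unit: "M \<in> Cell1 R R
      \<Longrightarrow> Csh2\<^bsub>K\<^esub> (inv (lbar B M)) \<cdot>\<^bsub>T\<^esub> \<theta>\<^bsub>K\<^esub> (U R) M = Csh2\<^bsub>K\<^esub> (inv (rbar B M))"

text \<open>
  The cotrace \<open>Csh Q \<rightarrow> Csh P\<close> of \<open>f : M \<triangleright> Q \<rightarrow> P \<triangleleft> M\<close> with respect to the dual pair
  \<open>(M, Ms)\<close> with coevaluation \<open>\<eta>\<close> and evaluation \<open>\<epsilon>\<close>.
\<close>

definition cotr :: "('o, 'm, 'c, 'z) closed_bicat_scheme \<Rightarrow> ('x, 'y, 'w) cat_scheme
    \<Rightarrow> ('m, 'c, 'x, 'y, 'v) coshadow_data_scheme
    \<Rightarrow> 'm \<Rightarrow> 'm \<Rightarrow> 'c \<Rightarrow> 'c \<Rightarrow> 'm \<Rightarrow> 'm \<Rightarrow> 'c \<Rightarrow> 'y" where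
  "cotr B T K M Ms \<eta> \<epsilon> Q P f =
     Csh2\<^bsub>K\<^esub> (inv\<^bsub>B\<^esub> (lbar B P) \<cdot>\<^bsub>B\<^esub> (\<one>\<^bsub>B\<^esub> P \<^bold>\<triangleleft>\<^bsub>B\<^esub> \<eta>) \<cdot>\<^bsub>B\<^esub> inv\<^bsub>B\<^esub> (tL B M Ms P))
     \<cdot>\<^bsub>T\<^esub> \<theta>\<^bsub>K\<^esub> Ms (P \<triangleleft>\<^bsub>B\<^esub> M)
     \<cdot>\<^bsub>T\<^esub> Csh2\<^bsub>K\<^esub> ((\<one>\<^bsub>B\<^esub> Ms \<^bold>\<triangleright>\<^bsub>B\<^esub> f) \<cdot>\<^bsub>B\<^esub> tR B Ms M Q \<cdot>\<^bsub>B\<^esub> (\<epsilon> \<^bold>\<triangleright>\<^bsub>B\<^esub> \<one>\<^bsub>B\<^esub> Q) \<cdot>\<^bsub>B\<^esub> rbar B Q)"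

end

theory Submission
  imports Defs
begin

text \<open>
  In a symmetric monoidal category the trace is cyclic because one of the two factors can be
  slid around the loop as its mate. The same idea works here, with homs in place of tensor
  products and \<open>\<theta>\<close> in place of the symmetry. The factor to slide is \<open>g : P\<^sub>2 \<odot> M \<rightarrow> N \<odot> Q\<^sub>2\<close>. Its mate
  \<open>g' : N* \<odot> P\<^sub>2 \<rightarrow> Q\<^sub>2 \<odot> M*\<close> has two properties: creating \<open>M \<odot> M*\<close> and applying \<open>g\<close> is the same as
  creating \<open>N \<odot> N*\<close> and applying \<open>g'\<close> (\<open>mate_insL\<close>), and applying \<open>g\<close> and cancelling \<open>N* \<odot> N\<close> is the
  same as applying \<open>g'\<close> and cancelling \<open>M* \<odot> M\<close> (\<open>remR_mate\<close>).

  A cotrace along \<open>M\<close> consists of an expansion \<open>Q \<rightarrow> M* \<triangleright> (M \<triangleright> Q)\<close>, the given 2-cell, \<open>\<theta>\<close>, and a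
  collapse \<open>(P \<triangleleft> M) \<triangleleft> M* \<rightarrow> P\<close>. Four identities in the closed bicategory connect the two cotraces.
  The expansion of \<open>Q\<^sub>1 \<triangleleft> Q\<^sub>2\<close> comes from that of \<open>Q\<^sub>1\<close> (\<open>expand_LHom\<close>), and the collapse to \<open>P\<^sub>2 \<triangleright> P\<^sub>1\<close>
  from that to \<open>P\<^sub>1\<close> (\<open>collapse_RHom\<close>). Let \<open>g\<close> and \<open>g'\<close> also stand for the maps that they induce on
  homs. By the properties of the mate, \<open>g\<close> followed by the collapse along \<open>M\<close> is \<open>g'\<close> followed by the
  collapse along \<open>N\<close> (\<open>collapse_mate\<close>), and the expansion along \<open>N\<close> followed by \<open>g\<close> is the expansion
  along \<open>M\<close> followed by \<open>g'\<close> (\<open>expand_mate\<close>). Now both sides of the theorem expand along \<open>M\<close>, apply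
  \<open>f\<close> and \<open>g'\<close>, and collapse along \<open>N\<close>; but the left-hand side applies \<open>\<theta>\<close> at \<open>M*\<close>, before \<open>f\<close> and
  \<open>g'\<close>, and the right-hand side applies it at \<open>N*\<close>, after them. The axiom on \<open>\<theta>\<close> and composites of
  1-cells splits the first \<open>\<theta>\<close> into the inverse of \<open>\<theta>\<close> at \<open>Q\<^sub>2\<close>, which moves past the expansion to
  the beginning, and \<open>\<theta>\<close> at \<open>Q\<^sub>2 \<odot> M*\<close>. Naturality in \<open>f\<close> and \<open>g'\<close> carries the latter to
  \<open>N* \<odot> P\<^sub>2\<close>, and the same axiom splits it into the second \<open>\<theta>\<close> and \<open>\<theta>\<close> at \<open>P\<^sub>2\<close>, which moves past
  the collapse to the end.

  The identities in the closed bicategory are checked on transposes. Every canonical 2-cell is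
  characterized by what composition with it does to a generalized element, a 2-cell out of an
  arbitrary 1-cell; in these terms each identity becomes an equation between pastings of \<open>\<eta>\<close>, \<open>\<epsilon>\<close>
  and \<open>g\<close> with associators and unitors. These are consequences of
  the pentagon, the triangle axiom and the triangle identities of the dual pairs.
\<close>

section \<open>Calculating in a category by its domain and codomain functions\<close>

text \<open>
  Typing is restated as conditional rewriting of \<open>Dom\<close>, \<open>Cod\<close>, \<open>Src\<close> and \<open>Trg\<close>, so that the
  simplifier computes the type of a composite from its form. Since it would compute the types of
  nested subterms again at every level, longer proofs name the subterms and record their types.
  Composites are normalized to be nested to the right.
\<close>

lemma (in category) Comp_typing [simp]:
  assumes "f \<in> Arr C" "g \<in> Arr C" "Cod C f = Dom C g"
  shows "g \<cdot> f \<in> Arr C" "Dom C (g \<cdot> f) = Dom C f" "Cod C (g \<cdot> f) = Cod C g"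
  using Comp_in_Hom[of f "Dom C f" "Cod C f" g "Cod C g"] assms by (auto simp: Hom_def)

lemma (in category) Id_typing [simp]:
  assumes "X \<in> Obj C"
  shows "\<one> X \<in> Arr C" "Dom C (\<one> X) = X" "Cod C (\<one> X) = X"
  using Id_in_Hom[OF assms] by (auto simp: Hom_def)

lemma (in category) Comp_Id_right [simp]: "f \<in> Arr C \<Longrightarrow> Dom C f = X \<Longrightarrow> f \<cdot> \<one> X = f"
  using Comp_Id[of f X "Cod C f"] by (simp add: Hom_def)

lemma (in category) Comp_Id_left [simp]: "f \<in> Arr C \<Longrightarrow> Cod C f = X \<Longrightarrow> \<one> X \<cdot> f = f"
  using Id_Comp[of f "Dom C f" X] by (simp add: Hom_def)

lemma (in category) Comp_reassoc [simp]:
  assumes "f \<in> Arr C" "g \<in> Arr C" "h \<in> Arr C" "Cod C f = Dom C g" "Cod C g = Dom C h"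
  shows "(h \<cdot> g) \<cdot> f = h \<cdot> (g \<cdot> f)"
  by (rule Comp_assoc) (use assms in \<open>auto simp: Hom_def\<close>)

text \<open>
  In a composite that is nested to the right, two adjacent factors form a subterm only at the very
  end. An instance of this rule applies the equation \<open>g \<cdot> f = e\<close> anywhere.
\<close>

lemma (in category) Comp_extend:
  assumes "g \<cdot> f = e" "f \<in> Arr C" "g \<in> Arr C" "x \<in> Arr C" "Cod C f = Dom C g" "Cod C x = Dom C f"
  shows "g \<cdot> (f \<cdot> x) = e \<cdot> x"
  unfolding assms(1)[symmetric] using assms(2-) by simp

lemma (in category) inverse_arrows_unique:
  assumes "inverse_arrows C f g" "inverse_arrows C f h"
  shows "g = h"
proof -
  have t: "f \<in> Arr C" "g \<in> Arr C" "h \<in> Arr C" "Dom C g = Cod C f" "Cod C g = Dom C f"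
    "Dom C h = Cod C f" "Cod C h = Dom C f"
    and e: "g \<cdot> f = \<one> (Dom C f)" "f \<cdot> h = \<one> (Cod C f)"
    using assms by (simp_all add: inverse_arrows_def Hom_def)
  have "g = g \<cdot> \<one> (Cod C f)" using t by simp
  also have "\<dots> = g \<cdot> (f \<cdot> h)" by (simp only: e)
  also have "\<dots> = (g \<cdot> f) \<cdot> h" using t by simp
  also have "\<dots> = h" unfolding e using t by simp
  finally show ?thesis .
qed

lemma (in category) inv_arrow_eq:
  assumes "inverse_arrows C f g"
  shows "inv f = g"
  unfolding inv_arrow_def
  by (rule the_equality[where P = "inverse_arrows C f"]) (use assms inverse_arrows_unique in blast)+

lemma (in category) inv_inverse_arrows: "iso_arrow C f \<Longrightarrow> inverse_arrows C f (inv f)"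
  using inv_arrow_eq unfolding iso_arrow_def by blast

lemma (in category) iso_arrow_in_Arr: "iso_arrow C f \<Longrightarrow> f \<in> Arr C"
  by (auto simp: iso_arrow_def inverse_arrows_def)

lemma (in category) inv_typing [simp]:
  assumes "iso_arrow C f"
  shows "inv f \<in> Arr C" "Dom C (inv f) = Cod C f" "Cod C (inv f) = Dom C f"
  using inv_inverse_arrows[OF assms] by (auto simp: inverse_arrows_def Hom_def)

lemma (in category) inv_cancel [simp]:
  assumes "iso_arrow C f"
  shows "inv f \<cdot> f = \<one> (Dom C f)" "f \<cdot> inv f = \<one> (Cod C f)"
  using inv_inverse_arrows[OF assms] by (auto simp: inverse_arrows_def)

lemma (in category) iso_arrow_inv [simp]: "iso_arrow C f \<Longrightarrow> iso_arrow C (inv f)"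
  unfolding iso_arrow_def[of C "inv f"]
  by (rule exI[of _ f]) (simp add: inverse_arrows_def Hom_def iso_arrow_in_Arr)

lemma (in category) inv_cancel_comp [simp]:
  assumes "iso_arrow C f" "x \<in> Arr C"
  shows "Cod C x = Dom C f \<Longrightarrow> inv f \<cdot> (f \<cdot> x) = x"
    and "Cod C x = Cod C f \<Longrightarrow> f \<cdot> (inv f \<cdot> x) = x"
  using assms iso_arrow_in_Arr[OF assms(1)]
  by (simp_all add: Comp_extend[OF inv_cancel(1)] Comp_extend[OF inv_cancel(2)])

lemma (in category) iso_left_cancel:
  assumes "iso_arrow C f" "f \<cdot> x = f \<cdot> y" "x \<in> Arr C" "y \<in> Arr C" "Cod C x = Dom C f" "Cod C y = Dom C f"
  shows "x = y"
  using inv_cancel_comp(1)[of f x] inv_cancel_comp(1)[of f y] assms by metis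

lemma (in category) iso_right_cancel:
  assumes "iso_arrow C f" "x \<cdot> f = y \<cdot> f" "x \<in> Arr C" "y \<in> Arr C" "Cod C f = Dom C x" "Cod C f = Dom C y"
  shows "x = y"
proof -
  note [simp] = assms(1,3,4) assms(5,6)[symmetric] iso_arrow_in_Arr[OF assms(1)]
  have "x = (x \<cdot> f) \<cdot> inv f" by simp
  also have "\<dots> = (y \<cdot> f) \<cdot> inv f" by (simp only: assms(2))
  also have "\<dots> = y" by simp
  finally show ?thesis .
qed

lemma (in category) inv_square:
  assumes "iso_arrow C i" "iso_arrow C j" "x \<in> Arr C" "y \<in> Arr C"
    and "Cod C i = Dom C x" "Cod C y = Dom C j" "Dom C y = Dom C i" "Cod C x = Cod C j"
    and "x \<cdot> i = j \<cdot> y"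
  shows "inv j \<cdot> x = y \<cdot> inv i"
proof -
  have "inv j \<cdot> x = inv j \<cdot> ((x \<cdot> i) \<cdot> inv i)"
    using assms(1-8) iso_arrow_in_Arr by simp
  also have "\<dots> = inv j \<cdot> ((j \<cdot> y) \<cdot> inv i)" by (simp only: assms(9))
  also have "\<dots> = y \<cdot> inv i"
    using assms(1-8) iso_arrow_in_Arr by simp
  finally show ?thesis .
qed

text \<open>
  From \<open>h \<cdot> k = \<one>\<close> one has \<open>h \<cdot> (k \<cdot> h) = h\<close>, and \<open>k\<close> is the inverse as soon as \<open>h\<close> can be cancelled.
\<close>

lemma (in category) iso_arrow_if_retraction_mono:
  assumes "h \<in> Arr C" "k \<in> Arr C" "Dom C k = Cod C h" "Cod C k = Dom C h" "h \<cdot> k = \<one> (Cod C h)"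
    and mono: "\<And>x y. x \<in> Hom (Dom C h) (Dom C h) \<Longrightarrow> y \<in> Hom (Dom C h) (Dom C h)
      \<Longrightarrow> h \<cdot> x = h \<cdot> y \<Longrightarrow> x = y"
  shows "iso_arrow C h"
proof -
  have obj: "Dom C h \<in> Obj C" using assms(1) by (rule Dom_in_Obj)
  have "h \<cdot> (k \<cdot> h) = (h \<cdot> k) \<cdot> h" using assms(1-4) by simp
  also have "\<dots> = h \<cdot> \<one> (Dom C h)" using assms(1-5) by simp
  finally have "h \<cdot> (k \<cdot> h) = h \<cdot> \<one> (Dom C h)" .
  then have "k \<cdot> h = \<one> (Dom C h)"
    by (rule mono[rotated 2]) (use assms(1-4) obj in \<open>auto simp: Hom_def\<close>)
  then show ?thesis using assms(1-5) by (auto simp: iso_arrow_def inverse_arrows_def Hom_def)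
qed

section \<open>Coherence of units and associators\<close>

lemma (in bicategory) Obj_typing [simp]:
  shows "f \<in> Arr B \<Longrightarrow> Dom B f \<in> Obj B" "f \<in> Arr B \<Longrightarrow> Cod B f \<in> Obj B"
    and "M \<in> Obj B \<Longrightarrow> Src B M \<in> Cell0 B" "M \<in> Obj B \<Longrightarrow> Trg B M \<in> Cell0 B"
    and "f \<in> Arr B \<Longrightarrow> Src B (Cod B f) = Src B (Dom B f)"
    and "f \<in> Arr B \<Longrightarrow> Trg B (Cod B f) = Trg B (Dom B f)"
  by (auto simp: Dom_in_Obj Cod_in_Obj Src_in_Cell0 Trg_in_Cell0 Src_parallel Trg_parallel)

lemma (in bicategory) Unit_typing [simp]:
  assumes "R \<in> Cell0 B"
  shows "U R \<in> Obj B" "Src B (U R) = R" "Trg B (U R) = R"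
  using Unit_in_Cell1[OF assms] by (auto simp: Cell1_def)

lemma (in bicategory) HComp_typing [simp]:
  assumes "M \<in> Obj B" "N \<in> Obj B" "Trg B M = Src B N"
  shows "M \<odot> N \<in> Obj B" "Src B (M \<odot> N) = Src B M" "Trg B (M \<odot> N) = Trg B N"
  using HComp_in_Cell1[of M "Src B M" "Trg B M" N "Trg B N"] assms by (auto simp: Cell1_def)

lemma (in bicategory) HComp2_typing [simp]:
  assumes "m \<in> Arr B" "n \<in> Arr B" "Trg B (Dom B m) = Src B (Dom B n)"
  shows "m \<^bold>\<odot> n \<in> Arr B" "Dom B (m \<^bold>\<odot> n) = Dom B m \<odot> Dom B n" "Cod B (m \<^bold>\<odot> n) = Cod B m \<odot> Cod B n"
  using HComp2_in_Hom[of "Dom B m" "Src B (Dom B m)" "Trg B (Dom B m)" "Dom B n" "Trg B (Dom B n)" m "Cod B m" n "Cod B n"] assms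
  by (auto simp: Cell1_def Hom_def)

lemma (in bicategory) HComp2_Id' [simp]:
  "M \<in> Obj B \<Longrightarrow> N \<in> Obj B \<Longrightarrow> Trg B M = Src B N \<Longrightarrow> \<one> M \<^bold>\<odot> \<one> N = \<one> (M \<odot> N)"
  using HComp2_Id[of M "Src B M" "Trg B M" N "Trg B N"] by (simp add: Cell1_def)

lemma (in bicategory) interchange:
  assumes "m \<in> Arr B" "n \<in> Arr B" "m' \<in> Arr B" "n' \<in> Arr B"
    and "Cod B m = Dom B m'" "Cod B n = Dom B n'" "Trg B (Dom B m) = Src B (Dom B n)"
  shows "(m' \<^bold>\<odot> n') \<cdot> (m \<^bold>\<odot> n) = (m' \<cdot> m) \<^bold>\<odot> (n' \<cdot> n)"
  using assms HComp2_Comp[of "Dom B m" "Src B (Dom B m)" "Trg B (Dom B m)" "Dom B n" "Trg B (Dom B n)"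
      m "Cod B m" m' "Cod B m'" n "Cod B n" n' "Cod B n'"]
  by (simp add: Cell1_def Hom_def)

lemma (in bicategory) whisker_left [simp]:
  assumes "M \<in> Obj B" "f \<in> Arr B" "g \<in> Arr B" "Cod B f = Dom B g" "Trg B M = Src B (Dom B f)"
  shows "\<one> M \<^bold>\<odot> (g \<cdot> f) = (\<one> M \<^bold>\<odot> g) \<cdot> (\<one> M \<^bold>\<odot> f)"
  using interchange[of "\<one> M" f "\<one> M" g] assms by simp

lemma (in bicategory) whisker_right [simp]:
  assumes "N \<in> Obj B" "f \<in> Arr B" "g \<in> Arr B" "Cod B f = Dom B g" "Trg B (Dom B f) = Src B N"
  shows "(g \<cdot> f) \<^bold>\<odot> \<one> N = (g \<^bold>\<odot> \<one> N) \<cdot> (f \<^bold>\<odot> \<one> N)"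
  using interchange[of f "\<one> N" g "\<one> N"] assms by simp

lemma (in bicategory) whiskers_commute:
  assumes "m \<in> Arr B" "n \<in> Arr B" "Trg B (Dom B m) = Src B (Dom B n)"
    and "Dom B m = M" "Cod B m = M'" "Dom B n = N" "Cod B n = N'"
  shows "(m \<^bold>\<odot> \<one> N') \<cdot> (\<one> M \<^bold>\<odot> n) = (\<one> M' \<^bold>\<odot> n) \<cdot> (m \<^bold>\<odot> \<one> N)"
  using interchange[of "\<one> M" n m "\<one> N'"] interchange[of m "\<one> N" "\<one> M'" n] assms by auto

lemma (in bicategory) LUnitor_typing [simp]:
  assumes "M \<in> Obj B" shows "\<l> M \<in> Arr B" "Dom B (\<l> M) = U (Src B M) \<odot> M" "Cod B (\<l> M) = M"
  using LUnitor_in_Hom[of M "Src B M" "Trg B M"] assms by (auto simp: Cell1_def Hom_def)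

lemma (in bicategory) RUnitor_typing [simp]:
  assumes "M \<in> Obj B" shows "\<r> M \<in> Arr B" "Dom B (\<r> M) = M \<odot> U (Trg B M)" "Cod B (\<r> M) = M"
  using RUnitor_in_Hom[of M "Src B M" "Trg B M"] assms by (auto simp: Cell1_def Hom_def)

lemma (in bicategory) LUnitor_nat:
  assumes "m \<in> Arr B" "Dom B m = M" "Cod B m = M'" "Src B M = R"
  shows "\<l> M' \<cdot> (\<one> (U R) \<^bold>\<odot> m) = m \<cdot> \<l> M"
  using assms LUnitor_natural[of M R "Trg B M" m M'] by (auto simp: Cell1_def Hom_def)

lemma (in bicategory) RUnitor_nat:
  assumes "m \<in> Arr B" "Dom B m = M" "Cod B m = M'" "Trg B M = R"
  shows "\<r> M' \<cdot> (m \<^bold>\<odot> \<one> (U R)) = m \<cdot> \<r> M"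
  using assms RUnitor_natural[of M "Src B M" R m M'] by (auto simp: Cell1_def Hom_def)

lemma (in bicategory) Assoc_typing [simp]:
  assumes "M \<in> Obj B" "N \<in> Obj B" "P \<in> Obj B" "Trg B M = Src B N" "Trg B N = Src B P"
  shows "\<alpha> M N P \<in> Arr B" "Dom B (\<alpha> M N P) = (M \<odot> N) \<odot> P" "Cod B (\<alpha> M N P) = M \<odot> (N \<odot> P)"
    and "iso_arrow B (\<alpha> M N P)"
  using Assoc_in_Hom[of M "Src B M" "Trg B M" N "Trg B N" P "Trg B P"]
    Assoc_iso[of M "Src B M" "Trg B M" N "Trg B N" P "Trg B P"] assms by (auto simp: Cell1_def Hom_def)

declare (in bicategory) LUnitor_iso [simp] RUnitor_iso [simp]

lemma (in bicategory) Assoc_nat: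
  assumes "m \<in> Arr B" "n \<in> Arr B" "p \<in> Arr B"
    and "Trg B (Dom B m) = Src B (Dom B n)" "Trg B (Dom B n) = Src B (Dom B p)"
    and "Dom B m = M" "Dom B n = N" "Dom B p = P" "Cod B m = M'" "Cod B n = N'" "Cod B p = P'"
  shows "\<alpha> M' N' P' \<cdot> ((m \<^bold>\<odot> n) \<^bold>\<odot> p) = (m \<^bold>\<odot> (n \<^bold>\<odot> p)) \<cdot> \<alpha> M N P"
  using assms Assoc_natural[of M "Src B M" "Trg B M" N "Trg B N" P "Trg B P" m M' n N' p P']
  by (auto simp: Cell1_def Hom_def)

lemma (in bicategory) Assoc_nat1:
  assumes "m \<in> Arr B" "N \<in> Obj B" "P \<in> Obj B"
    and "Trg B (Dom B m) = Src B N" "Trg B N = Src B P" "Dom B m = M" "Cod B m = M'"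
  shows "\<alpha> M' N P \<cdot> ((m \<^bold>\<odot> \<one> N) \<^bold>\<odot> \<one> P) = (m \<^bold>\<odot> \<one> (N \<odot> P)) \<cdot> \<alpha> M N P"
  using Assoc_nat[of m "\<one> N" "\<one> P" M N P M' N P] assms by simp

lemma (in bicategory) Assoc_nat2:
  assumes "n \<in> Arr B" "M \<in> Obj B" "P \<in> Obj B"
    and "Trg B M = Src B (Dom B n)" "Trg B (Dom B n) = Src B P" "Dom B n = N" "Cod B n = N'"
  shows "\<alpha> M N' P \<cdot> ((\<one> M \<^bold>\<odot> n) \<^bold>\<odot> \<one> P) = (\<one> M \<^bold>\<odot> (n \<^bold>\<odot> \<one> P)) \<cdot> \<alpha> M N P"
  using Assoc_nat[of "\<one> M" n "\<one> P" M N P M N' P] assms by simp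

lemma (in bicategory) Assoc_nat3:
  assumes "p \<in> Arr B" "M \<in> Obj B" "N \<in> Obj B"
    and "Trg B M = Src B N" "Trg B N = Src B (Dom B p)" "Dom B p = P" "Cod B p = P'"
  shows "\<alpha> M N P' \<cdot> (\<one> (M \<odot> N) \<^bold>\<odot> p) = (\<one> M \<^bold>\<odot> (\<one> N \<^bold>\<odot> p)) \<cdot> \<alpha> M N P"
  using Assoc_nat[of "\<one> M" "\<one> N" p M N P M N P'] assms by simp

lemma (in bicategory) Pentagon:
  assumes "M \<in> Obj B" "N \<in> Obj B" "P \<in> Obj B" "Q \<in> Obj B"
    and "Trg B M = Src B N" "Trg B N = Src B P" "Trg B P = Src B Q"
  shows "(\<one> M \<^bold>\<odot> \<alpha> N P Q) \<cdot> (\<alpha> M (N \<odot> P) Q \<cdot> (\<alpha> M N P \<^bold>\<odot> \<one> Q)) = \<alpha> M N (P \<odot> Q) \<cdot> \<alpha> (M \<odot> N) P Q"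
  using pentagon[of M "Src B M" "Trg B M" N "Trg B N" P "Trg B P" Q "Trg B Q"] assms by (simp add: Cell1_def)

lemma (in bicategory) Triangle:
  assumes "M \<in> Obj B" "N \<in> Obj B" "Trg B M = R" "Src B N = R"
  shows "(\<one> M \<^bold>\<odot> \<l> N) \<cdot> \<alpha> M (U R) N = \<r> M \<^bold>\<odot> \<one> N"
  using triangle[of M "Src B M" R N "Trg B N"] assms by (simp add: Cell1_def)

lemma (in bicategory) HComp2_iso:
  assumes "iso_arrow B m" "iso_arrow B n" "Trg B (Dom B m) = Src B (Dom B n)"
  shows "inverse_arrows B (m \<^bold>\<odot> n) (inv m \<^bold>\<odot> inv n)"
  using assms iso_arrow_in_Arr Obj_typing(5,6)[of m] Obj_typing(5,6)[of n]
  by (auto simp: inverse_arrows_def Hom_def interchange)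

lemma (in bicategory) whisker_iso [simp]:
  assumes "iso_arrow B m" "N \<in> Obj B"
  shows "Src B N = Trg B (Dom B m) \<Longrightarrow> iso_arrow B (m \<^bold>\<odot> \<one> N)"
    and "Src B N = Trg B (Dom B m) \<Longrightarrow> inv (m \<^bold>\<odot> \<one> N) = inv m \<^bold>\<odot> \<one> N"
    and "Trg B N = Src B (Dom B m) \<Longrightarrow> iso_arrow B (\<one> N \<^bold>\<odot> m)"
    and "Trg B N = Src B (Dom B m) \<Longrightarrow> inv (\<one> N \<^bold>\<odot> m) = \<one> N \<^bold>\<odot> inv m"
proof -
  have id: "inverse_arrows B (\<one> N) (\<one> N)" using assms by (auto simp: inverse_arrows_def Hom_def)
  then have "iso_arrow B (\<one> N)" "inv (\<one> N) = \<one> N" by (auto simp: iso_arrow_def inv_arrow_eq)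
  note * = this HComp2_iso[of m "\<one> N"] HComp2_iso[of "\<one> N" m]
  show "Src B N = Trg B (Dom B m) \<Longrightarrow> iso_arrow B (m \<^bold>\<odot> \<one> N)"
    and "Src B N = Trg B (Dom B m) \<Longrightarrow> inv (m \<^bold>\<odot> \<one> N) = inv m \<^bold>\<odot> \<one> N"
    and "Trg B N = Src B (Dom B m) \<Longrightarrow> iso_arrow B (\<one> N \<^bold>\<odot> m)"
    and "Trg B N = Src B (Dom B m) \<Longrightarrow> inv (\<one> N \<^bold>\<odot> m) = \<one> N \<^bold>\<odot> inv m"
    using * assms by (auto simp: iso_arrow_def inv_arrow_eq)
qed

text \<open>
  Whiskering with a unit 1-cell is faithful, because the unitor is a natural isomorphism.
\<close>

lemma (in bicategory) whisker_Unit_left_faithful: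
  assumes "f \<in> Arr B" "g \<in> Arr B" "Dom B f = Dom B g" "Cod B f = Cod B g" "Src B (Dom B f) = R"
    and "\<one> (U R) \<^bold>\<odot> f = \<one> (U R) \<^bold>\<odot> g"
  shows "f = g"
proof (rule iso_right_cancel)
  show "iso_arrow B (\<l> (Dom B f))" using assms by simp
  show "f \<cdot> \<l> (Dom B f) = g \<cdot> \<l> (Dom B f)"
    using LUnitor_nat[of f "Dom B f" "Cod B f" R] LUnitor_nat[of g "Dom B f" "Cod B f" R] assms by auto
qed (use assms in auto)

lemma (in bicategory) whisker_Unit_right_faithful:
  assumes "f \<in> Arr B" "g \<in> Arr B" "Dom B f = Dom B g" "Cod B f = Cod B g" "Trg B (Dom B f) = R"
    and "f \<^bold>\<odot> \<one> (U R) = g \<^bold>\<odot> \<one> (U R)"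
  shows "f = g"
proof (rule iso_right_cancel)
  show "iso_arrow B (\<r> (Dom B f))" using assms by simp
  show "f \<cdot> \<r> (Dom B f) = g \<cdot> \<r> (Dom B f)"
    using RUnitor_nat[of f "Dom B f" "Cod B f" R] RUnitor_nat[of g "Dom B f" "Cod B f" R] assms by auto
qed (use assms in auto)

text \<open>
  The two unit coherences that Kelly derived from the pentagon and the triangle: whisker with a
  unit 1-cell, where the triangle applies, and use that this whiskering is faithful.
\<close>

lemma (in bicategory) RUnitor_HComp:
  assumes [simp]: "M \<in> Obj B" "N \<in> Obj B" "Trg B M = Src B N" "Trg B N = T"
  shows "(\<one> M \<^bold>\<odot> \<r> N) \<cdot> \<alpha> M N (U T) = \<r> (M \<odot> N)"
proof (rule whisker_Unit_right_faithful[where R = T])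
  have T [simp]: "T \<in> Cell0 B" using Obj_typing(4)[of N] assms by simp
  have "\<alpha> M N (U T) \<cdot> (((\<one> M \<^bold>\<odot> \<r> N) \<^bold>\<odot> \<one> (U T)) \<cdot> (\<alpha> M N (U T) \<^bold>\<odot> \<one> (U T)))
      = (\<one> M \<^bold>\<odot> (\<r> N \<^bold>\<odot> \<one> (U T))) \<cdot> (\<alpha> M (N \<odot> U T) (U T) \<cdot> (\<alpha> M N (U T) \<^bold>\<odot> \<one> (U T)))"
    by (simp add: Comp_extend[OF Assoc_nat2])
  also have "\<dots> = (\<one> M \<^bold>\<odot> (\<one> N \<^bold>\<odot> \<l> (U T))) \<cdot> ((\<one> M \<^bold>\<odot> \<alpha> N (U T) (U T))
      \<cdot> (\<alpha> M (N \<odot> U T) (U T) \<cdot> (\<alpha> M N (U T) \<^bold>\<odot> \<one> (U T))))"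
    by (simp add: Triangle[of N "U T" T, symmetric])
  also have "\<dots> = \<alpha> M N (U T) \<cdot> ((\<one> (M \<odot> N) \<^bold>\<odot> \<l> (U T)) \<cdot> \<alpha> (M \<odot> N) (U T) (U T))"
    by (simp add: Pentagon Comp_extend[OF Assoc_nat3])
  also have "\<dots> = \<alpha> M N (U T) \<cdot> (\<r> (M \<odot> N) \<^bold>\<odot> \<one> (U T))"
    by (simp add: Triangle)
  finally show "((\<one> M \<^bold>\<odot> \<r> N) \<cdot> \<alpha> M N (U T)) \<^bold>\<odot> \<one> (U T) = \<r> (M \<odot> N) \<^bold>\<odot> \<one> (U T)"
    by (intro iso_left_cancel[of "\<alpha> M N (U T)" "((\<one> M \<^bold>\<odot> \<r> N) \<cdot> \<alpha> M N (U T)) \<^bold>\<odot> \<one> (U T)"]) simp_all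
qed (use Obj_typing(4)[of N] in simp_all)

lemma (in bicategory) LUnitor_HComp:
  assumes [simp]: "M \<in> Obj B" "N \<in> Obj B" "Trg B M = Src B N" "Src B M = R"
  shows "\<l> (M \<odot> N) \<cdot> \<alpha> (U R) M N = \<l> M \<^bold>\<odot> \<one> N"
proof (rule whisker_Unit_left_faithful[where R = R])
  have R [simp]: "R \<in> Cell0 B" using Obj_typing(3)[of M] assms by simp
  let ?i = "\<alpha> (U R) (U R \<odot> M) N \<cdot> (\<alpha> (U R) (U R) M \<^bold>\<odot> \<one> N)"
  have "((\<one> (U R) \<^bold>\<odot> \<l> (M \<odot> N)) \<cdot> (\<one> (U R) \<^bold>\<odot> \<alpha> (U R) M N)) \<cdot> ?i
      = (\<one> (U R) \<^bold>\<odot> \<l> (M \<odot> N)) \<cdot> (\<alpha> (U R) (U R) (M \<odot> N) \<cdot> \<alpha> (U R \<odot> U R) M N)"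
    by (simp add: Pentagon)
  also have "\<dots> = (\<r> (U R) \<^bold>\<odot> \<one> (M \<odot> N)) \<cdot> \<alpha> (U R \<odot> U R) M N"
    by (simp add: Comp_extend[OF Triangle])
  also have "\<dots> = \<alpha> (U R) M N \<cdot> ((\<r> (U R) \<^bold>\<odot> \<one> M) \<^bold>\<odot> \<one> N)"
    by (simp add: Assoc_nat1)
  also have "\<dots> = \<alpha> (U R) M N \<cdot> (((\<one> (U R) \<^bold>\<odot> \<l> M) \<^bold>\<odot> \<one> N) \<cdot> (\<alpha> (U R) (U R) M \<^bold>\<odot> \<one> N))"
    by (simp add: Triangle[of "U R" M R, symmetric])
  also have "\<dots> = (\<one> (U R) \<^bold>\<odot> (\<l> M \<^bold>\<odot> \<one> N)) \<cdot> ?i"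
    by (simp add: Comp_extend[OF Assoc_nat2])
  finally have "(((\<one> (U R) \<^bold>\<odot> \<l> (M \<odot> N)) \<cdot> (\<one> (U R) \<^bold>\<odot> \<alpha> (U R) M N))
        \<cdot> \<alpha> (U R) (U R \<odot> M) N) \<cdot> (\<alpha> (U R) (U R) M \<^bold>\<odot> \<one> N)
      = ((\<one> (U R) \<^bold>\<odot> (\<l> M \<^bold>\<odot> \<one> N)) \<cdot> \<alpha> (U R) (U R \<odot> M) N) \<cdot> (\<alpha> (U R) (U R) M \<^bold>\<odot> \<one> N)"
    by simp
  then have "((\<one> (U R) \<^bold>\<odot> \<l> (M \<odot> N)) \<cdot> (\<one> (U R) \<^bold>\<odot> \<alpha> (U R) M N)) \<cdot> \<alpha> (U R) (U R \<odot> M) N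
      = (\<one> (U R) \<^bold>\<odot> (\<l> M \<^bold>\<odot> \<one> N)) \<cdot> \<alpha> (U R) (U R \<odot> M) N"
    by (rule iso_right_cancel[rotated]) auto
  then have "(\<one> (U R) \<^bold>\<odot> \<l> (M \<odot> N)) \<cdot> (\<one> (U R) \<^bold>\<odot> \<alpha> (U R) M N) = \<one> (U R) \<^bold>\<odot> (\<l> M \<^bold>\<odot> \<one> N)"
    by (rule iso_right_cancel[rotated]) auto
  then show "\<one> (U R) \<^bold>\<odot> (\<l> (M \<odot> N) \<cdot> \<alpha> (U R) M N) = \<one> (U R) \<^bold>\<odot> (\<l> M \<^bold>\<odot> \<one> N)"
    by simp
qed (use Obj_typing(3)[of M] in simp_all)

lemma (in bicategory) Assoc_inv_nat1:
  assumes "m \<in> Arr B" "N \<in> Obj B" "P \<in> Obj B"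
    and "Trg B (Dom B m) = Src B N" "Trg B N = Src B P" "Dom B m = M" "Cod B m = M'"
  shows "inv (\<alpha> M' N P) \<cdot> (m \<^bold>\<odot> \<one> (N \<odot> P)) = ((m \<^bold>\<odot> \<one> N) \<^bold>\<odot> \<one> P) \<cdot> inv (\<alpha> M N P)"
  by (rule inv_square) (use assms Assoc_nat1 in auto)

lemma (in bicategory) Assoc_inv_nat2:
  assumes "n \<in> Arr B" "M \<in> Obj B" "P \<in> Obj B"
    and "Trg B M = Src B (Dom B n)" "Trg B (Dom B n) = Src B P" "Dom B n = N" "Cod B n = N'"
  shows "inv (\<alpha> M N' P) \<cdot> (\<one> M \<^bold>\<odot> (n \<^bold>\<odot> \<one> P)) = ((\<one> M \<^bold>\<odot> n) \<^bold>\<odot> \<one> P) \<cdot> inv (\<alpha> M N P)"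
  by (rule inv_square) (use assms Assoc_nat2 in auto)

lemma (in bicategory) Assoc_inv_nat3:
  assumes "p \<in> Arr B" "M \<in> Obj B" "N \<in> Obj B"
    and "Trg B M = Src B N" "Trg B N = Src B (Dom B p)" "Dom B p = P" "Cod B p = P'"
  shows "inv (\<alpha> M N P') \<cdot> (\<one> M \<^bold>\<odot> (\<one> N \<^bold>\<odot> p)) = (\<one> (M \<odot> N) \<^bold>\<odot> p) \<cdot> inv (\<alpha> M N P)"
  by (rule inv_square) (use assms Assoc_nat3 in auto)

lemma (in bicategory) LUnitor_inv_nat:
  assumes "m \<in> Arr B" "Dom B m = M" "Cod B m = M'" "Src B M = R"
  shows "inv (\<l> M') \<cdot> m = (\<one> (U R) \<^bold>\<odot> m) \<cdot> inv (\<l> M)"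
  by (rule inv_square) (use assms LUnitor_nat in auto)

text \<open>
  The unit coherences solved for inverse unitors, which occur in the insertion of a coevaluation.
\<close>

lemma (in bicategory) Triangle_inv:
  assumes [simp]: "M \<in> Obj B" "N \<in> Obj B" "Trg B M = R" "Src B N = R"
  shows "\<alpha> M (U R) N \<cdot> (inv (\<r> M) \<^bold>\<odot> \<one> N) = \<one> M \<^bold>\<odot> inv (\<l> N)"
proof -
  have R [simp]: "R \<in> Cell0 B" using Obj_typing(4)[of M] by simp
  have "inv (\<one> M \<^bold>\<odot> \<l> N) \<cdot> (\<r> M \<^bold>\<odot> \<one> N) = \<alpha> M (U R) N"
    by (simp add: Triangle[symmetric] del: whisker_iso(4))
  then have "(\<one> M \<^bold>\<odot> inv (\<l> N)) \<cdot> ((\<r> M \<^bold>\<odot> \<one> N) \<cdot> (inv (\<r> M) \<^bold>\<odot> \<one> N))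
      = \<alpha> M (U R) N \<cdot> (inv (\<r> M) \<^bold>\<odot> \<one> N)"
    by (subst Comp_reassoc[symmetric]) simp_all
  then show ?thesis using inv_cancel(2)[of "\<r> M \<^bold>\<odot> \<one> N"] by simp
qed

lemma (in bicategory) LUnitor_inv_HComp:
  assumes [simp]: "M \<in> Obj B" "N \<in> Obj B" "Trg B M = Src B N" "Src B M = R"
  shows "\<alpha> (U R) M N \<cdot> (inv (\<l> M) \<^bold>\<odot> \<one> N) = inv (\<l> (M \<odot> N))"
proof (rule iso_left_cancel)
  have R [simp]: "R \<in> Cell0 B" using Obj_typing(3)[of M] by simp
  show "\<l> (M \<odot> N) \<cdot> (\<alpha> (U R) M N \<cdot> (inv (\<l> M) \<^bold>\<odot> \<one> N)) = \<l> (M \<odot> N) \<cdot> inv (\<l> (M \<odot> N))"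
    using inv_cancel(2)[of "\<l> M \<^bold>\<odot> \<one> N"] by (simp add: Comp_extend[OF LUnitor_HComp])
qed (use Obj_typing(3)[of M] in simp_all)

lemma (in bicategory) RUnitor_inv_HComp:
  assumes [simp]: "M \<in> Obj B" "N \<in> Obj B" "Trg B M = Src B N" "Trg B N = R"
  shows "\<alpha> M N (U R) \<cdot> inv (\<r> (M \<odot> N)) = \<one> M \<^bold>\<odot> inv (\<r> N)"
proof (rule iso_left_cancel)
  have R [simp]: "R \<in> Cell0 B" using Obj_typing(4)[of N] by simp
  show "(\<one> M \<^bold>\<odot> \<r> N) \<cdot> (\<alpha> M N (U R) \<cdot> inv (\<r> (M \<odot> N))) = (\<one> M \<^bold>\<odot> \<r> N) \<cdot> (\<one> M \<^bold>\<odot> inv (\<r> N))"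
    using inv_cancel(2)[of "\<one> M \<^bold>\<odot> \<r> N"] by (simp add: Comp_extend[OF RUnitor_HComp])
qed (use Obj_typing(4)[of N] in simp_all)

lemma (in bicategory) whisker_inv_cancel [simp]:
  assumes "iso_arrow B m" "N \<in> Obj B"
  shows "Trg B N = Src B (Dom B m) \<Longrightarrow> (\<one> N \<^bold>\<odot> inv m) \<cdot> (\<one> N \<^bold>\<odot> m) = \<one> (N \<odot> Dom B m)"
    and "Trg B N = Src B (Dom B m) \<Longrightarrow> (\<one> N \<^bold>\<odot> m) \<cdot> (\<one> N \<^bold>\<odot> inv m) = \<one> (N \<odot> Cod B m)"
    and "Src B N = Trg B (Dom B m) \<Longrightarrow> (inv m \<^bold>\<odot> \<one> N) \<cdot> (m \<^bold>\<odot> \<one> N) = \<one> (Dom B m \<odot> N)"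
    and "Src B N = Trg B (Dom B m) \<Longrightarrow> (m \<^bold>\<odot> \<one> N) \<cdot> (inv m \<^bold>\<odot> \<one> N) = \<one> (Cod B m \<odot> N)"
  using assms iso_arrow_in_Arr[OF assms(1)]
    inv_cancel[of "\<one> N \<^bold>\<odot> m"] inv_cancel[of "m \<^bold>\<odot> \<one> N"] by simp_all

lemma (in bicategory) whisker_inv_cancel_comp [simp]:
  assumes "iso_arrow B m" "N \<in> Obj B" "x \<in> Arr B"
  shows "Trg B N = Src B (Dom B m) \<Longrightarrow> Cod B x = N \<odot> Dom B m
      \<Longrightarrow> (\<one> N \<^bold>\<odot> inv m) \<cdot> ((\<one> N \<^bold>\<odot> m) \<cdot> x) = x"
    and "Trg B N = Src B (Dom B m) \<Longrightarrow> Cod B x = N \<odot> Cod B m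
      \<Longrightarrow> (\<one> N \<^bold>\<odot> m) \<cdot> ((\<one> N \<^bold>\<odot> inv m) \<cdot> x) = x"
    and "Src B N = Trg B (Dom B m) \<Longrightarrow> Cod B x = Dom B m \<odot> N
      \<Longrightarrow> (inv m \<^bold>\<odot> \<one> N) \<cdot> ((m \<^bold>\<odot> \<one> N) \<cdot> x) = x"
    and "Src B N = Trg B (Dom B m) \<Longrightarrow> Cod B x = Cod B m \<odot> N
      \<Longrightarrow> (m \<^bold>\<odot> \<one> N) \<cdot> ((inv m \<^bold>\<odot> \<one> N) \<cdot> x) = x"
  using assms iso_arrow_in_Arr[OF assms(1)]
    inv_cancel_comp[of "\<one> N \<^bold>\<odot> m" x] inv_cancel_comp[of "m \<^bold>\<odot> \<one> N" x] by simp_all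

lemma (in bicategory) Pentagon_extend:
  assumes [simp]: "M \<in> Obj B" "N \<in> Obj B" "P \<in> Obj B" "Q \<in> Obj B"
    "Trg B M = Src B N" "Trg B N = Src B P" "Trg B P = Src B Q"
    and [simp]: "x \<in> Arr B" "Cod B x = ((M \<odot> N) \<odot> P) \<odot> Q"
  shows "(\<one> M \<^bold>\<odot> \<alpha> N P Q) \<cdot> (\<alpha> M (N \<odot> P) Q \<cdot> ((\<alpha> M N P \<^bold>\<odot> \<one> Q) \<cdot> x))
    = \<alpha> M N (P \<odot> Q) \<cdot> (\<alpha> (M \<odot> N) P Q \<cdot> x)"
  using Comp_extend[OF Pentagon[of M N P Q], of x] by simp

text \<open>The form in which the pentagon moves a bracket past an inverse associator.\<close>

lemma (in bicategory) Pentagon_inv: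
  assumes [simp]: "M \<in> Obj B" "N \<in> Obj B" "P \<in> Obj B" "Q \<in> Obj B"
    "Trg B M = Src B N" "Trg B N = Src B P" "Trg B P = Src B Q"
  shows "\<alpha> (M \<odot> N) P Q \<cdot> (inv (\<alpha> M N P) \<^bold>\<odot> \<one> Q)
    = inv (\<alpha> M N (P \<odot> Q)) \<cdot> ((\<one> M \<^bold>\<odot> \<alpha> N P Q) \<cdot> \<alpha> M (N \<odot> P) Q)"
  using Pentagon_extend[of M N P Q "inv (\<alpha> M N P) \<^bold>\<odot> \<one> Q"] inv_cancel(2)[of "\<alpha> M N P \<^bold>\<odot> \<one> Q"]
  by simp

lemma (in bicategory) Pentagon_inv':
  assumes [simp]: "M \<in> Obj B" "N \<in> Obj B" "P \<in> Obj B" "Q \<in> Obj B"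
    "Trg B M = Src B N" "Trg B N = Src B P" "Trg B P = Src B Q"
  shows "(\<one> M \<^bold>\<odot> inv (\<alpha> N P Q)) \<cdot> \<alpha> M N (P \<odot> Q)
    = \<alpha> M (N \<odot> P) Q \<cdot> ((\<alpha> M N P \<^bold>\<odot> \<one> Q) \<cdot> inv (\<alpha> (M \<odot> N) P Q))"
  by (rule iso_left_cancel[of "\<one> M \<^bold>\<odot> \<alpha> N P Q"]) (simp_all add: Pentagon_extend)

section \<open>Tensoring with a coevaluation or an evaluation\<close>

text \<open>
  A 2-cell \<open>\<eta> : U \<rightarrow> A \<odot> A'\<close> inserts \<open>A \<odot> A'\<close> on the left or on the right of a 1-cell, and
  \<open>\<epsilon> : A' \<odot> A \<rightarrow> U\<close> removes \<open>A' \<odot> A\<close>. The results are bracketed like iterated functors, \<open>A \<odot> (A' \<odot> -)\<close>,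
  because the transposes of the canonical 2-cells are bracketed in this way.
\<close>

definition (in bicategory) insL :: "'a \<Rightarrow> 'a \<Rightarrow> 'b \<Rightarrow> 'a \<Rightarrow> 'b" where
  "insL A A' \<eta> Z = \<alpha> A A' Z \<cdot> ((\<eta> \<^bold>\<odot> \<one> Z) \<cdot> inv (\<l> Z))"

definition (in bicategory) insR :: "'a \<Rightarrow> 'a \<Rightarrow> 'b \<Rightarrow> 'a \<Rightarrow> 'b" where
  "insR A A' \<eta> X = inv (\<alpha> X A A') \<cdot> ((\<one> X \<^bold>\<odot> \<eta>) \<cdot> inv (\<r> X))"

definition (in bicategory) remL :: "'a \<Rightarrow> 'a \<Rightarrow> 'b \<Rightarrow> 'a \<Rightarrow> 'b" where
  "remL A' A \<epsilon> Z = \<l> Z \<cdot> ((\<epsilon> \<^bold>\<odot> \<one> Z) \<cdot> inv (\<alpha> A' A Z))"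

definition (in bicategory) remR :: "'a \<Rightarrow> 'a \<Rightarrow> 'b \<Rightarrow> 'a \<Rightarrow> 'b" where
  "remR A' A \<epsilon> X = \<r> X \<cdot> ((\<one> X \<^bold>\<odot> \<epsilon>) \<cdot> \<alpha> X A' A)"

context bicategory
begin

context
  fixes A A' \<eta>
  assumes [simp]: "A \<in> Obj B" "A' \<in> Obj B" "Trg B A = Src B A'" "Trg B A' = Src B A"
    and [simp]: "\<eta> \<in> Arr B" "Dom B \<eta> = U (Src B A)" "Cod B \<eta> = A \<odot> A'"
begin

lemma insL_typing [simp]:
  assumes "Z \<in> Obj B" "Src B Z = Src B A"
  shows "insL A A' \<eta> Z \<in> Arr B" "Dom B (insL A A' \<eta> Z) = Z" "Cod B (insL A A' \<eta> Z) = A \<odot> (A' \<odot> Z)"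
  using assms by (simp_all add: insL_def)

lemma insR_typing [simp]:
  assumes "X \<in> Obj B" "Trg B X = Src B A"
  shows "insR A A' \<eta> X \<in> Arr B" "Dom B (insR A A' \<eta> X) = X" "Cod B (insR A A' \<eta> X) = (X \<odot> A) \<odot> A'"
  using assms by (simp_all add: insR_def)

lemma insL_natural:
  assumes [simp]: "z \<in> Arr B" "Dom B z = Z" "Cod B z = Z'" "Src B Z = Src B A"
  shows "insL A A' \<eta> Z' \<cdot> z = (\<one> A \<^bold>\<odot> (\<one> A' \<^bold>\<odot> z)) \<cdot> insL A A' \<eta> Z"
proof -
  have [simp]: "Z \<in> Obj B" "Z' \<in> Obj B" "Src B Z' = Src B A"
    using Obj_typing(1,2,5)[of z] by simp_all
  show ?thesis
    by (simp add: insL_def LUnitor_inv_nat[of z] Comp_extend[OF whiskers_commute[of \<eta> z]] Comp_extend[OF Assoc_nat3])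
qed

text \<open>
  An insertion beside \<open>Z \<odot> K\<close> involves only the nearer factor: the pentagon moves the brackets, the
  associator is natural in \<open>\<eta>\<close>, and the unitor of \<open>Z \<odot> K\<close> is that of the nearer factor. The variants
  for the other side and for removals hold for the same reasons.
\<close>

lemma insL_HComp:
  assumes [simp]: "Z \<in> Obj B" "K \<in> Obj B" "Src B Z = Src B A" "Trg B Z = Src B K"
  shows "(\<one> A \<^bold>\<odot> \<alpha> A' Z K) \<cdot> (\<alpha> A (A' \<odot> Z) K \<cdot> (insL A A' \<eta> Z \<^bold>\<odot> \<one> K)) = insL A A' \<eta> (Z \<odot> K)"
  by (simp add: insL_def Pentagon_extend Comp_extend[OF Assoc_nat1] LUnitor_inv_HComp)

lemma insR_HComp:
  assumes [simp]: "Z \<in> Obj B" "X \<in> Obj B" "Trg B Z = Src B A" "Trg B X = Src B Z"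
  shows "\<alpha> X (Z \<odot> A) A' \<cdot> ((\<alpha> X Z A \<^bold>\<odot> \<one> A') \<cdot> insR A A' \<eta> (X \<odot> Z)) = \<one> X \<^bold>\<odot> insR A A' \<eta> Z"
proof -
  have "(\<one> X \<^bold>\<odot> \<alpha> Z A A') \<cdot> (\<alpha> X (Z \<odot> A) A' \<cdot> ((\<alpha> X Z A \<^bold>\<odot> \<one> A') \<cdot> insR A A' \<eta> (X \<odot> Z)))
      = (\<one> X \<^bold>\<odot> \<alpha> Z A A') \<cdot> (\<one> X \<^bold>\<odot> insR A A' \<eta> Z)"
    using inv_cancel_comp(2)[of "\<one> X \<^bold>\<odot> \<alpha> Z A A'"]
    by (simp add: insR_def Pentagon_extend Comp_extend[OF Assoc_nat3] RUnitor_inv_HComp)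
  then show ?thesis
    by (rule iso_left_cancel[rotated]) simp_all
qed

text \<open>
  Inserting a pair between \<open>X\<close> and \<open>Z\<close> can be seen from either side, by the triangle axiom.
\<close>

lemma insR_insL:
  assumes [simp]: "X \<in> Obj B" "Z \<in> Obj B" "Trg B X = Src B A" "Src B Z = Src B A"
  shows "\<alpha> (X \<odot> A) A' Z \<cdot> (insR A A' \<eta> X \<^bold>\<odot> \<one> Z) = inv (\<alpha> X A (A' \<odot> Z)) \<cdot> (\<one> X \<^bold>\<odot> insL A A' \<eta> Z)"
  by (simp add: insR_def insL_def Comp_extend[OF Pentagon_inv] Comp_extend[OF Assoc_nat2] Triangle_inv)

end

context
  fixes A A' \<epsilon>
  assumes [simp]: "A \<in> Obj B" "A' \<in> Obj B" "Trg B A = Src B A'" "Trg B A' = Src B A"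
    and [simp]: "\<epsilon> \<in> Arr B" "Cod B \<epsilon> = U (Src B A')" "Dom B \<epsilon> = A' \<odot> A"
begin

lemma remL_typing [simp]:
  assumes "Z \<in> Obj B" "Src B Z = Src B A'"
  shows "remL A' A \<epsilon> Z \<in> Arr B" "Cod B (remL A' A \<epsilon> Z) = Z" "Dom B (remL A' A \<epsilon> Z) = A' \<odot> (A \<odot> Z)"
  using assms by (simp_all add: remL_def)

lemma remR_typing [simp]:
  assumes "X \<in> Obj B" "Trg B X = Src B A'"
  shows "remR A' A \<epsilon> X \<in> Arr B" "Cod B (remR A' A \<epsilon> X) = X" "Dom B (remR A' A \<epsilon> X) = (X \<odot> A') \<odot> A"
  using assms by (simp_all add: remR_def)

lemma remR_natural:
  assumes [simp]: "x \<in> Arr B" "Dom B x = X" "Cod B x = X'" "Trg B X = Src B A'"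
  shows "remR A' A \<epsilon> X' \<cdot> ((x \<^bold>\<odot> \<one> A') \<^bold>\<odot> \<one> A) = x \<cdot> remR A' A \<epsilon> X"
proof -
  have [simp]: "X \<in> Obj B" "X' \<in> Obj B" "Trg B X' = Src B A'"
    using Obj_typing(1,2,6)[of x] by simp_all
  show ?thesis
    by (simp add: remR_def Assoc_nat1 Comp_extend[OF whiskers_commute[of x \<epsilon>, symmetric]]
      Comp_extend[OF RUnitor_nat])
qed

lemma remR_HComp:
  assumes [simp]: "Z \<in> Obj B" "X \<in> Obj B" "Trg B Z = Src B A'" "Trg B X = Src B Z"
  shows "(\<one> X \<^bold>\<odot> remR A' A \<epsilon> Z) \<cdot> (\<alpha> X (Z \<odot> A') A \<cdot> (\<alpha> X Z A' \<^bold>\<odot> \<one> A)) = remR A' A \<epsilon> (X \<odot> Z)"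
  by (simp add: remR_def Pentagon RUnitor_HComp[symmetric] Comp_extend[OF Assoc_nat3])

lemma remL_HComp:
  assumes [simp]: "Z \<in> Obj B" "K \<in> Obj B" "Src B Z = Src B A'" "Trg B Z = Src B K"
  shows "remL A' A \<epsilon> (Z \<odot> K) \<cdot> ((\<one> A' \<^bold>\<odot> \<alpha> A Z K) \<cdot> \<alpha> A' (A \<odot> Z) K) = remL A' A \<epsilon> Z \<^bold>\<odot> \<one> K"
  by (simp add: remL_def Pentagon_inv[symmetric] Comp_extend[OF Assoc_nat1]
     LUnitor_HComp[symmetric])

lemma remL_remR:
  assumes [simp]: "X \<in> Obj B" "Z \<in> Obj B" "Trg B X = Src B A'" "Src B Z = Src B A'"
  shows "(\<one> X \<^bold>\<odot> remL A' A \<epsilon> Z) \<cdot> \<alpha> X A' (A \<odot> Z) = (remR A' A \<epsilon> X \<^bold>\<odot> \<one> Z) \<cdot> inv (\<alpha> (X \<odot> A') A Z)"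
  by (simp add: remL_def remR_def Pentagon_inv' Comp_extend[OF Assoc_nat2[symmetric]] Comp_extend[OF Triangle])

end

end

section \<open>Dual pairs and mates\<close>

text \<open>
  The triangle identity at \<open>M\<close> is stated through \<open>remR\<close>, because \<open>remR\<close> is also what appears when
  the identity is tensored with another 1-cell.
\<close>

definition (in bicategory) zigzag_pair :: "'a \<Rightarrow> 'a \<Rightarrow> 'b \<Rightarrow> 'b \<Rightarrow> bool" where
  "zigzag_pair M Ms \<eta> \<epsilon> \<longleftrightarrow> M \<in> Obj B \<and> Ms \<in> Obj B \<and> Trg B M = Src B Ms \<and> Trg B Ms = Src B M \<and>
    \<eta> \<in> Arr B \<and> Dom B \<eta> = U (Src B M) \<and> Cod B \<eta> = M \<odot> Ms \<and>
    \<epsilon> \<in> Arr B \<and> Dom B \<epsilon> = Ms \<odot> M \<and> Cod B \<epsilon> = U (Src B Ms) \<and>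
    remR Ms M \<epsilon> M \<cdot> ((\<eta> \<^bold>\<odot> \<one> M) \<cdot> inv (\<l> M)) = \<one> M"

context bicategory
begin

context
  fixes M Ms \<eta> \<epsilon>
  assumes dual: "zigzag_pair M Ms \<eta> \<epsilon>"
begin

lemma zigzag_pair_typing:
  "M \<in> Obj B" "Ms \<in> Obj B" "Trg B M = Src B Ms" "Trg B Ms = Src B M"
  "\<eta> \<in> Arr B" "Dom B \<eta> = U (Src B M)" "Cod B \<eta> = M \<odot> Ms"
  "\<epsilon> \<in> Arr B" "Dom B \<epsilon> = Ms \<odot> M" "Cod B \<epsilon> = U (Src B Ms)"
  using dual by (simp_all add: zigzag_pair_def)

lemma zigzag_pair_triangle: "remR Ms M \<epsilon> M \<cdot> ((\<eta> \<^bold>\<odot> \<one> M) \<cdot> inv (\<l> M)) = \<one> M"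
  using dual by (simp add: zigzag_pair_def)

declare zigzag_pair_typing [simp]

text \<open>
  Tensored with a 1-cell on the right or on the left, the triangle identity at \<open>M\<close> becomes a
  triangle identity between the functors \<open>Ms \<odot> -\<close> and \<open>M \<odot> -\<close>, respectively \<open>- \<odot> M\<close> and \<open>- \<odot> Ms\<close>.
\<close>

lemma zigzag_left:
  assumes [simp]: "K \<in> Obj B" "Src B K = Src B Ms"
  shows "(\<one> M \<^bold>\<odot> remL Ms M \<epsilon> K) \<cdot> insL M Ms \<eta> (M \<odot> K) = \<one> (M \<odot> K)"
proof -
  have "(\<one> M \<^bold>\<odot> remL Ms M \<epsilon> K) \<cdot> insL M Ms \<eta> (M \<odot> K)
      = (remR Ms M \<epsilon> M \<^bold>\<odot> \<one> K) \<cdot> (inv (\<alpha> (M \<odot> Ms) M K) \<cdot> ((\<eta> \<^bold>\<odot> \<one> (M \<odot> K)) \<cdot> inv (\<l> (M \<odot> K))))"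
    by (simp add: insL_def Comp_extend[OF remL_remR])
  also have "\<dots> = (remR Ms M \<epsilon> M \<cdot> ((\<eta> \<^bold>\<odot> \<one> M) \<cdot> inv (\<l> M))) \<^bold>\<odot> \<one> K"
    by (simp add: Comp_extend[OF Assoc_inv_nat1] LUnitor_inv_HComp[symmetric])
  finally show ?thesis by (simp add: zigzag_pair_triangle del: whisker_right)
qed

lemma zigzag_right:
  assumes [simp]: "X \<in> Obj B" "Trg B X = Src B M"
  shows "remR Ms M \<epsilon> (X \<odot> M) \<cdot> (insR M Ms \<eta> X \<^bold>\<odot> \<one> M) = \<one> (X \<odot> M)"
proof -
  have "remR Ms M \<epsilon> (X \<odot> M) \<cdot> (insR M Ms \<eta> X \<^bold>\<odot> \<one> M)
      = \<r> (X \<odot> M) \<cdot> ((\<one> (X \<odot> M) \<^bold>\<odot> \<epsilon>) \<cdot> (inv (\<alpha> X M (Ms \<odot> M)) \<cdot> (\<one> X \<^bold>\<odot> insL M Ms \<eta> M)))"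
    by (simp add: remR_def insR_insL)
  also have "\<dots> = \<one> X \<^bold>\<odot> (remR Ms M \<epsilon> M \<cdot> ((\<eta> \<^bold>\<odot> \<one> M) \<cdot> inv (\<l> M)))"
    by (simp add: remR_def insL_def RUnitor_HComp[symmetric] Comp_extend[OF Assoc_nat3])
  finally show ?thesis by (simp add: zigzag_pair_triangle del: whisker_left)
qed

end

end

text \<open>
  The mate of \<open>g : P \<odot> M \<rightarrow> N \<odot> Q\<close> is the 2-cell \<open>Ns \<odot> P \<rightarrow> Q \<odot> Ms\<close> that corresponds to \<open>g\<close> under
  the adjunctions of \<open>- \<odot> M\<close> with \<open>- \<odot> Ms\<close> and of \<open>Ns \<odot> -\<close> with \<open>N \<odot> -\<close>.
\<close>

definition (in bicategory) mate :: "'a \<Rightarrow> 'a \<Rightarrow> 'b \<Rightarrow> 'a \<Rightarrow> 'a \<Rightarrow> 'b \<Rightarrow> 'a \<Rightarrow> 'a \<Rightarrow> 'b \<Rightarrow> 'b" where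
  "mate M Ms \<eta> N Ns \<epsilon> P Q g = remL Ns N \<epsilon> (Q \<odot> Ms) \<cdot> (\<one> Ns \<^bold>\<odot> (\<alpha> N Q Ms \<cdot> ((g \<^bold>\<odot> \<one> Ms) \<cdot> insR M Ms \<eta> P)))"

context bicategory
begin

context
  fixes M Ms \<eta>\<^sub>M \<epsilon>\<^sub>M N Ns \<eta>\<^sub>N \<epsilon>\<^sub>N P Q g g'
  assumes M: "zigzag_pair M Ms \<eta>\<^sub>M \<epsilon>\<^sub>M" and N: "zigzag_pair N Ns \<eta>\<^sub>N \<epsilon>\<^sub>N"
    and [simp]: "P \<in> Obj B" "Q \<in> Obj B" "Trg B P = Src B M" "Trg B Q = Src B Ms"
      "Src B P = Src B N" "Src B Q = Src B Ns"
    and [simp]: "g \<in> Arr B" "Dom B g = P \<odot> M" "Cod B g = N \<odot> Q"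
    and g': "g' = mate M Ms \<eta>\<^sub>M N Ns \<epsilon>\<^sub>N P Q g"
begin

declare zigzag_pair_typing [OF M, simp] zigzag_pair_typing [OF N, simp]

lemma mate_typing [simp]: "g' \<in> Arr B" "Dom B g' = Ns \<odot> P" "Cod B g' = Q \<odot> Ms"
  by (simp_all add: g' mate_def)

text \<open>
  The mate does not depend on which of the two dualities is used first, since creating \<open>M \<odot> Ms\<close> on
  the right commutes with cancelling \<open>Ns \<odot> N\<close> on the left. The definition suits \<open>mate_insL\<close>, this
  form suits \<open>remR_mate\<close>.
\<close>

lemma mate_eq:
  "g' = ((remL Ns N \<epsilon>\<^sub>N Q \<cdot> ((\<one> Ns \<^bold>\<odot> g) \<cdot> \<alpha> Ns P M)) \<^bold>\<odot> \<one> Ms) \<cdot> insR M Ms \<eta>\<^sub>M (Ns \<odot> P)"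
  by (simp add: g' mate_def insR_HComp[symmetric] remL_HComp[symmetric] Comp_extend[OF Assoc_nat2])

text \<open>
  The insertion of \<open>N \<odot> Ns\<close> slides past the right-hand side by naturality and then cancels against
  the evaluation in the mate.
\<close>

lemma mate_insL:
  "(\<one> N \<^bold>\<odot> g') \<cdot> insL N Ns \<eta>\<^sub>N P = \<alpha> N Q Ms \<cdot> ((g \<^bold>\<odot> \<one> Ms) \<cdot> insR M Ms \<eta>\<^sub>M P)"
proof -
  let ?u = "\<alpha> N Q Ms \<cdot> ((g \<^bold>\<odot> \<one> Ms) \<cdot> insR M Ms \<eta>\<^sub>M P)"
  have u: "?u \<in> Arr B" "Dom B ?u = P" "Cod B ?u = N \<odot> (Q \<odot> Ms)" by simp_all
  have "(\<one> N \<^bold>\<odot> g') \<cdot> insL N Ns \<eta>\<^sub>N P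
      = (\<one> N \<^bold>\<odot> remL Ns N \<epsilon>\<^sub>N (Q \<odot> Ms)) \<cdot> ((\<one> N \<^bold>\<odot> (\<one> Ns \<^bold>\<odot> ?u)) \<cdot> insL N Ns \<eta>\<^sub>N P)"
    by (simp add: g' mate_def)
  also have "\<dots> = (\<one> N \<^bold>\<odot> remL Ns N \<epsilon>\<^sub>N (Q \<odot> Ms)) \<cdot> (insL N Ns \<eta>\<^sub>N (N \<odot> (Q \<odot> Ms)) \<cdot> ?u)"
    by (subst insL_natural[where z = ?u and Z = P, symmetric]) simp_all
  also have "\<dots> = ?u"
    using Comp_extend[OF zigzag_left[OF N, of "Q \<odot> Ms"] _ _ u(1)] by simp
  finally show ?thesis .
qed

lemma remR_mate:
  "remR Ms M \<epsilon>\<^sub>M Q \<cdot> (g' \<^bold>\<odot> \<one> M) = remL Ns N \<epsilon>\<^sub>N Q \<cdot> ((\<one> Ns \<^bold>\<odot> g) \<cdot> \<alpha> Ns P M)"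
proof -
  let ?v = "remL Ns N \<epsilon>\<^sub>N Q \<cdot> ((\<one> Ns \<^bold>\<odot> g) \<cdot> \<alpha> Ns P M)"
  have v: "?v \<in> Arr B" "Dom B ?v = (Ns \<odot> P) \<odot> M" "Cod B ?v = Q" by simp_all
  have "remR Ms M \<epsilon>\<^sub>M Q \<cdot> (g' \<^bold>\<odot> \<one> M)
      = (remR Ms M \<epsilon>\<^sub>M Q \<cdot> ((?v \<^bold>\<odot> \<one> Ms) \<^bold>\<odot> \<one> M)) \<cdot> (insR M Ms \<eta>\<^sub>M (Ns \<odot> P) \<^bold>\<odot> \<one> M)"
    by (simp add: mate_eq)
  also have "\<dots> = (?v \<cdot> remR Ms M \<epsilon>\<^sub>M ((Ns \<odot> P) \<odot> M)) \<cdot> (insR M Ms \<eta>\<^sub>M (Ns \<odot> P) \<^bold>\<odot> \<one> M)"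
    by (subst remR_natural[where x = ?v and X = "(Ns \<odot> P) \<odot> M"]) simp_all
  also have "\<dots> = ?v"
    by (simp add: zigzag_right[OF M])
  finally show ?thesis .
qed

text \<open>
  The two properties of the mate in a context, with \<open>Z\<close> on the right or \<open>X\<close> on the left, bracketed
  as they occur in transposes: first for the collapse, then for the expansion.
\<close>

lemma mate_insL_HComp:
  assumes [simp]: "Z \<in> Obj B" "Src B Z = Src B M"
  shows "(\<one> N \<^bold>\<odot> (\<alpha> Q Ms Z \<cdot> ((g' \<^bold>\<odot> \<one> Z) \<cdot> inv (\<alpha> Ns P Z)))) \<cdot> insL N Ns \<eta>\<^sub>N (P \<odot> Z)
    = \<alpha> N Q (Ms \<odot> Z) \<cdot> ((g \<^bold>\<odot> \<one> (Ms \<odot> Z)) \<cdot> (inv (\<alpha> P M (Ms \<odot> Z)) \<cdot> (\<one> P \<^bold>\<odot> insL M Ms \<eta>\<^sub>M Z)))"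
proof -
  have "(\<one> N \<^bold>\<odot> (\<alpha> Q Ms Z \<cdot> ((g' \<^bold>\<odot> \<one> Z) \<cdot> inv (\<alpha> Ns P Z)))) \<cdot> insL N Ns \<eta>\<^sub>N (P \<odot> Z)
      = (\<one> N \<^bold>\<odot> \<alpha> Q Ms Z) \<cdot> (\<alpha> N (Q \<odot> Ms) Z \<cdot> (((\<one> N \<^bold>\<odot> g') \<cdot> insL N Ns \<eta>\<^sub>N P) \<^bold>\<odot> \<one> Z))"
    by (simp add: insL_HComp[symmetric] Comp_extend[OF Assoc_nat2])
  also have "\<dots> = \<alpha> N Q (Ms \<odot> Z) \<cdot> ((g \<^bold>\<odot> \<one> (Ms \<odot> Z)) \<cdot> (\<alpha> (P \<odot> M) Ms Z \<cdot> (insR M Ms \<eta>\<^sub>M P \<^bold>\<odot> \<one> Z)))"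
    unfolding mate_insL by (simp add: Pentagon_extend Comp_extend[OF Assoc_nat1])
  also have "\<dots> = \<alpha> N Q (Ms \<odot> Z) \<cdot> ((g \<^bold>\<odot> \<one> (Ms \<odot> Z)) \<cdot> (inv (\<alpha> P M (Ms \<odot> Z)) \<cdot> (\<one> P \<^bold>\<odot> insL M Ms \<eta>\<^sub>M Z)))"
    by (simp add: insR_insL)
  finally show ?thesis .
qed

lemma remR_HComp_mate:
  assumes [simp]: "X \<in> Obj B" "Trg B X = Src B Q"
  shows "remR Ms M \<epsilon>\<^sub>M (X \<odot> Q) \<cdot> ((inv (\<alpha> X Q Ms) \<cdot> ((\<one> X \<^bold>\<odot> g') \<cdot> \<alpha> X Ns P)) \<^bold>\<odot> \<one> M)
    = (remR Ns N \<epsilon>\<^sub>N X \<^bold>\<odot> \<one> Q) \<cdot> (inv (\<alpha> (X \<odot> Ns) N Q) \<cdot> ((\<one> (X \<odot> Ns) \<^bold>\<odot> g) \<cdot> \<alpha> (X \<odot> Ns) P M))"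
proof -
  have "remR Ms M \<epsilon>\<^sub>M (X \<odot> Q) \<cdot> ((inv (\<alpha> X Q Ms) \<cdot> ((\<one> X \<^bold>\<odot> g') \<cdot> \<alpha> X Ns P)) \<^bold>\<odot> \<one> M)
      = (\<one> X \<^bold>\<odot> (remR Ms M \<epsilon>\<^sub>M Q \<cdot> (g' \<^bold>\<odot> \<one> M))) \<cdot> (\<alpha> X (Ns \<odot> P) M \<cdot> (\<alpha> X Ns P \<^bold>\<odot> \<one> M))"
    by (simp add: remR_HComp[symmetric] Comp_extend[OF Assoc_nat2])
  also have "\<dots> = (\<one> X \<^bold>\<odot> remL Ns N \<epsilon>\<^sub>N Q) \<cdot> ((\<one> X \<^bold>\<odot> (\<one> Ns \<^bold>\<odot> g)) \<cdot> (\<alpha> X Ns (P \<odot> M) \<cdot> \<alpha> (X \<odot> Ns) P M))"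
    unfolding remR_mate by (simp add: Pentagon)
  also have "\<dots> = ((\<one> X \<^bold>\<odot> remL Ns N \<epsilon>\<^sub>N Q) \<cdot> \<alpha> X Ns (N \<odot> Q)) \<cdot> ((\<one> (X \<odot> Ns) \<^bold>\<odot> g) \<cdot> \<alpha> (X \<odot> Ns) P M)"
    by (simp add: Comp_extend[OF Assoc_nat3])
  also have "\<dots> = (remR Ns N \<epsilon>\<^sub>N X \<^bold>\<odot> \<one> Q) \<cdot> (inv (\<alpha> (X \<odot> Ns) N Q) \<cdot> ((\<one> (X \<odot> Ns) \<^bold>\<odot> g) \<cdot> \<alpha> (X \<odot> Ns) P M))"
    by (subst remL_remR) simp_all
  finally show ?thesis .
qed

end

end

section \<open>Transposition in a closed bicategory\<close>

context closed_bicategory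
begin

lemma LHom_typing [simp]:
  assumes "P \<in> Obj B" "M \<in> Obj B" "Src B P = Src B M"
  shows "P \<triangleleft> M \<in> Obj B" "Src B (P \<triangleleft> M) = Trg B M" "Trg B (P \<triangleleft> M) = Trg B P"
  using LHom_in_Cell1[of P "Src B M" "Trg B P" M "Trg B M"] assms by (auto simp: Cell1_def)

lemma RHom_typing [simp]:
  assumes "P \<in> Obj B" "N \<in> Obj B" "Trg B N = Trg B P"
  shows "N \<triangleright> P \<in> Obj B" "Src B (N \<triangleright> P) = Src B P" "Trg B (N \<triangleright> P) = Src B N"
  using RHom_in_Cell1[of N "Src B N" "Trg B N" P "Src B P"] assms by (auto simp: Cell1_def)

lemma LHom2_typing [simp]:
  assumes "p \<in> Arr B" "m \<in> Arr B" "Src B (Dom B p) = Src B (Dom B m)"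
  shows "p \<^bold>\<triangleleft> m \<in> Arr B" "Dom B (p \<^bold>\<triangleleft> m) = Dom B p \<triangleleft> Cod B m" "Cod B (p \<^bold>\<triangleleft> m) = Cod B p \<triangleleft> Dom B m"
  using LHom2_in_Hom[of "Dom B p" "Src B (Dom B p)" "Trg B (Dom B p)" "Cod B m" "Trg B (Dom B m)" p "Cod B p" m "Dom B m"]
    assms by (auto simp: Cell1_def Hom_def)

lemma RHom2_typing [simp]:
  assumes "n \<in> Arr B" "p \<in> Arr B" "Trg B (Dom B n) = Trg B (Dom B p)"
  shows "n \<^bold>\<triangleright> p \<in> Arr B" "Dom B (n \<^bold>\<triangleright> p) = Cod B n \<triangleright> Dom B p" "Cod B (n \<^bold>\<triangleright> p) = Dom B n \<triangleright> Cod B p"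
  using RHom2_in_Hom[of "Cod B n" "Src B (Cod B n)" "Trg B (Cod B n)" "Dom B p" "Src B (Dom B p)" n "Dom B n" p "Cod B p"]
    assms by (auto simp: Cell1_def Hom_def)

lemma LHom2_Id' [simp]:
  "P \<in> Obj B \<Longrightarrow> M \<in> Obj B \<Longrightarrow> Src B P = Src B M \<Longrightarrow> \<one> P \<^bold>\<triangleleft> \<one> M = \<one> (P \<triangleleft> M)"
  using LHom2_Id[of P "Src B M" "Trg B P" M "Trg B M"] by (simp add: Cell1_def)

lemma RHom2_Id' [simp]:
  "P \<in> Obj B \<Longrightarrow> N \<in> Obj B \<Longrightarrow> Trg B N = Trg B P \<Longrightarrow> \<one> N \<^bold>\<triangleright> \<one> P = \<one> (N \<triangleright> P)"
  using RHom2_Id[of N "Src B N" "Trg B N" P "Src B P"] by (simp add: Cell1_def)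

lemma LHom2_interchange:
  assumes "p \<in> Arr B" "p' \<in> Arr B" "m \<in> Arr B" "m' \<in> Arr B" "Cod B p = Dom B p'" "Cod B m' = Dom B m"
    and "Src B (Dom B p) = Src B (Dom B m)"
  shows "(p' \<^bold>\<triangleleft> m') \<cdot> (p \<^bold>\<triangleleft> m) = (p' \<cdot> p) \<^bold>\<triangleleft> (m \<cdot> m')"
  using LHom2_Comp[of "Dom B p" "Src B (Dom B p)" "Trg B (Dom B p)" "Cod B m" "Trg B (Dom B m)"
      p "Cod B p" p' "Cod B p'" m "Dom B m" m' "Dom B m'"] assms
  by (simp add: Cell1_def Hom_def)

lemma RHom2_interchange:
  assumes "p \<in> Arr B" "p' \<in> Arr B" "n \<in> Arr B" "n' \<in> Arr B" "Cod B p = Dom B p'" "Cod B n' = Dom B n"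
    and "Trg B (Dom B p) = Trg B (Dom B n)"
  shows "(n' \<^bold>\<triangleright> p') \<cdot> (n \<^bold>\<triangleright> p) = (n \<cdot> n') \<^bold>\<triangleright> (p' \<cdot> p)"
  using RHom2_Comp[of "Cod B n" "Src B (Cod B n)" "Trg B (Cod B n)" "Dom B p" "Src B (Dom B p)"
      n "Dom B n" n' "Dom B n'" p "Cod B p" p' "Cod B p'"] assms
  by (simp add: Cell1_def Hom_def)

lemma LTr_bij':
  assumes "M \<in> Obj B" "N \<in> Obj B" "P \<in> Obj B" "Trg B M = Src B N" "Src B P = Src B M" "Trg B P = Trg B N"
  shows "bij_betw (LTr B M N) (Hom (M \<odot> N) P) (Hom N (P \<triangleleft> M))"
  using LTr_bij[of M "Src B M" "Trg B M" N "Trg B N" P] assms by (simp add: Cell1_def)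

lemma RTr_bij':
  assumes "M \<in> Obj B" "N \<in> Obj B" "P \<in> Obj B" "Trg B M = Src B N" "Src B P = Src B M" "Trg B P = Trg B N"
  shows "bij_betw (RTr B M N) (Hom (M \<odot> N) P) (Hom M (N \<triangleright> P))"
  using RTr_bij[of M "Src B M" "Trg B M" N "Trg B N" P] assms by (simp add: Cell1_def)

lemma LTr_typing [simp]:
  assumes "k \<in> Arr B" "Dom B k = M \<odot> N" "M \<in> Obj B" "N \<in> Obj B" "Trg B M = Src B N"
  shows "LTr B M N k \<in> Arr B" "Dom B (LTr B M N k) = N" "Cod B (LTr B M N k) = Cod B k \<triangleleft> M"
proof -
  have "Src B (Cod B k) = Src B M" "Trg B (Cod B k) = Trg B N" using assms by simp_all
  then have "LTr B M N k \<in> Hom N (Cod B k \<triangleleft> M)"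
    using bij_betwE[OF LTr_bij'[of M N "Cod B k"]] assms by (auto simp: Hom_def)
  then show "LTr B M N k \<in> Arr B" "Dom B (LTr B M N k) = N" "Cod B (LTr B M N k) = Cod B k \<triangleleft> M"
    by (simp_all add: Hom_def)
qed

lemma RTr_typing [simp]:
  assumes "k \<in> Arr B" "Dom B k = M \<odot> N" "M \<in> Obj B" "N \<in> Obj B" "Trg B M = Src B N"
  shows "RTr B M N k \<in> Arr B" "Dom B (RTr B M N k) = M" "Cod B (RTr B M N k) = N \<triangleright> Cod B k"
proof -
  have "Src B (Cod B k) = Src B M" "Trg B (Cod B k) = Trg B N" using assms by simp_all
  then have "RTr B M N k \<in> Hom M (N \<triangleright> Cod B k)"
    using bij_betwE[OF RTr_bij'[of M N "Cod B k"]] assms by (auto simp: Hom_def)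
  then show "RTr B M N k \<in> Arr B" "Dom B (RTr B M N k) = M" "Cod B (RTr B M N k) = N \<triangleright> Cod B k"
    by (simp_all add: Hom_def)
qed

lemma evL_properties:
  assumes [simp]: "M \<in> Obj B" "P \<in> Obj B" "Src B P = Src B M"
  shows "evL B M P \<in> Hom (M \<odot> (P \<triangleleft> M)) P" "LTr B M (P \<triangleleft> M) (evL B M P) = \<one> (P \<triangleleft> M)"
proof -
  have b: "bij_betw (LTr B M (P \<triangleleft> M)) (Hom (M \<odot> (P \<triangleleft> M)) P) (Hom (P \<triangleleft> M) (P \<triangleleft> M))"
    by (rule LTr_bij') simp_all
  have i: "\<one> (P \<triangleleft> M) \<in> Hom (P \<triangleleft> M) (P \<triangleleft> M)" by (simp add: Hom_def)
  show "evL B M P \<in> Hom (M \<odot> (P \<triangleleft> M)) P"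
    unfolding evL_def using bij_betwE[OF bij_betw_the_inv_into[OF b]] i by blast
  show "LTr B M (P \<triangleleft> M) (evL B M P) = \<one> (P \<triangleleft> M)"
    unfolding evL_def by (rule f_the_inv_into_f_bij_betw[OF b]) (use i in simp)
qed

lemma evR_properties:
  assumes [simp]: "N \<in> Obj B" "P \<in> Obj B" "Trg B N = Trg B P"
  shows "evR B N P \<in> Hom ((N \<triangleright> P) \<odot> N) P" "RTr B (N \<triangleright> P) N (evR B N P) = \<one> (N \<triangleright> P)"
proof -
  have b: "bij_betw (RTr B (N \<triangleright> P) N) (Hom ((N \<triangleright> P) \<odot> N) P) (Hom (N \<triangleright> P) (N \<triangleright> P))"
    by (rule RTr_bij') simp_all
  have i: "\<one> (N \<triangleright> P) \<in> Hom (N \<triangleright> P) (N \<triangleright> P)" by (simp add: Hom_def)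
  show "evR B N P \<in> Hom ((N \<triangleright> P) \<odot> N) P"
    unfolding evR_def using bij_betwE[OF bij_betw_the_inv_into[OF b]] i by blast
  show "RTr B (N \<triangleright> P) N (evR B N P) = \<one> (N \<triangleright> P)"
    unfolding evR_def by (rule f_the_inv_into_f_bij_betw[OF b]) (use i in simp)
qed

lemma evL_typing [simp]:
  assumes "M \<in> Obj B" "P \<in> Obj B" "Src B P = Src B M"
  shows "evL B M P \<in> Arr B" "Dom B (evL B M P) = M \<odot> (P \<triangleleft> M)" "Cod B (evL B M P) = P"
  using evL_properties(1)[OF assms] by (simp_all add: Hom_def)

lemma evR_typing [simp]:
  assumes "N \<in> Obj B" "P \<in> Obj B" "Trg B N = Trg B P"
  shows "evR B N P \<in> Arr B" "Dom B (evR B N P) = (N \<triangleright> P) \<odot> N" "Cod B (evR B N P) = P"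
  using evR_properties(1)[OF assms] by (simp_all add: Hom_def)

text \<open>
  Untransposing, written as evaluation after whiskering so that its naturality in the generalized
  element \<open>h\<close> is visible. The 1-cells \<open>M\<close> and \<open>P\<close> are passed because \<open>P \<triangleleft> M\<close> does not determine them.
\<close>

definition uncL :: "'a \<Rightarrow> 'a \<Rightarrow> 'b \<Rightarrow> 'b" where
  "uncL M P h = evL B M P \<cdot> (\<one> M \<^bold>\<odot> h)"

definition uncR :: "'a \<Rightarrow> 'a \<Rightarrow> 'b \<Rightarrow> 'b" where
  "uncR N P h = evR B N P \<cdot> (h \<^bold>\<odot> \<one> N)"

lemma uncL_typing [simp]:
  assumes "h \<in> Arr B" "Cod B h = P \<triangleleft> M" "M \<in> Obj B" "P \<in> Obj B" "Src B P = Src B M"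
  shows "uncL M P h \<in> Arr B" "Dom B (uncL M P h) = M \<odot> Dom B h" "Cod B (uncL M P h) = P"
  using assms Obj_typing(5)[of h] by (simp_all add: uncL_def)

lemma uncR_typing [simp]:
  assumes "h \<in> Arr B" "Cod B h = N \<triangleright> P" "N \<in> Obj B" "P \<in> Obj B" "Trg B N = Trg B P"
  shows "uncR N P h \<in> Arr B" "Dom B (uncR N P h) = Dom B h \<odot> N" "Cod B (uncR N P h) = P"
  using assms Obj_typing(6)[of h] by (simp_all add: uncR_def)

lemma LTr_nat:
  assumes "h \<in> Arr B" "Dom B h = M \<odot> N" "M \<in> Obj B" "N \<in> Obj B" "Trg B M = Src B N"
    and "p \<in> Arr B" "Dom B p = Cod B h" "m \<in> Arr B" "Cod B m = M" "n \<in> Arr B" "Cod B n = N"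
  shows "LTr B (Dom B m) (Dom B n) (p \<cdot> (h \<cdot> (m \<^bold>\<odot> n))) = (p \<^bold>\<triangleleft> m) \<cdot> (LTr B M N h \<cdot> n)"
proof -
  have [simp]: "Src B (Cod B h) = Src B M" "Trg B (Cod B h) = Trg B N" using assms by simp_all
  have [simp]: "Trg B (Dom B m) = Trg B M" "Src B (Dom B n) = Src B N" "Src B (Dom B m) = Src B M"
    using assms(8-11) Obj_typing(5,6)[of m] Obj_typing(5,6)[of n] by simp_all
  show ?thesis
    using LTr_natural[of M "Src B M" "Trg B M" N "Trg B N" "Cod B h" m "Dom B m" n "Dom B n" p "Cod B p" h] assms
    by (simp add: Cell1_def Hom_def)
qed

lemma RTr_nat:
  assumes "h \<in> Arr B" "Dom B h = M \<odot> N" "M \<in> Obj B" "N \<in> Obj B" "Trg B M = Src B N"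
    and "p \<in> Arr B" "Dom B p = Cod B h" "m \<in> Arr B" "Cod B m = M" "n \<in> Arr B" "Cod B n = N"
  shows "RTr B (Dom B m) (Dom B n) (p \<cdot> (h \<cdot> (m \<^bold>\<odot> n))) = (n \<^bold>\<triangleright> p) \<cdot> (RTr B M N h \<cdot> m)"
proof -
  have [simp]: "Src B (Cod B h) = Src B M" "Trg B (Cod B h) = Trg B N" using assms by simp_all
  have [simp]: "Trg B (Dom B m) = Trg B M" "Src B (Dom B n) = Src B N" "Trg B (Dom B n) = Trg B N"
    using assms(8-11) Obj_typing(5,6)[of m] Obj_typing(5,6)[of n] by simp_all
  show ?thesis
    using RTr_natural[of M "Src B M" "Trg B M" N "Trg B N" "Cod B h" m "Dom B m" n "Dom B n" p "Cod B p" h] assms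
    by (simp add: Cell1_def Hom_def)
qed

lemma LTr_uncL [simp]:
  assumes "h \<in> Arr B" "Dom B h = X" "Cod B h = P \<triangleleft> M" "M \<in> Obj B" "P \<in> Obj B" "Src B P = Src B M"
  shows "LTr B M X (uncL M P h) = h"
proof -
  note [simp] = assms
  have [simp]: "Src B X = Trg B M" "X \<in> Obj B" using Obj_typing(1,5)[of h] by simp_all
  have "LTr B (Dom B (\<one> M)) (Dom B h) (\<one> P \<cdot> (evL B M P \<cdot> (\<one> M \<^bold>\<odot> h)))
      = (\<one> P \<^bold>\<triangleleft> \<one> M) \<cdot> (LTr B M (P \<triangleleft> M) (evL B M P) \<cdot> h)"
    by (rule LTr_nat) simp_all
  then show ?thesis by (simp add: uncL_def evL_properties)
qed

lemma RTr_uncR [simp]: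
  assumes "h \<in> Arr B" "Dom B h = X" "Cod B h = N \<triangleright> P" "N \<in> Obj B" "P \<in> Obj B" "Trg B N = Trg B P"
  shows "RTr B X N (uncR N P h) = h"
proof -
  note [simp] = assms
  have [simp]: "Trg B X = Src B N" "X \<in> Obj B" using Obj_typing(1,6)[of h] by simp_all
  have "RTr B (Dom B h) (Dom B (\<one> N)) (\<one> P \<cdot> (evR B N P \<cdot> (h \<^bold>\<odot> \<one> N)))
      = (\<one> N \<^bold>\<triangleright> \<one> P) \<cdot> (RTr B (N \<triangleright> P) N (evR B N P) \<cdot> h)"
    by (rule RTr_nat) simp_all
  then show ?thesis by (simp add: uncR_def evR_properties)
qed

lemma uncL_LTr [simp]:
  assumes "k \<in> Arr B" "Dom B k = M \<odot> X" "Cod B k = P" "M \<in> Obj B" "X \<in> Obj B" "Trg B M = Src B X"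
  shows "uncL M P (LTr B M X k) = k"
proof (rule inj_onD[OF bij_betw_imp_inj_on[OF LTr_bij']])
  have [simp]: "P \<in> Obj B" "Src B P = Src B M" "Trg B P = Trg B X"
    using assms Obj_typing(2,5,6)[of k] by simp_all
  show "LTr B M X (uncL M P (LTr B M X k)) = LTr B M X k" using assms by simp
  show "P \<in> Obj B" "Src B P = Src B M" "Trg B P = Trg B X" by simp_all
  show "uncL M P (LTr B M X k) \<in> Hom (M \<odot> X) P" using assms by (simp add: Hom_def)
qed (use assms in \<open>simp_all add: Hom_def\<close>)

lemma uncR_RTr [simp]:
  assumes "k \<in> Arr B" "Dom B k = X \<odot> N" "Cod B k = P" "N \<in> Obj B" "X \<in> Obj B" "Trg B X = Src B N"
  shows "uncR N P (RTr B X N k) = k"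
proof (rule inj_onD[OF bij_betw_imp_inj_on[OF RTr_bij']])
  have [simp]: "P \<in> Obj B" "Src B P = Src B X" "Trg B P = Trg B N"
    using assms Obj_typing(2,5,6)[of k] by simp_all
  show "RTr B X N (uncR N P (RTr B X N k)) = RTr B X N k" using assms by simp
  show "P \<in> Obj B" "Src B P = Src B X" "Trg B P = Trg B N" by simp_all
  show "uncR N P (RTr B X N k) \<in> Hom (X \<odot> N) P" using assms by (simp add: Hom_def)
qed (use assms in \<open>simp_all add: Hom_def\<close>)

lemma uncL_inject:
  assumes "uncL M P h = uncL M P h'" "h \<in> Arr B" "h' \<in> Arr B" "Dom B h = Dom B h'"
    and "Cod B h = P \<triangleleft> M" "Cod B h' = P \<triangleleft> M" "M \<in> Obj B" "P \<in> Obj B" "Src B P = Src B M"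
  shows "h = h'"
proof -
  have "h = LTr B M (Dom B h) (uncL M P h)" using assms(2-) by simp
  also have "\<dots> = LTr B M (Dom B h') (uncL M P h')" by (simp only: assms(1,4))
  also have "\<dots> = h'" using assms(2-) by simp
  finally show ?thesis .
qed

lemma uncR_inject:
  assumes "uncR N P h = uncR N P h'" "h \<in> Arr B" "h' \<in> Arr B" "Dom B h = Dom B h'"
    and "Cod B h = N \<triangleright> P" "Cod B h' = N \<triangleright> P" "N \<in> Obj B" "P \<in> Obj B" "Trg B N = Trg B P"
  shows "h = h'"
proof -
  have "h = RTr B (Dom B h) N (uncR N P h)" using assms(2-) by simp
  also have "\<dots> = RTr B (Dom B h') N (uncR N P h')" by (simp only: assms(1,4))
  also have "\<dots> = h'" using assms(2-) by simp
  finally show ?thesis .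
qed

lemma uncL_Comp:
  assumes "h \<in> Arr B" "x \<in> Arr B" "Cod B x = Dom B h" "Cod B h = P \<triangleleft> M" "M \<in> Obj B" "P \<in> Obj B" "Src B P = Src B M"
  shows "uncL M P (h \<cdot> x) = uncL M P h \<cdot> (\<one> M \<^bold>\<odot> x)"
proof -
  have "Src B (Dom B h) = Trg B M" "Src B (Dom B x) = Trg B M"
    using assms Obj_typing(5)[of h] Obj_typing(5)[of x] by simp_all
  then show ?thesis using assms by (simp add: uncL_def)
qed

lemma uncR_Comp:
  assumes "h \<in> Arr B" "x \<in> Arr B" "Cod B x = Dom B h" "Cod B h = N \<triangleright> P" "N \<in> Obj B" "P \<in> Obj B" "Trg B N = Trg B P"
  shows "uncR N P (h \<cdot> x) = uncR N P h \<cdot> (x \<^bold>\<odot> \<one> N)"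
proof -
  have "Trg B (Dom B h) = Src B N" "Trg B (Dom B x) = Src B N"
    using assms Obj_typing(6)[of h] Obj_typing(6)[of x] by simp_all
  then show ?thesis using assms by (simp add: uncR_def)
qed

text \<open>
  Untransposing turns the functoriality of \<open>\<triangleleft>\<close> into composition with \<open>p\<close> and whiskering of \<open>m\<close>: this
  is the naturality of transposition in all variables.
\<close>

lemma uncL_LHom2:
  assumes "p \<in> Arr B" "m \<in> Arr B" "Dom B p = P" "Cod B p = P'" "Dom B m = M'" "Cod B m = M"
    and "Src B P = Src B M" "h \<in> Arr B" "Cod B h = P \<triangleleft> M"
  shows "uncL M' P' ((p \<^bold>\<triangleleft> m) \<cdot> h) = p \<cdot> (uncL M P h \<cdot> (m \<^bold>\<odot> \<one> (Dom B h)))"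
proof -
  note [simp] = assms
  have [simp]: "M \<in> Obj B" "P \<in> Obj B" "M' \<in> Obj B" "P' \<in> Obj B"
    "Src B M' = Src B M" "Trg B M' = Trg B M" "Src B P' = Src B M" "Trg B P' = Trg B P"
    using Obj_typing(1,2,5,6)[of m] Obj_typing(1,2,5,6)[of p] by simp_all
  have [simp]: "Src B (Dom B h) = Trg B M" "Trg B (Dom B h) = Trg B P"
    using Obj_typing(5,6)[of h] by simp_all
  have "LTr B (Dom B m) (Dom B (\<one> (Dom B h))) (p \<cdot> (uncL M P h \<cdot> (m \<^bold>\<odot> \<one> (Dom B h))))
      = (p \<^bold>\<triangleleft> m) \<cdot> (LTr B M (Dom B h) (uncL M P h) \<cdot> \<one> (Dom B h))"
    by (rule LTr_nat) simp_all
  then have "(p \<^bold>\<triangleleft> m) \<cdot> h = LTr B M' (Dom B h) (p \<cdot> (uncL M P h \<cdot> (m \<^bold>\<odot> \<one> (Dom B h))))"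
    by simp
  then show ?thesis by simp
qed

lemma uncR_RHom2:
  assumes "p \<in> Arr B" "n \<in> Arr B" "Dom B p = P" "Cod B p = P'" "Dom B n = N'" "Cod B n = N"
    and "Trg B P = Trg B N" "h \<in> Arr B" "Cod B h = N \<triangleright> P"
  shows "uncR N' P' ((n \<^bold>\<triangleright> p) \<cdot> h) = p \<cdot> (uncR N P h \<cdot> (\<one> (Dom B h) \<^bold>\<odot> n))"
proof -
  note [simp] = assms
  have [simp]: "N \<in> Obj B" "P \<in> Obj B" "N' \<in> Obj B" "P' \<in> Obj B"
    "Src B N' = Src B N" "Trg B N' = Trg B N" "Src B P' = Src B P" "Trg B P' = Trg B N"
    using Obj_typing(1,2,5,6)[of n] Obj_typing(1,2,5,6)[of p] by simp_all
  have [simp]: "Trg B (Dom B h) = Src B N" "Src B (Dom B h) = Src B P"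
    using Obj_typing(5,6)[of h] by simp_all
  have "RTr B (Dom B (\<one> (Dom B h))) (Dom B n) (p \<cdot> (uncR N P h \<cdot> (\<one> (Dom B h) \<^bold>\<odot> n)))
      = (n \<^bold>\<triangleright> p) \<cdot> (RTr B (Dom B h) N (uncR N P h) \<cdot> \<one> (Dom B h))"
    by (rule RTr_nat) simp_all
  then have "(n \<^bold>\<triangleright> p) \<cdot> h = RTr B (Dom B h) N' (p \<cdot> (uncR N P h \<cdot> (\<one> (Dom B h) \<^bold>\<odot> n)))"
    by simp
  then show ?thesis by simp
qed

end

section \<open>The canonical 2-cells\<close>

text \<open>
  The canonical 2-cells are defined as iterated transposes. Untransposing a composite of one of
  them with a generalized element \<open>h\<close> therefore gives back the untransposed \<open>h\<close>, up to an associator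
  or unitor. By Yoneda these formulas determine the 2-cells, and what follows is derived from them.
\<close>

context closed_bicategory
begin

lemma uncL_uncL_tL:
  assumes [simp]: "M \<in> Obj B" "N \<in> Obj B" "P \<in> Obj B" "Trg B M = Src B N" "Src B P = Src B M"
  shows tL_typing [simp]: "tL B M N P \<in> Arr B" "Dom B (tL B M N P) = P \<triangleleft> (M \<odot> N)"
      "Cod B (tL B M N P) = (P \<triangleleft> M) \<triangleleft> N"
    and "uncL M P (uncL N (P \<triangleleft> M) (tL B M N P)) = evL B (M \<odot> N) P \<cdot> inv (\<alpha> M N (P \<triangleleft> (M \<odot> N)))"
proof -
  define X where "X = P \<triangleleft> (M \<odot> N)"
  have [simp]: "X \<in> Obj B" "Src B X = Trg B N" "Trg B X = Trg B P"
    by (simp_all add: X_def)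
  define k where "k = evL B (M \<odot> N) P \<cdot> inv (\<alpha> M N X)"
  have [simp]: "k \<in> Arr B" "Dom B k = M \<odot> (N \<odot> X)" "Cod B k = P"
    by (simp_all add: k_def X_def)
  have t: "tL B M N P = LTr B N X (LTr B M (N \<odot> X) k)"
    by (simp only: tL_def Let_def k_def X_def)
  show "tL B M N P \<in> Arr B" "Dom B (tL B M N P) = P \<triangleleft> (M \<odot> N)"
      "Cod B (tL B M N P) = (P \<triangleleft> M) \<triangleleft> N"
    unfolding t X_def[symmetric] by simp_all
  have "uncL M P (uncL N (P \<triangleleft> M) (tL B M N P)) = k"
    unfolding t by simp
  then show "uncL M P (uncL N (P \<triangleleft> M) (tL B M N P)) = evL B (M \<odot> N) P \<cdot> inv (\<alpha> M N (P \<triangleleft> (M \<odot> N)))"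
    by (simp only: k_def X_def)
qed

lemma uncR_uncR_tR:
  assumes [simp]: "M \<in> Obj B" "N \<in> Obj B" "P \<in> Obj B" "Trg B M = Src B N" "Trg B N = Trg B P"
  shows tR_typing [simp]: "tR B M N P \<in> Arr B" "Dom B (tR B M N P) = (M \<odot> N) \<triangleright> P"
      "Cod B (tR B M N P) = M \<triangleright> (N \<triangleright> P)"
    and "uncR N P (uncR M (N \<triangleright> P) (tR B M N P)) = evR B (M \<odot> N) P \<cdot> \<alpha> ((M \<odot> N) \<triangleright> P) M N"
proof -
  define X where "X = (M \<odot> N) \<triangleright> P"
  have [simp]: "X \<in> Obj B" "Src B X = Src B P" "Trg B X = Src B M"
    by (simp_all add: X_def)
  define k where "k = evR B (M \<odot> N) P \<cdot> \<alpha> X M N"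
  have [simp]: "k \<in> Arr B" "Dom B k = (X \<odot> M) \<odot> N" "Cod B k = P"
    by (simp_all add: k_def X_def)
  have t: "tR B M N P = RTr B X M (RTr B (X \<odot> M) N k)"
    by (simp only: tR_def Let_def k_def X_def)
  show "tR B M N P \<in> Arr B" "Dom B (tR B M N P) = (M \<odot> N) \<triangleright> P"
      "Cod B (tR B M N P) = M \<triangleright> (N \<triangleright> P)"
    unfolding t X_def[symmetric] by simp_all
  have "uncR N P (uncR M (N \<triangleright> P) (tR B M N P)) = k"
    unfolding t by simp
  then show "uncR N P (uncR M (N \<triangleright> P) (tR B M N P)) = evR B (M \<odot> N) P \<cdot> \<alpha> ((M \<odot> N) \<triangleright> P) M N"
    by (simp only: k_def X_def)
qed

lemma uncL_uncR_aLR: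
  assumes [simp]: "N \<in> Obj B" "P \<in> Obj B" "M \<in> Obj B" "Trg B N = Trg B P" "Src B P = Src B M"
  shows aLR_typing [simp]: "aLR B N P M \<in> Arr B" "Dom B (aLR B N P M) = (N \<triangleright> P) \<triangleleft> M"
      "Cod B (aLR B N P M) = N \<triangleright> (P \<triangleleft> M)"
    and "uncL M P (uncR N (P \<triangleleft> M) (aLR B N P M))
      = evR B N P \<cdot> ((evL B M (N \<triangleright> P) \<^bold>\<odot> \<one> N) \<cdot> inv (\<alpha> M ((N \<triangleright> P) \<triangleleft> M) N))"
proof -
  define X where "X = (N \<triangleright> P) \<triangleleft> M"
  have [simp]: "X \<in> Obj B" "Src B X = Trg B M" "Trg B X = Src B N"
    by (simp_all add: X_def)
  define e where "e = evL B M (N \<triangleright> P)"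
  have [simp]: "e \<in> Arr B" "Dom B e = M \<odot> X" "Cod B e = N \<triangleright> P"
    by (simp_all add: e_def X_def)
  define k where "k = evR B N P \<cdot> ((e \<^bold>\<odot> \<one> N) \<cdot> inv (\<alpha> M X N))"
  have k': "k = evR B N P \<cdot> (e \<^bold>\<odot> \<one> N) \<cdot> inv (\<alpha> M X N)"
    by (simp add: k_def)
  have [simp]: "k \<in> Arr B" "Dom B k = M \<odot> (X \<odot> N)" "Cod B k = P"
    by (simp_all add: k_def)
  have t: "aLR B N P M = RTr B X N (LTr B M (X \<odot> N) k)"
    unfolding k' by (simp only: aLR_def Let_def e_def X_def)
  show "aLR B N P M \<in> Arr B" "Dom B (aLR B N P M) = (N \<triangleright> P) \<triangleleft> M"
      "Cod B (aLR B N P M) = N \<triangleright> (P \<triangleleft> M)"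
    unfolding t X_def[symmetric] by simp_all
  have "uncL M P (uncR N (P \<triangleleft> M) (aLR B N P M)) = k"
    unfolding t by simp
  then show "uncL M P (uncR N (P \<triangleleft> M) (aLR B N P M))
      = evR B N P \<cdot> ((evL B M (N \<triangleright> P) \<^bold>\<odot> \<one> N) \<cdot> inv (\<alpha> M ((N \<triangleright> P) \<triangleleft> M) N))"
    by (simp only: k_def e_def X_def)
qed

lemma lbar_typing [simp]:
  assumes [simp]: "M \<in> Obj B"
  shows "lbar B M \<in> Arr B" "Dom B (lbar B M) = M" "Cod B (lbar B M) = M \<triangleleft> U (Src B M)"
  by (simp_all add: lbar_def)

lemma rbar_typing [simp]:
  assumes [simp]: "M \<in> Obj B"
  shows "rbar B M \<in> Arr B" "Dom B (rbar B M) = M" "Cod B (rbar B M) = U (Trg B M) \<triangleright> M"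
  by (simp_all add: rbar_def)

lemma uncL_tL:
  assumes "M \<in> Obj B" "N \<in> Obj B" "P \<in> Obj B" "Trg B M = Src B N" "Src B P = Src B M"
    and "h \<in> Arr B" "Cod B h = P \<triangleleft> (M \<odot> N)"
  shows "uncL M P (uncL N (P \<triangleleft> M) (tL B M N P \<cdot> h)) = uncL (M \<odot> N) P h \<cdot> inv (\<alpha> M N (Dom B h))"
proof -
  note [simp] = assms
  have [simp]: "Src B (Dom B h) = Trg B N" "Trg B (Dom B h) = Trg B P"
    using Obj_typing(5,6)[of h] by simp_all
  have "uncL M P (uncL N (P \<triangleleft> M) (tL B M N P \<cdot> h))
      = evL B (M \<odot> N) P \<cdot> (inv (\<alpha> M N (P \<triangleleft> (M \<odot> N))) \<cdot> (\<one> M \<^bold>\<odot> (\<one> N \<^bold>\<odot> h)))"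
    by (simp add: uncL_Comp uncL_uncL_tL)
  also have "\<dots> = uncL (M \<odot> N) P h \<cdot> inv (\<alpha> M N (Dom B h))"
    by (simp add: uncL_def Assoc_inv_nat3)
  finally show ?thesis .
qed

lemma uncR_tR:
  assumes "M \<in> Obj B" "N \<in> Obj B" "P \<in> Obj B" "Trg B M = Src B N" "Trg B N = Trg B P"
    and "h \<in> Arr B" "Cod B h = (M \<odot> N) \<triangleright> P"
  shows "uncR N P (uncR M (N \<triangleright> P) (tR B M N P \<cdot> h)) = uncR (M \<odot> N) P h \<cdot> \<alpha> (Dom B h) M N"
proof -
  note [simp] = assms
  have [simp]: "Trg B (Dom B h) = Src B M" "Src B (Dom B h) = Src B P"
    using Obj_typing(5,6)[of h] by simp_all
  have "uncR N P (uncR M (N \<triangleright> P) (tR B M N P \<cdot> h))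
      = evR B (M \<odot> N) P \<cdot> (\<alpha> ((M \<odot> N) \<triangleright> P) M N \<cdot> ((h \<^bold>\<odot> \<one> M) \<^bold>\<odot> \<one> N))"
    by (simp add: uncR_Comp uncR_uncR_tR)
  also have "\<dots> = uncR (M \<odot> N) P h \<cdot> \<alpha> (Dom B h) M N"
    by (simp add: uncR_def Assoc_nat1)
  finally show ?thesis .
qed

lemma uncL_aLR:
  assumes "N \<in> Obj B" "P \<in> Obj B" "M \<in> Obj B" "Trg B N = Trg B P" "Src B P = Src B M"
    and "h \<in> Arr B" "Cod B h = (N \<triangleright> P) \<triangleleft> M"
  shows "uncL M P (uncR N (P \<triangleleft> M) (aLR B N P M \<cdot> h)) = uncR N P (uncL M (N \<triangleright> P) h) \<cdot> inv (\<alpha> M (Dom B h) N)"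
proof -
  note [simp] = assms
  have [simp]: "Src B (Dom B h) = Trg B M" "Trg B (Dom B h) = Src B N"
    using Obj_typing(5,6)[of h] by simp_all
  have "uncL M P (uncR N (P \<triangleleft> M) (aLR B N P M \<cdot> h))
      = evR B N P \<cdot> ((evL B M (N \<triangleright> P) \<^bold>\<odot> \<one> N) \<cdot> (inv (\<alpha> M ((N \<triangleright> P) \<triangleleft> M) N) \<cdot> (\<one> M \<^bold>\<odot> (h \<^bold>\<odot> \<one> N))))"
    by (simp add: uncL_Comp uncR_Comp uncL_uncR_aLR)
  also have "\<dots> = uncR N P (uncL M (N \<triangleright> P) h) \<cdot> inv (\<alpha> M (Dom B h) N)"
    by (simp add: uncL_def uncR_def Assoc_inv_nat2)
  finally show ?thesis .
qed

lemma uncL_lbar: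
  assumes "P \<in> Obj B" "h \<in> Arr B" "Cod B h = P" "R = Src B P"
  shows "uncL (U R) P (lbar B P \<cdot> h) = h \<cdot> \<l> (Dom B h)"
proof -
  note [simp] = assms
  have [simp]: "Src B (Dom B h) = Src B P" "Trg B (Dom B h) = Trg B P"
    using Obj_typing(5,6)[of h] by simp_all
  show ?thesis by (simp add: uncL_Comp lbar_def LUnitor_nat)
qed

lemma uncR_rbar:
  assumes "P \<in> Obj B" "h \<in> Arr B" "Cod B h = P" "R = Trg B P"
  shows "uncR (U R) P (rbar B P \<cdot> h) = h \<cdot> \<r> (Dom B h)"
proof -
  note [simp] = assms
  have [simp]: "Src B (Dom B h) = Src B P" "Trg B (Dom B h) = Trg B P"
    using Obj_typing(5,6)[of h] by simp_all
  show ?thesis by (simp add: uncR_Comp rbar_def RUnitor_nat)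
qed

text \<open>
  Each canonical 2-cell is invertible because, by the formulas above, composing with it is a
  bijection on generalized elements; a right inverse is found by transposing an identity.
\<close>

lemma tL_iso [simp]:
  assumes [simp]: "M \<in> Obj B" "N \<in> Obj B" "P \<in> Obj B" "Trg B M = Src B N" "Src B P = Src B M"
  shows "iso_arrow B (tL B M N P)"
proof (rule iso_arrow_if_retraction_mono)
  define Y where "Y = (P \<triangleleft> M) \<triangleleft> N"
  have [simp]: "Y \<in> Obj B" "Src B Y = Trg B N" "Trg B Y = Trg B P" by (simp_all add: Y_def)
  define y where "y = \<one> Y"
  have [simp]: "y \<in> Arr B" "Dom B y = Y" "Cod B y = (P \<triangleleft> M) \<triangleleft> N"
    unfolding y_def by (simp_all add: Y_def)
  define u where "u = uncL M P (uncL N (P \<triangleleft> M) y)"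
  have [simp]: "u \<in> Arr B" "Dom B u = M \<odot> (N \<odot> Y)" "Cod B u = P" by (simp_all add: u_def)
  define k where "k = LTr B (M \<odot> N) Y (u \<cdot> \<alpha> M N Y)"
  have k [simp]: "k \<in> Arr B" "Dom B k = Y" "Cod B k = P \<triangleleft> (M \<odot> N)"
    and u: "uncL (M \<odot> N) P k = u \<cdot> \<alpha> M N Y" by (simp_all add: k_def)
  have "uncL M P (uncL N (P \<triangleleft> M) (tL B M N P \<cdot> k)) = uncL M P (uncL N (P \<triangleleft> M) y)"
    using u by (simp add: uncL_tL flip: u_def)
  then have "uncL N (P \<triangleleft> M) (tL B M N P \<cdot> k) = uncL N (P \<triangleleft> M) y"
    by (rule uncL_inject) simp_all
  then have "tL B M N P \<cdot> k = y"
    by (rule uncL_inject) simp_all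
  then show "tL B M N P \<cdot> k = \<one> (Cod B (tL B M N P))" by (simp add: y_def Y_def)
  show "k \<in> Arr B" "Dom B k = Cod B (tL B M N P)" "Cod B k = Dom B (tL B M N P)"
    by (simp_all add: Y_def)
next
  fix x y
  define X where "X = P \<triangleleft> (M \<odot> N)"
  have [simp]: "X \<in> Obj B" "Src B X = Trg B N" "Trg B X = Trg B P" by (simp_all add: X_def)
  assume "x \<in> Hom (Dom B (tL B M N P)) (Dom B (tL B M N P))" "y \<in> Hom (Dom B (tL B M N P)) (Dom B (tL B M N P))"
    and eq: "tL B M N P \<cdot> x = tL B M N P \<cdot> y"
  then have [simp]: "x \<in> Arr B" "y \<in> Arr B" "Dom B x = X" "Cod B x = P \<triangleleft> (M \<odot> N)"
    "Dom B y = X" "Cod B y = P \<triangleleft> (M \<odot> N)"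
    by (simp_all add: Hom_def X_def)
  have "uncL (M \<odot> N) P x \<cdot> inv (\<alpha> M N X) = uncL (M \<odot> N) P y \<cdot> inv (\<alpha> M N X)"
    using uncL_tL[of M N P x] uncL_tL[of M N P y] unfolding eq by simp
  then have "uncL (M \<odot> N) P x = uncL (M \<odot> N) P y" 
    by (rule iso_right_cancel[rotated]) simp_all
  then show "x = y" by (rule uncL_inject) simp_all
qed simp

lemma tR_iso [simp]:
  assumes [simp]: "M \<in> Obj B" "N \<in> Obj B" "P \<in> Obj B" "Trg B M = Src B N" "Trg B N = Trg B P"
  shows "iso_arrow B (tR B M N P)"
proof (rule iso_arrow_if_retraction_mono)
  define Y where "Y = M \<triangleright> (N \<triangleright> P)"
  have [simp]: "Y \<in> Obj B" "Src B Y = Src B P" "Trg B Y = Src B M" by (simp_all add: Y_def)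
  define y where "y = \<one> Y"
  have [simp]: "y \<in> Arr B" "Dom B y = Y" "Cod B y = M \<triangleright> (N \<triangleright> P)"
    unfolding y_def by (simp_all add: Y_def)
  define u where "u = uncR N P (uncR M (N \<triangleright> P) y)"
  have [simp]: "u \<in> Arr B" "Dom B u = (Y \<odot> M) \<odot> N" "Cod B u = P" by (simp_all add: u_def)
  define k where "k = RTr B Y (M \<odot> N) (u \<cdot> inv (\<alpha> Y M N))"
  have k [simp]: "k \<in> Arr B" "Dom B k = Y" "Cod B k = (M \<odot> N) \<triangleright> P"
    and u: "uncR (M \<odot> N) P k = u \<cdot> inv (\<alpha> Y M N)" by (simp_all add: k_def)
  have "uncR N P (uncR M (N \<triangleright> P) (tR B M N P \<cdot> k)) = uncR N P (uncR M (N \<triangleright> P) y)"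
    using u by (simp add: uncR_tR flip: u_def)
  then have "uncR M (N \<triangleright> P) (tR B M N P \<cdot> k) = uncR M (N \<triangleright> P) y"
    by (rule uncR_inject) simp_all
  then have "tR B M N P \<cdot> k = y"
    by (rule uncR_inject) simp_all
  then show "tR B M N P \<cdot> k = \<one> (Cod B (tR B M N P))" by (simp add: y_def Y_def)
  show "k \<in> Arr B" "Dom B k = Cod B (tR B M N P)" "Cod B k = Dom B (tR B M N P)"
    by (simp_all add: Y_def)
next
  fix x y
  define X where "X = (M \<odot> N) \<triangleright> P"
  have [simp]: "X \<in> Obj B" "Src B X = Src B P" "Trg B X = Src B M" by (simp_all add: X_def)
  assume "x \<in> Hom (Dom B (tR B M N P)) (Dom B (tR B M N P))" "y \<in> Hom (Dom B (tR B M N P)) (Dom B (tR B M N P))"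
    and eq: "tR B M N P \<cdot> x = tR B M N P \<cdot> y"
  then have [simp]: "x \<in> Arr B" "y \<in> Arr B" "Dom B x = X" "Cod B x = (M \<odot> N) \<triangleright> P"
    "Dom B y = X" "Cod B y = (M \<odot> N) \<triangleright> P"
    by (simp_all add: Hom_def X_def)
  have "uncR (M \<odot> N) P x \<cdot> \<alpha> X M N = uncR (M \<odot> N) P y \<cdot> \<alpha> X M N"
    using uncR_tR[of M N P x] uncR_tR[of M N P y] unfolding eq by simp
  then have "uncR (M \<odot> N) P x = uncR (M \<odot> N) P y"
    by (rule iso_right_cancel[rotated]) simp_all
  then show "x = y" by (rule uncR_inject) simp_all
qed simp

lemma aLR_iso [simp]:
  assumes [simp]: "N \<in> Obj B" "P \<in> Obj B" "M \<in> Obj B" "Trg B N = Trg B P" "Src B P = Src B M"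
  shows "iso_arrow B (aLR B N P M)"
proof (rule iso_arrow_if_retraction_mono)
  define Y where "Y = N \<triangleright> (P \<triangleleft> M)"
  have [simp]: "Y \<in> Obj B" "Src B Y = Trg B M" "Trg B Y = Src B N" by (simp_all add: Y_def)
  define y where "y = \<one> Y"
  have [simp]: "y \<in> Arr B" "Dom B y = Y" "Cod B y = N \<triangleright> (P \<triangleleft> M)"
    unfolding y_def by (simp_all add: Y_def)
  define u where "u = uncL M P (uncR N (P \<triangleleft> M) y)"
  have [simp]: "u \<in> Arr B" "Dom B u = M \<odot> (Y \<odot> N)" "Cod B u = P" by (simp_all add: u_def)
  define v where "v = RTr B (M \<odot> Y) N (u \<cdot> \<alpha> M Y N)"
  have v [simp]: "v \<in> Arr B" "Dom B v = M \<odot> Y" "Cod B v = N \<triangleright> P"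
    and u: "uncR N P v = u \<cdot> \<alpha> M Y N" by (simp_all add: v_def)
  define k where "k = LTr B M Y v"
  have k [simp]: "k \<in> Arr B" "Dom B k = Y" "Cod B k = (N \<triangleright> P) \<triangleleft> M"
    and v: "uncL M (N \<triangleright> P) k = v" by (simp_all add: k_def)
  have "uncL M P (uncR N (P \<triangleleft> M) (aLR B N P M \<cdot> k)) = uncL M P (uncR N (P \<triangleleft> M) y)"
    using u v by (simp add: uncL_aLR flip: u_def)
  then have "uncR N (P \<triangleleft> M) (aLR B N P M \<cdot> k) = uncR N (P \<triangleleft> M) y"
    by (rule uncL_inject) simp_all
  then have "aLR B N P M \<cdot> k = y"
    by (rule uncR_inject) simp_all
  then show "aLR B N P M \<cdot> k = \<one> (Cod B (aLR B N P M))" by (simp add: y_def Y_def)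
  show "k \<in> Arr B" "Dom B k = Cod B (aLR B N P M)" "Cod B k = Dom B (aLR B N P M)"
    by (simp_all add: Y_def)
next
  fix x y
  define X where "X = (N \<triangleright> P) \<triangleleft> M"
  have [simp]: "X \<in> Obj B" "Src B X = Trg B M" "Trg B X = Src B N" by (simp_all add: X_def)
  assume "x \<in> Hom (Dom B (aLR B N P M)) (Dom B (aLR B N P M))" "y \<in> Hom (Dom B (aLR B N P M)) (Dom B (aLR B N P M))"
    and eq: "aLR B N P M \<cdot> x = aLR B N P M \<cdot> y"
  then have [simp]: "x \<in> Arr B" "y \<in> Arr B" "Dom B x = X" "Cod B x = (N \<triangleright> P) \<triangleleft> M"
    "Dom B y = X" "Cod B y = (N \<triangleright> P) \<triangleleft> M"
    by (simp_all add: Hom_def X_def)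
  have "uncR N P (uncL M (N \<triangleright> P) x) \<cdot> inv (\<alpha> M X N) = uncR N P (uncL M (N \<triangleright> P) y) \<cdot> inv (\<alpha> M X N)"
    using uncL_aLR[of N P M x] uncL_aLR[of N P M y] unfolding eq by simp
  then have "uncR N P (uncL M (N \<triangleright> P) x) = uncR N P (uncL M (N \<triangleright> P) y)"
    by (rule iso_right_cancel[rotated]) simp_all
  then have "uncL M (N \<triangleright> P) x = uncL M (N \<triangleright> P) y" by (rule uncR_inject) simp_all
  then show "x = y" by (rule uncL_inject) simp_all
qed simp

lemma lbar_iso [simp]:
  assumes [simp]: "P \<in> Obj B"
  shows "iso_arrow B (lbar B P)"
proof (rule iso_arrow_if_retraction_mono)
  define Y where "Y = P \<triangleleft> U (Src B P)"
  have [simp]: "Y \<in> Obj B" "Src B Y = Src B P" "Trg B Y = Trg B P" by (simp_all add: Y_def)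
  define y where "y = \<one> Y"
  have [simp]: "y \<in> Arr B" "Dom B y = Y" "Cod B y = P \<triangleleft> U (Src B P)"
    unfolding y_def by (simp_all add: Y_def)
  let ?k = "uncL (U (Src B P)) P y \<cdot> inv (\<l> Y)"
  have "uncL (U (Src B P)) P (lbar B P \<cdot> ?k) = uncL (U (Src B P)) P y"
    by (simp add: uncL_lbar)
  then have "lbar B P \<cdot> ?k = y"
    by (rule uncL_inject) simp_all
  then show "lbar B P \<cdot> ?k = \<one> (Cod B (lbar B P))" by (simp add: y_def Y_def)
  show "?k \<in> Arr B" "Dom B ?k = Cod B (lbar B P)" "Cod B ?k = Dom B (lbar B P)"
    by (simp_all, simp add: Y_def)
next
  fix x y
  assume "x \<in> Hom (Dom B (lbar B P)) (Dom B (lbar B P))" "y \<in> Hom (Dom B (lbar B P)) (Dom B (lbar B P))"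
    and eq: "lbar B P \<cdot> x = lbar B P \<cdot> y"
  then have [simp]: "x \<in> Arr B" "y \<in> Arr B" "Dom B x = P" "Cod B x = P" "Dom B y = P" "Cod B y = P"
    by (simp_all add: Hom_def)
  have "x \<cdot> \<l> P = y \<cdot> \<l> P"
    using uncL_lbar[of P x "Src B P"] uncL_lbar[of P y "Src B P"] unfolding eq by simp
  then show "x = y" by (rule iso_right_cancel[rotated]) simp_all
qed simp

lemma uncL_inv_tL:
  assumes "M \<in> Obj B" "N \<in> Obj B" "P \<in> Obj B" "Trg B M = Src B N" "Src B P = Src B M"
    and "y \<in> Arr B" "Cod B y = (P \<triangleleft> M) \<triangleleft> N"
  shows "uncL (M \<odot> N) P (inv (tL B M N P) \<cdot> y) = uncL M P (uncL N (P \<triangleleft> M) y) \<cdot> \<alpha> M N (Dom B y)"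
proof -
  note [simp] = assms
  have [simp]: "Src B (Dom B y) = Trg B N" "Trg B (Dom B y) = Trg B P"
    using Obj_typing(5,6)[of y] by simp_all
  show ?thesis using uncL_tL[of M N P "inv (tL B M N P) \<cdot> y"] by simp
qed

lemma uncR_inv_tR:
  assumes "M \<in> Obj B" "N \<in> Obj B" "P \<in> Obj B" "Trg B M = Src B N" "Trg B N = Trg B P"
    and "y \<in> Arr B" "Cod B y = M \<triangleright> (N \<triangleright> P)"
  shows "uncR (M \<odot> N) P (inv (tR B M N P) \<cdot> y) = uncR N P (uncR M (N \<triangleright> P) y) \<cdot> inv (\<alpha> (Dom B y) M N)"
proof -
  note [simp] = assms
  have [simp]: "Trg B (Dom B y) = Src B M" "Src B (Dom B y) = Src B P"
    using Obj_typing(5,6)[of y] by simp_all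
  show ?thesis using uncR_tR[of M N P "inv (tR B M N P) \<cdot> y"] by simp
qed

lemma tL_natural:
  assumes "M \<in> Obj B" "N \<in> Obj B" "Trg B M = Src B N"
    and "p \<in> Arr B" "Dom B p = P" "Cod B p = P'" "Src B P = Src B M"
  shows "tL B M N P' \<cdot> (p \<^bold>\<triangleleft> \<one> (M \<odot> N)) = ((p \<^bold>\<triangleleft> \<one> M) \<^bold>\<triangleleft> \<one> N) \<cdot> tL B M N P"
proof -
  note [simp] = assms
  have [simp]: "P \<in> Obj B" "P' \<in> Obj B" "Src B P' = Src B M" "Trg B P' = Trg B P"
    using Obj_typing(1,2,5,6)[of p] by simp_all
  have "tL B M N P' \<cdot> ((p \<^bold>\<triangleleft> \<one> (M \<odot> N)) \<cdot> h) = ((p \<^bold>\<triangleleft> \<one> M) \<^bold>\<triangleleft> \<one> N) \<cdot> (tL B M N P \<cdot> h)"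
    if [simp]: "h \<in> Arr B" "Cod B h = P \<triangleleft> (M \<odot> N)" for h
  proof -
    have [simp]: "Src B (Dom B h) = Trg B N" "Trg B (Dom B h) = Trg B P"
      using Obj_typing(5,6)[of h] by simp_all
    have "uncL M P' (uncL N (P' \<triangleleft> M) (tL B M N P' \<cdot> ((p \<^bold>\<triangleleft> \<one> (M \<odot> N)) \<cdot> h)))
        = p \<cdot> (uncL (M \<odot> N) P h \<cdot> inv (\<alpha> M N (Dom B h)))"
      by (simp add: uncL_tL uncL_LHom2)
    also have "\<dots> = uncL M P' (uncL N (P' \<triangleleft> M) (((p \<^bold>\<triangleleft> \<one> M) \<^bold>\<triangleleft> \<one> N) \<cdot> (tL B M N P \<cdot> h)))"
      by (simp add: uncL_tL uncL_LHom2)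
    finally have "uncL N (P' \<triangleleft> M) (tL B M N P' \<cdot> ((p \<^bold>\<triangleleft> \<one> (M \<odot> N)) \<cdot> h))
        = uncL N (P' \<triangleleft> M) (((p \<^bold>\<triangleleft> \<one> M) \<^bold>\<triangleleft> \<one> N) \<cdot> (tL B M N P \<cdot> h))"
      by (rule uncL_inject) simp_all
    then show ?thesis by (rule uncL_inject) simp_all
  qed
  from this[of "\<one> (P \<triangleleft> (M \<odot> N))"] show ?thesis by simp
qed

lemma tR_natural:
  assumes "M \<in> Obj B" "N \<in> Obj B" "Trg B M = Src B N"
    and "p \<in> Arr B" "Dom B p = P" "Cod B p = P'" "Trg B P = Trg B N"
  shows "tR B M N P' \<cdot> (\<one> (M \<odot> N) \<^bold>\<triangleright> p) = (\<one> M \<^bold>\<triangleright> (\<one> N \<^bold>\<triangleright> p)) \<cdot> tR B M N P"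
proof -
  note [simp] = assms
  have [simp]: "P \<in> Obj B" "P' \<in> Obj B" "Trg B P' = Trg B N" "Src B P' = Src B P"
    using Obj_typing(1,2,5,6)[of p] by simp_all
  have "tR B M N P' \<cdot> ((\<one> (M \<odot> N) \<^bold>\<triangleright> p) \<cdot> h) = (\<one> M \<^bold>\<triangleright> (\<one> N \<^bold>\<triangleright> p)) \<cdot> (tR B M N P \<cdot> h)"
    if [simp]: "h \<in> Arr B" "Cod B h = (M \<odot> N) \<triangleright> P" for h
  proof -
    have [simp]: "Trg B (Dom B h) = Src B M" "Src B (Dom B h) = Src B P"
      using Obj_typing(5,6)[of h] by simp_all
    have "uncR N P' (uncR M (N \<triangleright> P') (tR B M N P' \<cdot> ((\<one> (M \<odot> N) \<^bold>\<triangleright> p) \<cdot> h)))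
        = p \<cdot> (uncR (M \<odot> N) P h \<cdot> \<alpha> (Dom B h) M N)"
      by (simp add: uncR_tR uncR_RHom2)
    also have "\<dots> = uncR N P' (uncR M (N \<triangleright> P') ((\<one> M \<^bold>\<triangleright> (\<one> N \<^bold>\<triangleright> p)) \<cdot> (tR B M N P \<cdot> h)))"
      by (simp add: uncR_tR uncR_RHom2)
    finally have "uncR M (N \<triangleright> P') (tR B M N P' \<cdot> ((\<one> (M \<odot> N) \<^bold>\<triangleright> p) \<cdot> h))
        = uncR M (N \<triangleright> P') ((\<one> M \<^bold>\<triangleright> (\<one> N \<^bold>\<triangleright> p)) \<cdot> (tR B M N P \<cdot> h))"
      by (rule uncR_inject) simp_all
    then show ?thesis by (rule uncR_inject) simp_all
  qed
  from this[of "\<one> ((M \<odot> N) \<triangleright> P)"] show ?thesis by simp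
qed

end

section \<open>Expanding and collapsing along a dual pair\<close>

context closed_bicategory
begin

text \<open>
  What the cotrace does before it applies the given 2-cell, and what it does after \<open>\<theta>\<close>:
  \<open>Q \<rightarrow> Ms \<triangleright> (M \<triangleright> Q)\<close> and \<open>(P \<triangleleft> M) \<triangleleft> Ms \<rightarrow> P\<close>.
\<close>

definition expand :: "'a \<Rightarrow> 'a \<Rightarrow> 'b \<Rightarrow> 'a \<Rightarrow> 'b" where
  "expand M Ms \<epsilon> Q = tR B Ms M Q \<cdot> ((\<epsilon> \<^bold>\<triangleright> \<one> Q) \<cdot> rbar B Q)"

definition collapse :: "'a \<Rightarrow> 'a \<Rightarrow> 'b \<Rightarrow> 'a \<Rightarrow> 'b" where
  "collapse M Ms \<eta> P = inv (lbar B P) \<cdot> ((\<one> P \<^bold>\<triangleleft> \<eta>) \<cdot> inv (tL B M Ms P))"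

context
  fixes M Ms \<eta> \<epsilon>
  assumes dual: "zigzag_pair M Ms \<eta> \<epsilon>"
begin

declare zigzag_pair_typing [OF dual, simp]

lemma expand_typing [simp]:
  assumes [simp]: "Q \<in> Obj B" "Trg B Q = Src B Ms"
  shows "expand M Ms \<epsilon> Q \<in> Arr B" "Dom B (expand M Ms \<epsilon> Q) = Q" "Cod B (expand M Ms \<epsilon> Q) = Ms \<triangleright> (M \<triangleright> Q)"
  by (simp_all add: expand_def)

lemma collapse_typing [simp]:
  assumes [simp]: "P \<in> Obj B" "Src B P = Src B M"
  shows "collapse M Ms \<eta> P \<in> Arr B" "Dom B (collapse M Ms \<eta> P) = (P \<triangleleft> M) \<triangleleft> Ms" "Cod B (collapse M Ms \<eta> P) = P"
  by (simp_all add: collapse_def)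

text \<open>
  On generalized elements an expansion becomes the removal of \<open>Ms \<odot> M\<close>, and a collapse the insertion
  of \<open>M \<odot> Ms\<close>.
\<close>

lemma uncR_expand:
  assumes "Q \<in> Obj B" "Trg B Q = Src B Ms" "h \<in> Arr B" "Cod B h = Q"
  shows "uncR M Q (uncR Ms (M \<triangleright> Q) (expand M Ms \<epsilon> Q \<cdot> h)) = h \<cdot> remR Ms M \<epsilon> (Dom B h)"
proof -
  note [simp] = assms
  have [simp]: "Src B (Dom B h) = Src B Q" "Trg B (Dom B h) = Src B Ms"
    using Obj_typing(5,6)[of h] by simp_all
  define x where "x = rbar B Q \<cdot> h"
  have [simp]: "x \<in> Arr B" "Dom B x = Dom B h" "Cod B x = U (Src B Ms) \<triangleright> Q"
    by (simp_all add: x_def)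
  have x: "uncR (U (Src B Ms)) Q x = h \<cdot> \<r> (Dom B h)"
    unfolding x_def by (rule uncR_rbar) simp_all
  define y where "y = (\<epsilon> \<^bold>\<triangleright> \<one> Q) \<cdot> x"
  have [simp]: "y \<in> Arr B" "Dom B y = Dom B h" "Cod B y = (Ms \<odot> M) \<triangleright> Q"
    by (simp_all add: y_def)
  have y: "uncR (Ms \<odot> M) Q y = h \<cdot> (\<r> (Dom B h) \<cdot> (\<one> (Dom B h) \<^bold>\<odot> \<epsilon>))"
    by (simp add: y_def uncR_RHom2 x)
  have "expand M Ms \<epsilon> Q \<cdot> h = tR B Ms M Q \<cdot> y"
    by (simp add: expand_def y_def x_def)
  then show ?thesis
    by (simp add: uncR_tR y remR_def)
qed

lemma collapse_Comp:
  assumes "P \<in> Obj B" "Src B P = Src B M" "y \<in> Arr B" "Cod B y = (P \<triangleleft> M) \<triangleleft> Ms"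
  shows "collapse M Ms \<eta> P \<cdot> y = uncL M P (uncL Ms (P \<triangleleft> M) y) \<cdot> insL M Ms \<eta> (Dom B y)"
proof -
  note [simp] = assms
  have [simp]: "Src B (Dom B y) = Src B M" "Trg B (Dom B y) = Trg B P"
    using Obj_typing(5,6)[of y] by simp_all
  define u where "u = uncL M P (uncL Ms (P \<triangleleft> M) y)"
  have [simp]: "u \<in> Arr B" "Dom B u = M \<odot> (Ms \<odot> Dom B y)" "Cod B u = P"
    by (simp_all add: u_def)
  define x where "x = inv (tL B M Ms P) \<cdot> y"
  have [simp]: "x \<in> Arr B" "Dom B x = Dom B y" "Cod B x = P \<triangleleft> (M \<odot> Ms)"
    by (simp_all add: x_def)
  have x: "uncL (M \<odot> Ms) P x = u \<cdot> \<alpha> M Ms (Dom B y)"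
    by (simp add: x_def uncL_inv_tL u_def)
  define c where "c = collapse M Ms \<eta> P \<cdot> y"
  have [simp]: "c \<in> Arr B" "Dom B c = Dom B y" "Cod B c = P"
    by (simp_all add: c_def)
  have "lbar B P \<cdot> c = (\<one> P \<^bold>\<triangleleft> \<eta>) \<cdot> x"
    by (simp add: c_def collapse_def x_def)
  then have "c \<cdot> \<l> (Dom B y) = u \<cdot> (\<alpha> M Ms (Dom B y) \<cdot> (\<eta> \<^bold>\<odot> \<one> (Dom B y)))"
    using uncL_lbar[of P c "Src B P"] by (simp add: uncL_LHom2 x)
  then have "(c \<cdot> \<l> (Dom B y)) \<cdot> inv (\<l> (Dom B y)) = u \<cdot> insL M Ms \<eta> (Dom B y)"
    by (simp add: insL_def del: Comp_reassoc) (simp add: insL_def)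
  then show ?thesis by (simp add: c_def u_def)
qed

text \<open>
  On a generalized element \<open>h\<close> of \<open>Q\<^sub>1 \<triangleleft> Q\<^sub>2\<close> both sides say: remove \<open>Ms \<odot> M\<close> and untranspose \<open>h\<close>. On the
  left the removal takes place beside \<open>Q\<^sub>2 \<odot> X\<close>, on the right beside \<open>X\<close>, which is the same.
\<close>

lemma expand_LHom:
  assumes [simp]: "Q\<^sub>1 \<in> Obj B" "Q\<^sub>2 \<in> Obj B" "Trg B Q\<^sub>1 = Src B Ms" "Trg B Q\<^sub>2 = Src B Ms" "Src B Q\<^sub>1 = Src B Q\<^sub>2"
  shows "(\<one> Ms \<^bold>\<triangleright> aLR B M Q\<^sub>1 Q\<^sub>2) \<cdot> (aLR B Ms (M \<triangleright> Q\<^sub>1) Q\<^sub>2 \<cdot> (expand M Ms \<epsilon> Q\<^sub>1 \<^bold>\<triangleleft> \<one> Q\<^sub>2)) = expand M Ms \<epsilon> (Q\<^sub>1 \<triangleleft> Q\<^sub>2)"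
proof -
  have "(\<one> Ms \<^bold>\<triangleright> aLR B M Q\<^sub>1 Q\<^sub>2) \<cdot> (aLR B Ms (M \<triangleright> Q\<^sub>1) Q\<^sub>2 \<cdot> ((expand M Ms \<epsilon> Q\<^sub>1 \<^bold>\<triangleleft> \<one> Q\<^sub>2) \<cdot> h))
      = expand M Ms \<epsilon> (Q\<^sub>1 \<triangleleft> Q\<^sub>2) \<cdot> h"
    if [simp]: "h \<in> Arr B" "Dom B h = X" "Cod B h = Q\<^sub>1 \<triangleleft> Q\<^sub>2" for h X
  proof -
    have [simp]: "X \<in> Obj B" "Src B X = Src B Ms" "Trg B X = Src B Ms"
      using Obj_typing(1,5,6)[of h] by simp_all
    define e where "e = uncL Q\<^sub>2 Q\<^sub>1 h"
    have [simp]: "e \<in> Arr B" "Dom B e = Q\<^sub>2 \<odot> X" "Cod B e = Q\<^sub>1"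
      by (simp_all add: e_def)
    define y1 where "y1 = (expand M Ms \<epsilon> Q\<^sub>1 \<^bold>\<triangleleft> \<one> Q\<^sub>2) \<cdot> h"
    have [simp]: "y1 \<in> Arr B" "Dom B y1 = X" "Cod B y1 = (Ms \<triangleright> (M \<triangleright> Q\<^sub>1)) \<triangleleft> Q\<^sub>2"
      by (simp_all add: y1_def)
    have y1: "uncL Q\<^sub>2 (Ms \<triangleright> (M \<triangleright> Q\<^sub>1)) y1 = expand M Ms \<epsilon> Q\<^sub>1 \<cdot> e"
      by (simp add: y1_def uncL_LHom2 flip: e_def)
    define z where "z = uncR Ms (M \<triangleright> Q\<^sub>1) (expand M Ms \<epsilon> Q\<^sub>1 \<cdot> e)"
    have [simp]: "z \<in> Arr B" "Dom B z = (Q\<^sub>2 \<odot> X) \<odot> Ms" "Cod B z = M \<triangleright> Q\<^sub>1"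
      by (simp_all add: z_def)
    have z: "uncR M Q\<^sub>1 z = e \<cdot> remR Ms M \<epsilon> (Q\<^sub>2 \<odot> X)"
      by (simp add: z_def uncR_expand)
    define y2 where "y2 = uncR Ms ((M \<triangleright> Q\<^sub>1) \<triangleleft> Q\<^sub>2) (aLR B Ms (M \<triangleright> Q\<^sub>1) Q\<^sub>2 \<cdot> y1)"
    have [simp]: "y2 \<in> Arr B" "Dom B y2 = X \<odot> Ms" "Cod B y2 = (M \<triangleright> Q\<^sub>1) \<triangleleft> Q\<^sub>2"
      by (simp_all add: y2_def)
    have y2: "uncL Q\<^sub>2 (M \<triangleright> Q\<^sub>1) y2 = z \<cdot> inv (\<alpha> Q\<^sub>2 X Ms)"
      by (simp add: y2_def uncL_aLR y1 flip: z_def)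
    let ?L = "(\<one> Ms \<^bold>\<triangleright> aLR B M Q\<^sub>1 Q\<^sub>2) \<cdot> (aLR B Ms (M \<triangleright> Q\<^sub>1) Q\<^sub>2 \<cdot> y1)"
    have L: "uncR Ms (M \<triangleright> (Q\<^sub>1 \<triangleleft> Q\<^sub>2)) ?L = aLR B M Q\<^sub>1 Q\<^sub>2 \<cdot> y2"
      by (simp add: uncR_RHom2 flip: y2_def)
    have "uncL Q\<^sub>2 Q\<^sub>1 (uncR M (Q\<^sub>1 \<triangleleft> Q\<^sub>2) (aLR B M Q\<^sub>1 Q\<^sub>2 \<cdot> y2))
        = (uncR M Q\<^sub>1 z \<cdot> (inv (\<alpha> Q\<^sub>2 X Ms) \<^bold>\<odot> \<one> M)) \<cdot> inv (\<alpha> Q\<^sub>2 (X \<odot> Ms) M)"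
      by (simp add: uncL_aLR y2 uncR_Comp[of z])
    also have "\<dots> = e \<cdot> (\<one> Q\<^sub>2 \<^bold>\<odot> remR Ms M \<epsilon> X)"
      by (simp add: z remR_HComp[symmetric])
    also have "\<dots> = uncL Q\<^sub>2 Q\<^sub>1 (h \<cdot> remR Ms M \<epsilon> X)"
      by (simp add: e_def uncL_Comp[of h])
    finally have "uncR M (Q\<^sub>1 \<triangleleft> Q\<^sub>2) (aLR B M Q\<^sub>1 Q\<^sub>2 \<cdot> y2) = h \<cdot> remR Ms M \<epsilon> X"
      by (rule uncL_inject) simp_all
    also have "\<dots> = uncR M (Q\<^sub>1 \<triangleleft> Q\<^sub>2) (uncR Ms (M \<triangleright> (Q\<^sub>1 \<triangleleft> Q\<^sub>2)) (expand M Ms \<epsilon> (Q\<^sub>1 \<triangleleft> Q\<^sub>2) \<cdot> h))"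
      by (simp add: uncR_expand)
    finally have "uncR Ms (M \<triangleright> (Q\<^sub>1 \<triangleleft> Q\<^sub>2)) ?L = uncR Ms (M \<triangleright> (Q\<^sub>1 \<triangleleft> Q\<^sub>2)) (expand M Ms \<epsilon> (Q\<^sub>1 \<triangleleft> Q\<^sub>2) \<cdot> h)"
      unfolding L by (rule uncR_inject) simp_all
    then have "?L = expand M Ms \<epsilon> (Q\<^sub>1 \<triangleleft> Q\<^sub>2) \<cdot> h"
      by (rule uncR_inject) simp_all
    then show ?thesis by (simp only: y1_def)
  qed
  from this[of "\<one> (Q\<^sub>1 \<triangleleft> Q\<^sub>2)"] show ?thesis by simp
qed

text \<open>
  Both sides insert \<open>M \<odot> Ms\<close> and untranspose the generalized element \<open>y\<close>. On the left the insertion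
  takes place beside \<open>Z \<odot> P\<^sub>2\<close>, on the right beside \<open>Z\<close>.
\<close>

lemma collapse_RHom:
  assumes [simp]: "P\<^sub>1 \<in> Obj B" "P\<^sub>2 \<in> Obj B" "Src B P\<^sub>1 = Src B M" "Src B P\<^sub>2 = Src B M" "Trg B P\<^sub>1 = Trg B P\<^sub>2"
  shows "(\<one> P\<^sub>2 \<^bold>\<triangleright> collapse M Ms \<eta> P\<^sub>1) \<cdot> (aLR B P\<^sub>2 (P\<^sub>1 \<triangleleft> M) Ms \<cdot> (aLR B P\<^sub>2 P\<^sub>1 M \<^bold>\<triangleleft> \<one> Ms)) = collapse M Ms \<eta> (P\<^sub>2 \<triangleright> P\<^sub>1)"
proof -
  have "(\<one> P\<^sub>2 \<^bold>\<triangleright> collapse M Ms \<eta> P\<^sub>1) \<cdot> (aLR B P\<^sub>2 (P\<^sub>1 \<triangleleft> M) Ms \<cdot> ((aLR B P\<^sub>2 P\<^sub>1 M \<^bold>\<triangleleft> \<one> Ms) \<cdot> y))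
      = collapse M Ms \<eta> (P\<^sub>2 \<triangleright> P\<^sub>1) \<cdot> y"
    if [simp]: "y \<in> Arr B" "Dom B y = Z" "Cod B y = ((P\<^sub>2 \<triangleright> P\<^sub>1) \<triangleleft> M) \<triangleleft> Ms" for y Z
  proof -
    have [simp]: "Z \<in> Obj B" "Src B Z = Src B M" "Trg B Z = Src B M"
      using Obj_typing(1,5,6)[of y] by simp_all
    define v where "v = uncL Ms ((P\<^sub>2 \<triangleright> P\<^sub>1) \<triangleleft> M) y"
    have [simp]: "v \<in> Arr B" "Dom B v = Ms \<odot> Z" "Cod B v = (P\<^sub>2 \<triangleright> P\<^sub>1) \<triangleleft> M"
      by (simp_all add: v_def)
    define w where "w = uncL M (P\<^sub>2 \<triangleright> P\<^sub>1) v"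
    have [simp]: "w \<in> Arr B" "Dom B w = M \<odot> (Ms \<odot> Z)" "Cod B w = P\<^sub>2 \<triangleright> P\<^sub>1"
      by (simp_all add: w_def)
    define e where "e = uncR P\<^sub>2 P\<^sub>1 w"
    have [simp]: "e \<in> Arr B" "Dom B e = (M \<odot> (Ms \<odot> Z)) \<odot> P\<^sub>2" "Cod B e = P\<^sub>1"
      by (simp_all add: e_def)
    define y1 where "y1 = (aLR B P\<^sub>2 P\<^sub>1 M \<^bold>\<triangleleft> \<one> Ms) \<cdot> y"
    have [simp]: "y1 \<in> Arr B" "Dom B y1 = Z" "Cod B y1 = (P\<^sub>2 \<triangleright> (P\<^sub>1 \<triangleleft> M)) \<triangleleft> Ms"
      by (simp_all add: y1_def)
    have y1: "uncL Ms (P\<^sub>2 \<triangleright> (P\<^sub>1 \<triangleleft> M)) y1 = aLR B P\<^sub>2 P\<^sub>1 M \<cdot> v"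
      by (simp add: y1_def uncL_LHom2 flip: v_def)
    define x where "x = uncR P\<^sub>2 (P\<^sub>1 \<triangleleft> M) (aLR B P\<^sub>2 P\<^sub>1 M \<cdot> v)"
    have [simp]: "x \<in> Arr B" "Dom B x = (Ms \<odot> Z) \<odot> P\<^sub>2" "Cod B x = P\<^sub>1 \<triangleleft> M"
      by (simp_all add: x_def)
    have x: "uncL M P\<^sub>1 x = e \<cdot> inv (\<alpha> M (Ms \<odot> Z) P\<^sub>2)"
      by (simp add: x_def uncL_aLR flip: e_def w_def)
    define y2 where "y2 = uncR P\<^sub>2 ((P\<^sub>1 \<triangleleft> M) \<triangleleft> Ms) (aLR B P\<^sub>2 (P\<^sub>1 \<triangleleft> M) Ms \<cdot> y1)"
    have [simp]: "y2 \<in> Arr B" "Dom B y2 = Z \<odot> P\<^sub>2" "Cod B y2 = (P\<^sub>1 \<triangleleft> M) \<triangleleft> Ms"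
      by (simp_all add: y2_def)
    have y2: "uncL Ms (P\<^sub>1 \<triangleleft> M) y2 = x \<cdot> inv (\<alpha> Ms Z P\<^sub>2)"
      by (simp add: y2_def uncL_aLR y1 flip: x_def)
    let ?L = "(\<one> P\<^sub>2 \<^bold>\<triangleright> collapse M Ms \<eta> P\<^sub>1) \<cdot> (aLR B P\<^sub>2 (P\<^sub>1 \<triangleleft> M) Ms \<cdot> y1)"
    have "uncR P\<^sub>2 P\<^sub>1 ?L = collapse M Ms \<eta> P\<^sub>1 \<cdot> y2"
      by (simp add: uncR_RHom2 flip: y2_def)
    also have "\<dots> = uncL M P\<^sub>1 (x \<cdot> inv (\<alpha> Ms Z P\<^sub>2)) \<cdot> insL M Ms \<eta> (Z \<odot> P\<^sub>2)"
      by (simp add: collapse_Comp y2)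
    also have "\<dots> = e \<cdot> (inv (\<alpha> M (Ms \<odot> Z) P\<^sub>2) \<cdot> ((\<one> M \<^bold>\<odot> inv (\<alpha> Ms Z P\<^sub>2)) \<cdot> insL M Ms \<eta> (Z \<odot> P\<^sub>2)))"
      by (simp add: uncL_Comp[of x] x)
    also have "\<dots> = e \<cdot> (insL M Ms \<eta> Z \<^bold>\<odot> \<one> P\<^sub>2)"
      by (simp add: insL_HComp[symmetric])
    also have "\<dots> = uncR P\<^sub>2 P\<^sub>1 (collapse M Ms \<eta> (P\<^sub>2 \<triangleright> P\<^sub>1) \<cdot> y)"
      by (simp add: collapse_Comp uncR_Comp[of w] e_def flip: w_def v_def)
    finally have "?L = collapse M Ms \<eta> (P\<^sub>2 \<triangleright> P\<^sub>1) \<cdot> y"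
      by (rule uncR_inject) simp_all
    then show ?thesis by (simp only: y1_def)
  qed
  from this[of "\<one> (((P\<^sub>2 \<triangleright> P\<^sub>1) \<triangleleft> M) \<triangleleft> Ms)"] show ?thesis by simp
qed

end

end

section \<open>Sliding the mate through expansions and collapses\<close>

context closed_bicategory
begin

context
  fixes M Ms \<eta>\<^sub>M \<epsilon>\<^sub>M N Ns \<eta>\<^sub>N \<epsilon>\<^sub>N P\<^sub>2 Q\<^sub>2 g g'
  assumes M: "zigzag_pair M Ms \<eta>\<^sub>M \<epsilon>\<^sub>M" and N: "zigzag_pair N Ns \<eta>\<^sub>N \<epsilon>\<^sub>N"
    and P\<^sub>2 [simp]: "P\<^sub>2 \<in> Obj B" and Q\<^sub>2 [simp]: "Q\<^sub>2 \<in> Obj B"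
    and TP\<^sub>2 [simp]: "Trg B P\<^sub>2 = Src B M" and TQ\<^sub>2 [simp]: "Trg B Q\<^sub>2 = Src B Ms"
    and SP\<^sub>2 [simp]: "Src B P\<^sub>2 = Src B N" and SQ\<^sub>2 [simp]: "Src B Q\<^sub>2 = Src B Ns"
    and g [simp]: "g \<in> Arr B" "Dom B g = P\<^sub>2 \<odot> M" "Cod B g = N \<odot> Q\<^sub>2"
    and g': "g' = mate M Ms \<eta>\<^sub>M N Ns \<epsilon>\<^sub>N P\<^sub>2 Q\<^sub>2 g"
begin

declare zigzag_pair_typing [OF M, simp] zigzag_pair_typing [OF N, simp]

lemmas g'_typing = mate_typing [OF M N P\<^sub>2 Q\<^sub>2 TP\<^sub>2 TQ\<^sub>2 SP\<^sub>2 SQ\<^sub>2 g g']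

declare g'_typing [simp]

text \<open>
  On a generalized element \<open>h\<close> of \<open>Q\<^sub>2 \<triangleright> Q\<^sub>1\<close> both sides untranspose to \<open>h\<close> after a 2-cell that removes
  \<open>Ns \<odot> N\<close> after \<open>g\<close>, respectively \<open>Ms \<odot> M\<close> after the mate; these 2-cells are equal by
  \<open>remR_HComp_mate\<close>.
\<close>

lemma expand_mate:
  assumes [simp]: "Q\<^sub>1 \<in> Obj B" "Trg B Q\<^sub>1 = Src B Ms" "Src B Q\<^sub>1 = Src B Ns"
  shows "(\<one> Ns \<^bold>\<triangleright> (tR B P\<^sub>2 M Q\<^sub>1 \<cdot> ((g \<^bold>\<triangleright> \<one> Q\<^sub>1) \<cdot> inv (tR B N Q\<^sub>2 Q\<^sub>1)))) \<cdot> expand N Ns \<epsilon>\<^sub>N (Q\<^sub>2 \<triangleright> Q\<^sub>1)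
    = tR B Ns P\<^sub>2 (M \<triangleright> Q\<^sub>1) \<cdot> ((g' \<^bold>\<triangleright> \<one> (M \<triangleright> Q\<^sub>1)) \<cdot> (inv (tR B Q\<^sub>2 Ms (M \<triangleright> Q\<^sub>1)) \<cdot> (\<one> Q\<^sub>2 \<^bold>\<triangleright> expand M Ms \<epsilon>\<^sub>M Q\<^sub>1)))"
proof -
  define k where "k = tR B P\<^sub>2 M Q\<^sub>1 \<cdot> ((g \<^bold>\<triangleright> \<one> Q\<^sub>1) \<cdot> inv (tR B N Q\<^sub>2 Q\<^sub>1))"
  have [simp]: "k \<in> Arr B" "Dom B k = N \<triangleright> (Q\<^sub>2 \<triangleright> Q\<^sub>1)" "Cod B k = P\<^sub>2 \<triangleright> (M \<triangleright> Q\<^sub>1)"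
    by (simp_all add: k_def)
  define E where "E = expand M Ms \<epsilon>\<^sub>M Q\<^sub>1"
  have [simp]: "E \<in> Arr B" "Dom B E = Q\<^sub>1" "Cod B E = Ms \<triangleright> (M \<triangleright> Q\<^sub>1)"
    unfolding E_def by (simp_all add: expand_typing[OF M])
  define E' where "E' = expand N Ns \<epsilon>\<^sub>N (Q\<^sub>2 \<triangleright> Q\<^sub>1)"
  have [simp]: "E' \<in> Arr B" "Dom B E' = Q\<^sub>2 \<triangleright> Q\<^sub>1" "Cod B E' = Ns \<triangleright> (N \<triangleright> (Q\<^sub>2 \<triangleright> Q\<^sub>1))"
    unfolding E'_def by (simp_all add: expand_typing[OF N])
  note [simp] = remR_typing[of Ns N \<epsilon>\<^sub>N] remR_typing[of Ms M \<epsilon>\<^sub>M]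
  have "(\<one> Ns \<^bold>\<triangleright> k) \<cdot> (E' \<cdot> h)
    = tR B Ns P\<^sub>2 (M \<triangleright> Q\<^sub>1) \<cdot> ((g' \<^bold>\<triangleright> \<one> (M \<triangleright> Q\<^sub>1)) \<cdot> (inv (tR B Q\<^sub>2 Ms (M \<triangleright> Q\<^sub>1)) \<cdot> ((\<one> Q\<^sub>2 \<^bold>\<triangleright> E) \<cdot> h)))"
    if [simp]: "h \<in> Arr B" "Dom B h = X" "Cod B h = Q\<^sub>2 \<triangleright> Q\<^sub>1" for h X
  proof -
    have [simp]: "X \<in> Obj B" "Src B X = Src B Ns" "Trg B X = Src B Ns"
      using Obj_typing(1,5,6)[of h] by simp_all
    define e where "e = uncR Q\<^sub>2 Q\<^sub>1 h"
    have [simp]: "e \<in> Arr B" "Dom B e = X \<odot> Q\<^sub>2" "Cod B e = Q\<^sub>1"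
      by (simp_all add: e_def)

    \<comment> \<open>transposes of what the left-hand side makes of \<open>h\<close>, one canonical 2-cell at a time\<close>
    define y0 where "y0 = uncR Ns (N \<triangleright> (Q\<^sub>2 \<triangleright> Q\<^sub>1)) (E' \<cdot> h)"
    have [simp]: "y0 \<in> Arr B" "Dom B y0 = X \<odot> Ns" "Cod B y0 = N \<triangleright> (Q\<^sub>2 \<triangleright> Q\<^sub>1)"
      by (simp_all add: y0_def)
    have y0: "uncR N (Q\<^sub>2 \<triangleright> Q\<^sub>1) y0 = h \<cdot> remR Ns N \<epsilon>\<^sub>N X"
      by (simp add: y0_def E'_def uncR_expand[OF N])
    define y1 where "y1 = inv (tR B N Q\<^sub>2 Q\<^sub>1) \<cdot> y0"
    have [simp]: "y1 \<in> Arr B" "Dom B y1 = X \<odot> Ns" "Cod B y1 = (N \<odot> Q\<^sub>2) \<triangleright> Q\<^sub>1"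
      by (simp_all add: y1_def)
    have y1: "uncR (N \<odot> Q\<^sub>2) Q\<^sub>1 y1 = e \<cdot> ((remR Ns N \<epsilon>\<^sub>N X \<^bold>\<odot> \<one> Q\<^sub>2) \<cdot> inv (\<alpha> (X \<odot> Ns) N Q\<^sub>2))"
      by (simp add: y1_def uncR_inv_tR y0 uncR_Comp[of h] flip: e_def)
    define y2 where "y2 = (g \<^bold>\<triangleright> \<one> Q\<^sub>1) \<cdot> y1"
    have [simp]: "y2 \<in> Arr B" "Dom B y2 = X \<odot> Ns" "Cod B y2 = (P\<^sub>2 \<odot> M) \<triangleright> Q\<^sub>1"
      by (simp_all add: y2_def)
    have y2: "uncR (P\<^sub>2 \<odot> M) Q\<^sub>1 y2
        = e \<cdot> ((remR Ns N \<epsilon>\<^sub>N X \<^bold>\<odot> \<one> Q\<^sub>2) \<cdot> (inv (\<alpha> (X \<odot> Ns) N Q\<^sub>2) \<cdot> (\<one> (X \<odot> Ns) \<^bold>\<odot> g)))"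
      by (simp add: y2_def uncR_RHom2 y1)
    have ky0: "k \<cdot> y0 = tR B P\<^sub>2 M Q\<^sub>1 \<cdot> y2"
      by (simp add: k_def y2_def y1_def)
    have L: "uncR M Q\<^sub>1 (uncR P\<^sub>2 (M \<triangleright> Q\<^sub>1) (uncR Ns (P\<^sub>2 \<triangleright> (M \<triangleright> Q\<^sub>1)) ((\<one> Ns \<^bold>\<triangleright> k) \<cdot> (E' \<cdot> h))))
        = e \<cdot> ((remR Ns N \<epsilon>\<^sub>N X \<^bold>\<odot> \<one> Q\<^sub>2)
          \<cdot> (inv (\<alpha> (X \<odot> Ns) N Q\<^sub>2) \<cdot> ((\<one> (X \<odot> Ns) \<^bold>\<odot> g) \<cdot> \<alpha> (X \<odot> Ns) P\<^sub>2 M)))"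
      by (simp add: uncR_RHom2 ky0 uncR_tR y2 flip: y0_def)

    \<comment> \<open>the same for the right-hand side; \<open>c\<close> is the mate with its associators\<close>
    define z0 where "z0 = (\<one> Q\<^sub>2 \<^bold>\<triangleright> E) \<cdot> h"
    have [simp]: "z0 \<in> Arr B" "Dom B z0 = X" "Cod B z0 = Q\<^sub>2 \<triangleright> (Ms \<triangleright> (M \<triangleright> Q\<^sub>1))"
      by (simp_all add: z0_def)
    have z0: "uncR Q\<^sub>2 (Ms \<triangleright> (M \<triangleright> Q\<^sub>1)) z0 = E \<cdot> e"
      by (simp add: z0_def uncR_RHom2 flip: e_def)
    define r where "r = uncR Ms (M \<triangleright> Q\<^sub>1) (E \<cdot> e)"
    have [simp]: "r \<in> Arr B" "Dom B r = (X \<odot> Q\<^sub>2) \<odot> Ms" "Cod B r = M \<triangleright> Q\<^sub>1"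
      by (simp_all add: r_def)
    have r: "uncR M Q\<^sub>1 r = e \<cdot> remR Ms M \<epsilon>\<^sub>M (X \<odot> Q\<^sub>2)"
      by (simp add: r_def E_def uncR_expand[OF M])
    define z1 where "z1 = inv (tR B Q\<^sub>2 Ms (M \<triangleright> Q\<^sub>1)) \<cdot> z0"
    have [simp]: "z1 \<in> Arr B" "Dom B z1 = X" "Cod B z1 = (Q\<^sub>2 \<odot> Ms) \<triangleright> (M \<triangleright> Q\<^sub>1)"
      by (simp_all add: z1_def)
    have z1: "uncR (Q\<^sub>2 \<odot> Ms) (M \<triangleright> Q\<^sub>1) z1 = r \<cdot> inv (\<alpha> X Q\<^sub>2 Ms)"
      by (simp add: z1_def uncR_inv_tR z0 flip: r_def)
    define z2 where "z2 = (g' \<^bold>\<triangleright> \<one> (M \<triangleright> Q\<^sub>1)) \<cdot> z1"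
    have [simp]: "z2 \<in> Arr B" "Dom B z2 = X" "Cod B z2 = (Ns \<odot> P\<^sub>2) \<triangleright> (M \<triangleright> Q\<^sub>1)"
      by (simp_all add: z2_def)
    have z2: "uncR (Ns \<odot> P\<^sub>2) (M \<triangleright> Q\<^sub>1) z2 = r \<cdot> (inv (\<alpha> X Q\<^sub>2 Ms) \<cdot> (\<one> X \<^bold>\<odot> g'))"
      by (simp add: z2_def uncR_RHom2 z1)
    define c where "c = inv (\<alpha> X Q\<^sub>2 Ms) \<cdot> ((\<one> X \<^bold>\<odot> g') \<cdot> \<alpha> X Ns P\<^sub>2)"
    have [simp]: "c \<in> Arr B" "Dom B c = (X \<odot> Ns) \<odot> P\<^sub>2" "Cod B c = (X \<odot> Q\<^sub>2) \<odot> Ms"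
      by (simp_all add: c_def)
    have z3: "uncR P\<^sub>2 (M \<triangleright> Q\<^sub>1) (uncR Ns (P\<^sub>2 \<triangleright> (M \<triangleright> Q\<^sub>1)) (tR B Ns P\<^sub>2 (M \<triangleright> Q\<^sub>1) \<cdot> z2)) = r \<cdot> c"
      by (simp add: uncR_tR z2 c_def)
    have c: "remR Ms M \<epsilon>\<^sub>M (X \<odot> Q\<^sub>2) \<cdot> (c \<^bold>\<odot> \<one> M)
      = (remR Ns N \<epsilon>\<^sub>N X \<^bold>\<odot> \<one> Q\<^sub>2) \<cdot> (inv (\<alpha> (X \<odot> Ns) N Q\<^sub>2) \<cdot> ((\<one> (X \<odot> Ns) \<^bold>\<odot> g) \<cdot> \<alpha> (X \<odot> Ns) P\<^sub>2 M))"
      unfolding c_def by (rule remR_HComp_mate[OF M N]) (simp_all add: g')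
    have R: "uncR M Q\<^sub>1 (uncR P\<^sub>2 (M \<triangleright> Q\<^sub>1) (uncR Ns (P\<^sub>2 \<triangleright> (M \<triangleright> Q\<^sub>1)) (tR B Ns P\<^sub>2 (M \<triangleright> Q\<^sub>1) \<cdot> z2)))
        = e \<cdot> (remR Ms M \<epsilon>\<^sub>M (X \<odot> Q\<^sub>2) \<cdot> (c \<^bold>\<odot> \<one> M))"
      unfolding z3 by (simp add: uncR_Comp[of r] r)
    have "uncR M Q\<^sub>1 (uncR P\<^sub>2 (M \<triangleright> Q\<^sub>1) (uncR Ns (P\<^sub>2 \<triangleright> (M \<triangleright> Q\<^sub>1)) ((\<one> Ns \<^bold>\<triangleright> k) \<cdot> (E' \<cdot> h))))
        = uncR M Q\<^sub>1 (uncR P\<^sub>2 (M \<triangleright> Q\<^sub>1) (uncR Ns (P\<^sub>2 \<triangleright> (M \<triangleright> Q\<^sub>1)) (tR B Ns P\<^sub>2 (M \<triangleright> Q\<^sub>1) \<cdot> z2)))"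
      unfolding L R c ..
    then have "uncR P\<^sub>2 (M \<triangleright> Q\<^sub>1) (uncR Ns (P\<^sub>2 \<triangleright> (M \<triangleright> Q\<^sub>1)) ((\<one> Ns \<^bold>\<triangleright> k) \<cdot> (E' \<cdot> h)))
        = uncR P\<^sub>2 (M \<triangleright> Q\<^sub>1) (uncR Ns (P\<^sub>2 \<triangleright> (M \<triangleright> Q\<^sub>1)) (tR B Ns P\<^sub>2 (M \<triangleright> Q\<^sub>1) \<cdot> z2))"
      by (rule uncR_inject) simp_all
    then have "uncR Ns (P\<^sub>2 \<triangleright> (M \<triangleright> Q\<^sub>1)) ((\<one> Ns \<^bold>\<triangleright> k) \<cdot> (E' \<cdot> h))
        = uncR Ns (P\<^sub>2 \<triangleright> (M \<triangleright> Q\<^sub>1)) (tR B Ns P\<^sub>2 (M \<triangleright> Q\<^sub>1) \<cdot> z2)"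
      by (rule uncR_inject) simp_all
    then have "(\<one> Ns \<^bold>\<triangleright> k) \<cdot> (E' \<cdot> h) = tR B Ns P\<^sub>2 (M \<triangleright> Q\<^sub>1) \<cdot> z2"
      by (rule uncR_inject) simp_all
    then show ?thesis by (simp only: z0_def z1_def z2_def)
  qed
  from this[of "\<one> (Q\<^sub>2 \<triangleright> Q\<^sub>1)"] show ?thesis by (simp flip: k_def E_def E'_def)
qed

text \<open>
  Dually, the untransposed generalized element follows a 2-cell that inserts \<open>M \<odot> Ms\<close> and applies
  \<open>g\<close>, or inserts \<open>N \<odot> Ns\<close> and applies the mate; these are equal by \<open>mate_insL_HComp\<close>.
\<close>

lemma collapse_mate:
  assumes [simp]: "P\<^sub>1 \<in> Obj B" "Trg B P\<^sub>1 = Src B M" "Src B P\<^sub>1 = Src B N"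
  shows "collapse M Ms \<eta>\<^sub>M (P\<^sub>1 \<triangleleft> P\<^sub>2) \<cdot> ((tL B P\<^sub>2 M P\<^sub>1 \<cdot> ((\<one> P\<^sub>1 \<^bold>\<triangleleft> g) \<cdot> inv (tL B N Q\<^sub>2 P\<^sub>1))) \<^bold>\<triangleleft> \<one> Ms)
    = (collapse N Ns \<eta>\<^sub>N P\<^sub>1 \<^bold>\<triangleleft> \<one> P\<^sub>2) \<cdot> (tL B Ns P\<^sub>2 (P\<^sub>1 \<triangleleft> N) \<cdot> ((\<one> (P\<^sub>1 \<triangleleft> N) \<^bold>\<triangleleft> g') \<cdot> inv (tL B Q\<^sub>2 Ms (P\<^sub>1 \<triangleleft> N))))"
proof -
  define k where "k = tL B P\<^sub>2 M P\<^sub>1 \<cdot> ((\<one> P\<^sub>1 \<^bold>\<triangleleft> g) \<cdot> inv (tL B N Q\<^sub>2 P\<^sub>1))"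
  have [simp]: "k \<in> Arr B" "Dom B k = (P\<^sub>1 \<triangleleft> N) \<triangleleft> Q\<^sub>2" "Cod B k = (P\<^sub>1 \<triangleleft> P\<^sub>2) \<triangleleft> M"
    by (simp_all add: k_def)
  define C where "C = collapse M Ms \<eta>\<^sub>M (P\<^sub>1 \<triangleleft> P\<^sub>2)"
  have [simp]: "C \<in> Arr B" "Dom B C = ((P\<^sub>1 \<triangleleft> P\<^sub>2) \<triangleleft> M) \<triangleleft> Ms" "Cod B C = P\<^sub>1 \<triangleleft> P\<^sub>2"
    unfolding C_def by (simp_all add: collapse_typing[OF M])
  define C' where "C' = collapse N Ns \<eta>\<^sub>N P\<^sub>1"
  have [simp]: "C' \<in> Arr B" "Dom B C' = (P\<^sub>1 \<triangleleft> N) \<triangleleft> Ns" "Cod B C' = P\<^sub>1"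
    unfolding C'_def by (simp_all add: collapse_typing[OF N])
  note [simp] = insL_typing[of N Ns \<eta>\<^sub>N] insL_typing[of M Ms \<eta>\<^sub>M]
  have "C \<cdot> ((k \<^bold>\<triangleleft> \<one> Ms) \<cdot> y)
    = (C' \<^bold>\<triangleleft> \<one> P\<^sub>2) \<cdot> (tL B Ns P\<^sub>2 (P\<^sub>1 \<triangleleft> N) \<cdot> ((\<one> (P\<^sub>1 \<triangleleft> N) \<^bold>\<triangleleft> g') \<cdot> (inv (tL B Q\<^sub>2 Ms (P\<^sub>1 \<triangleleft> N)) \<cdot> y)))"
    if [simp]: "y \<in> Arr B" "Dom B y = Z" "Cod B y = ((P\<^sub>1 \<triangleleft> N) \<triangleleft> Q\<^sub>2) \<triangleleft> Ms" for y Z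
  proof -
    have [simp]: "Z \<in> Obj B" "Src B Z = Src B M" "Trg B Z = Src B M"
      using Obj_typing(1,5,6)[of y] by simp_all
    define a where "a = uncL Ms ((P\<^sub>1 \<triangleleft> N) \<triangleleft> Q\<^sub>2) y"
    have [simp]: "a \<in> Arr B" "Dom B a = Ms \<odot> Z" "Cod B a = (P\<^sub>1 \<triangleleft> N) \<triangleleft> Q\<^sub>2"
      by (simp_all add: a_def)
    define b where "b = uncL Q\<^sub>2 (P\<^sub>1 \<triangleleft> N) a"
    have [simp]: "b \<in> Arr B" "Dom B b = Q\<^sub>2 \<odot> (Ms \<odot> Z)" "Cod B b = P\<^sub>1 \<triangleleft> N"
      by (simp_all add: b_def)
    define e where "e = uncL N P\<^sub>1 b"
    have [simp]: "e \<in> Arr B" "Dom B e = N \<odot> (Q\<^sub>2 \<odot> (Ms \<odot> Z))" "Cod B e = P\<^sub>1"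
      by (simp_all add: e_def)

    \<comment> \<open>transposes of what the left-hand side makes of \<open>y\<close>, one canonical 2-cell at a time\<close>
    define y1 where "y1 = (k \<^bold>\<triangleleft> \<one> Ms) \<cdot> y"
    have [simp]: "y1 \<in> Arr B" "Dom B y1 = Z" "Cod B y1 = ((P\<^sub>1 \<triangleleft> P\<^sub>2) \<triangleleft> M) \<triangleleft> Ms"
      by (simp_all add: y1_def)
    have y1: "uncL Ms ((P\<^sub>1 \<triangleleft> P\<^sub>2) \<triangleleft> M) y1 = k \<cdot> a"
      by (simp add: y1_def uncL_LHom2 flip: a_def)
    define a1 where "a1 = inv (tL B N Q\<^sub>2 P\<^sub>1) \<cdot> a"
    have [simp]: "a1 \<in> Arr B" "Dom B a1 = Ms \<odot> Z" "Cod B a1 = P\<^sub>1 \<triangleleft> (N \<odot> Q\<^sub>2)"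
      by (simp_all add: a1_def)
    have a1: "uncL (N \<odot> Q\<^sub>2) P\<^sub>1 a1 = e \<cdot> \<alpha> N Q\<^sub>2 (Ms \<odot> Z)"
      by (simp add: a1_def uncL_inv_tL flip: e_def b_def)
    define a2 where "a2 = (\<one> P\<^sub>1 \<^bold>\<triangleleft> g) \<cdot> a1"
    have [simp]: "a2 \<in> Arr B" "Dom B a2 = Ms \<odot> Z" "Cod B a2 = P\<^sub>1 \<triangleleft> (P\<^sub>2 \<odot> M)"
      by (simp_all add: a2_def)
    have a2: "uncL (P\<^sub>2 \<odot> M) P\<^sub>1 a2 = e \<cdot> (\<alpha> N Q\<^sub>2 (Ms \<odot> Z) \<cdot> (g \<^bold>\<odot> \<one> (Ms \<odot> Z)))"
      by (simp add: a2_def uncL_LHom2 a1)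
    define a3 where "a3 = uncL M (P\<^sub>1 \<triangleleft> P\<^sub>2) (k \<cdot> a)"
    have [simp]: "a3 \<in> Arr B" "Dom B a3 = M \<odot> (Ms \<odot> Z)" "Cod B a3 = P\<^sub>1 \<triangleleft> P\<^sub>2"
      by (simp_all add: a3_def)
    have ka: "k \<cdot> a = tL B P\<^sub>2 M P\<^sub>1 \<cdot> a2"
      by (simp add: k_def a2_def a1_def)
    have a3: "uncL P\<^sub>2 P\<^sub>1 a3
        = e \<cdot> (\<alpha> N Q\<^sub>2 (Ms \<odot> Z) \<cdot> ((g \<^bold>\<odot> \<one> (Ms \<odot> Z)) \<cdot> inv (\<alpha> P\<^sub>2 M (Ms \<odot> Z))))"
      unfolding a3_def ka by (simp add: uncL_tL a2)
    have Cy1: "C \<cdot> y1 = a3 \<cdot> insL M Ms \<eta>\<^sub>M Z"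
      by (simp add: C_def collapse_Comp[OF M] y1 flip: a3_def)
    have L: "uncL P\<^sub>2 P\<^sub>1 (C \<cdot> y1) = e \<cdot> (\<alpha> N Q\<^sub>2 (Ms \<odot> Z) \<cdot> ((g \<^bold>\<odot> \<one> (Ms \<odot> Z))
        \<cdot> (inv (\<alpha> P\<^sub>2 M (Ms \<odot> Z)) \<cdot> (\<one> P\<^sub>2 \<^bold>\<odot> insL M Ms \<eta>\<^sub>M Z))))"
      unfolding Cy1 by (simp add: uncL_Comp[of a3] a3)

    \<comment> \<open>the same for the right-hand side; \<open>c\<close> is the mate with its associators\<close>
    define b1 where "b1 = inv (tL B Q\<^sub>2 Ms (P\<^sub>1 \<triangleleft> N)) \<cdot> y"
    have [simp]: "b1 \<in> Arr B" "Dom B b1 = Z" "Cod B b1 = (P\<^sub>1 \<triangleleft> N) \<triangleleft> (Q\<^sub>2 \<odot> Ms)"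
      by (simp_all add: b1_def)
    have b1: "uncL (Q\<^sub>2 \<odot> Ms) (P\<^sub>1 \<triangleleft> N) b1 = b \<cdot> \<alpha> Q\<^sub>2 Ms Z"
      by (simp add: b1_def uncL_inv_tL flip: b_def a_def)
    define b2 where "b2 = (\<one> (P\<^sub>1 \<triangleleft> N) \<^bold>\<triangleleft> g') \<cdot> b1"
    have [simp]: "b2 \<in> Arr B" "Dom B b2 = Z" "Cod B b2 = (P\<^sub>1 \<triangleleft> N) \<triangleleft> (Ns \<odot> P\<^sub>2)"
      by (simp_all add: b2_def)
    have b2: "uncL (Ns \<odot> P\<^sub>2) (P\<^sub>1 \<triangleleft> N) b2 = b \<cdot> (\<alpha> Q\<^sub>2 Ms Z \<cdot> (g' \<^bold>\<odot> \<one> Z))"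
      by (simp add: b2_def uncL_LHom2 b1)
    define c where "c = \<alpha> Q\<^sub>2 Ms Z \<cdot> ((g' \<^bold>\<odot> \<one> Z) \<cdot> inv (\<alpha> Ns P\<^sub>2 Z))"
    have [simp]: "c \<in> Arr B" "Dom B c = Ns \<odot> (P\<^sub>2 \<odot> Z)" "Cod B c = Q\<^sub>2 \<odot> (Ms \<odot> Z)"
      by (simp_all add: c_def)
    define b3 where "b3 = uncL P\<^sub>2 ((P\<^sub>1 \<triangleleft> N) \<triangleleft> Ns) (tL B Ns P\<^sub>2 (P\<^sub>1 \<triangleleft> N) \<cdot> b2)"
    have [simp]: "b3 \<in> Arr B" "Dom B b3 = P\<^sub>2 \<odot> Z" "Cod B b3 = (P\<^sub>1 \<triangleleft> N) \<triangleleft> Ns"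
      by (simp_all add: b3_def)
    have b3: "uncL Ns (P\<^sub>1 \<triangleleft> N) b3 = b \<cdot> c"
      by (simp add: b3_def uncL_tL b2 c_def)
    have c: "(\<one> N \<^bold>\<odot> c) \<cdot> insL N Ns \<eta>\<^sub>N (P\<^sub>2 \<odot> Z) = \<alpha> N Q\<^sub>2 (Ms \<odot> Z) \<cdot> ((g \<^bold>\<odot> \<one> (Ms \<odot> Z))
        \<cdot> (inv (\<alpha> P\<^sub>2 M (Ms \<odot> Z)) \<cdot> (\<one> P\<^sub>2 \<^bold>\<odot> insL M Ms \<eta>\<^sub>M Z)))"
      unfolding c_def by (rule mate_insL_HComp[OF M N]) (simp_all add: g')
    have "uncL P\<^sub>2 P\<^sub>1 ((C' \<^bold>\<triangleleft> \<one> P\<^sub>2) \<cdot> (tL B Ns P\<^sub>2 (P\<^sub>1 \<triangleleft> N) \<cdot> b2)) = C' \<cdot> b3"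
      by (simp add: uncL_LHom2 flip: b3_def)
    also have "\<dots> = uncL N P\<^sub>1 (b \<cdot> c) \<cdot> insL N Ns \<eta>\<^sub>N (P\<^sub>2 \<odot> Z)"
      by (simp add: C'_def collapse_Comp[OF N] b3)
    also have "\<dots> = e \<cdot> ((\<one> N \<^bold>\<odot> c) \<cdot> insL N Ns \<eta>\<^sub>N (P\<^sub>2 \<odot> Z))"
      by (simp add: uncL_Comp[of b] flip: e_def)
    finally have "uncL P\<^sub>2 P\<^sub>1 (C \<cdot> y1) = uncL P\<^sub>2 P\<^sub>1 ((C' \<^bold>\<triangleleft> \<one> P\<^sub>2) \<cdot> (tL B Ns P\<^sub>2 (P\<^sub>1 \<triangleleft> N) \<cdot> b2))"
      unfolding L c ..
    then have "C \<cdot> y1 = (C' \<^bold>\<triangleleft> \<one> P\<^sub>2) \<cdot> (tL B Ns P\<^sub>2 (P\<^sub>1 \<triangleleft> N) \<cdot> b2)"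
      by (rule uncL_inject) simp_all
    then show ?thesis by (simp only: y1_def b1_def b2_def)
  qed
  from this[of "\<one> (((P\<^sub>1 \<triangleleft> N) \<triangleleft> Q\<^sub>2) \<triangleleft> Ms)"] show ?thesis by (simp flip: k_def C_def C'_def)
qed

end

end

context closed_bicategory
begin

lemma LHom2_split:
  assumes "p \<in> Arr B" "m \<in> Arr B" "Src B (Dom B p) = Src B (Dom B m)"
    and "Dom B p = P" "Cod B p = P'" "Dom B m = M'" "Cod B m = M"
  shows "(\<one> P' \<^bold>\<triangleleft> m) \<cdot> (p \<^bold>\<triangleleft> \<one> M) = p \<^bold>\<triangleleft> m"
proof -
  have "P' \<in> Obj B" "M \<in> Obj B" "Src B M = Src B M'"
    using assms Obj_typing(2)[of p] Obj_typing(2,5)[of m] by auto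
  then show ?thesis using assms by (simp add: LHom2_interchange)
qed

lemma RHom2_split:
  assumes "p \<in> Arr B" "n \<in> Arr B" "Trg B (Dom B p) = Trg B (Dom B n)"
    and "Dom B p = P" "Cod B p = P'" "Dom B n = N'" "Cod B n = N"
  shows "(\<one> N' \<^bold>\<triangleright> p) \<cdot> (n \<^bold>\<triangleright> \<one> P) = n \<^bold>\<triangleright> p"
proof -
  have "N' \<in> Obj B" "P \<in> Obj B"
    using assms Obj_typing(1)[of p] Obj_typing(1)[of n] by auto
  then show ?thesis using assms by (simp add: RHom2_interchange)
qed

lemma LHom2_Comp_left:
  assumes "p \<in> Arr B" "p' \<in> Arr B" "Cod B p = Dom B p'" "M \<in> Obj B" "Src B (Dom B p) = Src B M"
  shows "(p' \<cdot> p) \<^bold>\<triangleleft> \<one> M = (p' \<^bold>\<triangleleft> \<one> M) \<cdot> (p \<^bold>\<triangleleft> \<one> M)"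
  using LHom2_interchange[of p p' "\<one> M" "\<one> M"] assms by simp

lemma RHom2_Comp_right:
  assumes "p \<in> Arr B" "p' \<in> Arr B" "Cod B p = Dom B p'" "N \<in> Obj B" "Trg B (Dom B p) = Trg B N"
  shows "\<one> N \<^bold>\<triangleright> (p' \<cdot> p) = (\<one> N \<^bold>\<triangleright> p') \<cdot> (\<one> N \<^bold>\<triangleright> p)"
  using RHom2_interchange[of p p' "\<one> N" "\<one> N"] assms by simp

lemma zigzag_pair_if_dual_pair:
  assumes "dual_pair B M Ms \<eta> \<epsilon>"
  shows "zigzag_pair M Ms \<eta> \<epsilon>"
proof -
  obtain R S where "M \<in> Cell1 R S" "Ms \<in> Cell1 S R" "\<eta> \<in> Hom (U R) (M \<odot> Ms)" "\<epsilon> \<in> Hom (Ms \<odot> M) (U S)"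
    and triangle: "\<r> M \<cdot> (\<one> M \<^bold>\<odot> \<epsilon>) \<cdot> \<alpha> M Ms M \<cdot> (\<eta> \<^bold>\<odot> \<one> M) \<cdot> inv (\<l> M) = \<one> M"
    using assms unfolding dual_pair_def by blast
  then have [simp]: "M \<in> Obj B" "Ms \<in> Obj B" "Src B M = R" "Trg B M = S" "Src B Ms = S" "Trg B Ms = R"
    "\<eta> \<in> Arr B" "Dom B \<eta> = U R" "Cod B \<eta> = M \<odot> Ms" "\<epsilon> \<in> Arr B" "Dom B \<epsilon> = Ms \<odot> M" "Cod B \<epsilon> = U S"
    by (simp_all add: Cell1_def Hom_def)
  have [simp]: "R \<in> Cell0 B" "S \<in> Cell0 B"
    using Obj_typing(3,4)[of M] by simp_all
  have "remR Ms M \<epsilon> M \<cdot> ((\<eta> \<^bold>\<odot> \<one> M) \<cdot> inv (\<l> M)) = \<one> M"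
    using triangle by (simp add: remR_def)
  then show ?thesis by (simp add: zigzag_pair_def)
qed

end

section \<open>Coshadows and the cyclicity of the cotrace\<close>

context coshadow
begin

lemma Csh2_typing [simp]:
  assumes "f \<in> Arr B" "Trg B (Dom B f) = Src B (Dom B f)"
  shows "Csh2\<^bsub>K\<^esub> f \<in> Arr T" "Dom T (Csh2\<^bsub>K\<^esub> f) = Csh\<^bsub>K\<^esub> (Dom B f)" "Cod T (Csh2\<^bsub>K\<^esub> f) = Csh\<^bsub>K\<^esub> (Cod B f)"
  using Csh2_in_Hom[of "Dom B f" "Src B (Dom B f)" f "Cod B f"] assms
  by (simp_all add: Cell1_def Hom_def)

lemma Csh2_Id' [simp]: "M \<in> Obj B \<Longrightarrow> Trg B M = Src B M \<Longrightarrow> Csh2\<^bsub>K\<^esub> (\<one> M) = \<one>\<^bsub>T\<^esub> (Csh\<^bsub>K\<^esub> M)"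
  using Csh2_Id[of M "Src B M"] by (simp add: Cell1_def)

lemma Csh_Obj [simp]: "M \<in> Obj B \<Longrightarrow> Trg B M = Src B M \<Longrightarrow> Csh\<^bsub>K\<^esub> M \<in> Obj T"
  using Csh_in_Obj[of M "Src B M"] by (simp add: Cell1_def)

lemma Csh2_Comp':
  assumes "f \<in> Arr B" "g \<in> Arr B" "Cod B f = Dom B g" "Trg B (Dom B f) = Src B (Dom B f)"
  shows "Csh2\<^bsub>K\<^esub> (g \<cdot> f) = Csh2\<^bsub>K\<^esub> g \<cdot>\<^bsub>T\<^esub> Csh2\<^bsub>K\<^esub> f"
  using Csh2_Comp[of "Dom B f" "Src B (Dom B f)" f "Cod B f" g "Cod B g"] assms
  by (simp add: Cell1_def Hom_def)

lemma theta_typing [simp]: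
  assumes "M \<in> Obj B" "N \<in> Obj B" "Src B M = Src B N" "Trg B M = Trg B N"
  shows "\<theta>\<^bsub>K\<^esub> M N \<in> Arr T" "Dom T (\<theta>\<^bsub>K\<^esub> M N) = Csh\<^bsub>K\<^esub> (M \<triangleright> N)" "Cod T (\<theta>\<^bsub>K\<^esub> M N) = Csh\<^bsub>K\<^esub> (N \<triangleleft> M)"
    and "iso_arrow T (\<theta>\<^bsub>K\<^esub> M N)"
  using theta_in_Hom[of M "Src B N" "Trg B N" N] theta_iso[of M "Src B N" "Trg B N" N] assms
  by (simp_all add: Cell1_def Hom_def)

lemma theta_nat:
  assumes "m \<in> Arr B" "n \<in> Arr B" "Dom B m = M'" "Cod B m = M" "Dom B n = N" "Cod B n = N'"
    and "Src B M = Src B N" "Trg B M = Trg B N"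
  shows "\<theta>\<^bsub>K\<^esub> M' N' \<cdot>\<^bsub>T\<^esub> Csh2\<^bsub>K\<^esub> (m \<^bold>\<triangleright> n) = Csh2\<^bsub>K\<^esub> (n \<^bold>\<triangleleft> m) \<cdot>\<^bsub>T\<^esub> \<theta>\<^bsub>K\<^esub> M N"
  by (rule theta_natural[of M "Src B N" "Trg B N"])
    (use assms Obj_typing(1,2)[of m] Obj_typing(1,2)[of n] in \<open>simp_all add: Cell1_def Hom_def\<close>)

lemma theta_inv_nat:
  assumes "m \<in> Arr B" "n \<in> Arr B" "Dom B m = M'" "Cod B m = M" "Dom B n = N" "Cod B n = N'"
    and "Src B M = Src B N" "Trg B M = Trg B N"
  shows "inv\<^bsub>T\<^esub> (\<theta>\<^bsub>K\<^esub> M' N') \<cdot>\<^bsub>T\<^esub> Csh2\<^bsub>K\<^esub> (n \<^bold>\<triangleleft> m) = Csh2\<^bsub>K\<^esub> (m \<^bold>\<triangleright> n) \<cdot>\<^bsub>T\<^esub> inv\<^bsub>T\<^esub> (\<theta>\<^bsub>K\<^esub> M N)"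
proof -
  note [simp] = assms
  have [simp]: "M \<in> Obj B" "M' \<in> Obj B" "N \<in> Obj B" "N' \<in> Obj B"
    "Src B M' = Src B N" "Trg B M' = Trg B N" "Src B N' = Src B N" "Trg B N' = Trg B N"
    using Obj_typing(1,2,5,6)[of m] Obj_typing(1,2,5,6)[of n] by simp_all
  show ?thesis
    by (rule T.inv_square) (simp_all add: theta_nat)
qed

text \<open>
  The axiom on \<open>\<theta>\<close> and composites of 1-cells is a pentagon of isomorphisms, used in two
  solved forms: one computes \<open>\<theta>\<close> at a composite from \<open>\<theta>\<close> at the factors, the other trades \<open>\<theta>\<close> at the
  second factor for \<open>\<theta>\<close> at the composite and \<open>\<theta>\<close> at the first factor.
\<close>

lemma theta_HComp_left:
  assumes [simp]: "M \<in> Obj B" "N \<in> Obj B" "P \<in> Obj B" "Trg B M = Src B N" "Src B M = Src B P" "Trg B N = Trg B P"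
  shows "Csh2\<^bsub>K\<^esub> (tL B M N P) \<cdot>\<^bsub>T\<^esub> \<theta>\<^bsub>K\<^esub> (M \<odot> N) P
    = \<theta>\<^bsub>K\<^esub> N (P \<triangleleft> M) \<cdot>\<^bsub>T\<^esub> (Csh2\<^bsub>K\<^esub> (aLR B N P M) \<cdot>\<^bsub>T\<^esub> (\<theta>\<^bsub>K\<^esub> M (N \<triangleright> P) \<cdot>\<^bsub>T\<^esub> Csh2\<^bsub>K\<^esub> (tR B M N P)))"
proof -
  let ?l = "Csh2\<^bsub>K\<^esub> (tL B M N P) \<cdot>\<^bsub>T\<^esub> \<theta>\<^bsub>K\<^esub> (M \<odot> N) P"
  have "?l = \<theta>\<^bsub>K\<^esub> N (P \<triangleleft> M) \<cdot>\<^bsub>T\<^esub> (inv\<^bsub>T\<^esub> (\<theta>\<^bsub>K\<^esub> N (P \<triangleleft> M)) \<cdot>\<^bsub>T\<^esub> ?l)"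
    by simp
  also have "inv\<^bsub>T\<^esub> (\<theta>\<^bsub>K\<^esub> N (P \<triangleleft> M)) \<cdot>\<^bsub>T\<^esub> ?l
      = Csh2\<^bsub>K\<^esub> (aLR B N P M) \<cdot>\<^bsub>T\<^esub> (\<theta>\<^bsub>K\<^esub> M (N \<triangleright> P) \<cdot>\<^bsub>T\<^esub> Csh2\<^bsub>K\<^esub> (tR B M N P))"
    using theta_HComp[of M "Src B P" "Src B N" N "Trg B P" P] by (simp add: Cell1_def)
  finally show ?thesis .
qed

lemma theta_HComp_inv:
  assumes [simp]: "M \<in> Obj B" "N \<in> Obj B" "P \<in> Obj B" "Trg B M = Src B N" "Src B M = Src B P" "Trg B N = Trg B P"
  shows "Csh2\<^bsub>K\<^esub> (inv (tL B M N P)) \<cdot>\<^bsub>T\<^esub> (\<theta>\<^bsub>K\<^esub> N (P \<triangleleft> M) \<cdot>\<^bsub>T\<^esub> Csh2\<^bsub>K\<^esub> (aLR B N P M))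
    = \<theta>\<^bsub>K\<^esub> (M \<odot> N) P \<cdot>\<^bsub>T\<^esub> (Csh2\<^bsub>K\<^esub> (inv (tR B M N P)) \<cdot>\<^bsub>T\<^esub> inv\<^bsub>T\<^esub> (\<theta>\<^bsub>K\<^esub> M (N \<triangleright> P)))"
proof -
  define x where "x = Csh2\<^bsub>K\<^esub> (inv (tR B M N P)) \<cdot>\<^bsub>T\<^esub> inv\<^bsub>T\<^esub> (\<theta>\<^bsub>K\<^esub> M (N \<triangleright> P))"
  have [simp]: "x \<in> Arr T" "Dom T x = Csh\<^bsub>K\<^esub> ((N \<triangleright> P) \<triangleleft> M)" "Cod T x = Csh\<^bsub>K\<^esub> ((M \<odot> N) \<triangleright> P)"
    by (simp_all add: x_def)
  have iR: "Csh2\<^bsub>K\<^esub> (tR B M N P) \<cdot>\<^bsub>T\<^esub> Csh2\<^bsub>K\<^esub> (inv (tR B M N P)) = \<one>\<^bsub>T\<^esub> (Csh\<^bsub>K\<^esub> (M \<triangleright> (N \<triangleright> P)))"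
    by (simp flip: Csh2_Comp')
  have iL: "Csh2\<^bsub>K\<^esub> (inv (tL B M N P)) \<cdot>\<^bsub>T\<^esub> Csh2\<^bsub>K\<^esub> (tL B M N P) = \<one>\<^bsub>T\<^esub> (Csh\<^bsub>K\<^esub> (P \<triangleleft> (M \<odot> N)))"
    by (simp flip: Csh2_Comp')
  have x: "\<theta>\<^bsub>K\<^esub> M (N \<triangleright> P) \<cdot>\<^bsub>T\<^esub> (Csh2\<^bsub>K\<^esub> (tR B M N P) \<cdot>\<^bsub>T\<^esub> x) = \<one>\<^bsub>T\<^esub> (Csh\<^bsub>K\<^esub> ((N \<triangleright> P) \<triangleleft> M))"
    by (simp add: x_def T.Comp_extend[OF iR])
  have "\<theta>\<^bsub>K\<^esub> (M \<odot> N) P \<cdot>\<^bsub>T\<^esub> x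
      = Csh2\<^bsub>K\<^esub> (inv (tL B M N P)) \<cdot>\<^bsub>T\<^esub> (Csh2\<^bsub>K\<^esub> (tL B M N P) \<cdot>\<^bsub>T\<^esub> (\<theta>\<^bsub>K\<^esub> (M \<odot> N) P \<cdot>\<^bsub>T\<^esub> x))"
    by (simp add: T.Comp_extend[OF iL])
  also have "\<dots> = Csh2\<^bsub>K\<^esub> (inv (tL B M N P)) \<cdot>\<^bsub>T\<^esub> (\<theta>\<^bsub>K\<^esub> N (P \<triangleleft> M) \<cdot>\<^bsub>T\<^esub> (Csh2\<^bsub>K\<^esub> (aLR B N P M)
      \<cdot>\<^bsub>T\<^esub> (\<theta>\<^bsub>K\<^esub> M (N \<triangleright> P) \<cdot>\<^bsub>T\<^esub> (Csh2\<^bsub>K\<^esub> (tR B M N P) \<cdot>\<^bsub>T\<^esub> x))))"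
    by (simp add: T.Comp_extend[OF theta_HComp_left])
  also have "\<dots> = Csh2\<^bsub>K\<^esub> (inv (tL B M N P)) \<cdot>\<^bsub>T\<^esub> (\<theta>\<^bsub>K\<^esub> N (P \<triangleleft> M) \<cdot>\<^bsub>T\<^esub> Csh2\<^bsub>K\<^esub> (aLR B N P M))"
    unfolding x by simp
  finally show ?thesis by (simp add: x_def)
qed

lemma cotr_eq:
  assumes dual: "zigzag_pair M Ms \<eta> \<epsilon>"
    and [simp]: "Q \<in> Obj B" "Src B Q = Src B Ms" "Trg B Q = Src B Ms"
      "P \<in> Obj B" "Src B P = Src B M" "Trg B P = Src B M"
      "h \<in> Arr B" "Dom B h = M \<triangleright> Q" "Cod B h = P \<triangleleft> M"
  shows "cotr B T K M Ms \<eta> \<epsilon> Q P h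
    = Csh2\<^bsub>K\<^esub> (collapse M Ms \<eta> P) \<cdot>\<^bsub>T\<^esub> (\<theta>\<^bsub>K\<^esub> Ms (P \<triangleleft> M) \<cdot>\<^bsub>T\<^esub> Csh2\<^bsub>K\<^esub> ((\<one> Ms \<^bold>\<triangleright> h) \<cdot> expand M Ms \<epsilon> Q))"
proof -
  note [simp] = zigzag_pair_typing[OF dual] collapse_typing[OF dual] expand_typing[OF dual]
  have "inv (lbar B P) \<cdot> (\<one> P \<^bold>\<triangleleft> \<eta>) \<cdot> inv (tL B M Ms P) = collapse M Ms \<eta> P"
    by (simp add: collapse_def)
  moreover have "(\<one> Ms \<^bold>\<triangleright> h) \<cdot> tR B Ms M Q \<cdot> (\<epsilon> \<^bold>\<triangleright> \<one> Q) \<cdot> rbar B Q = (\<one> Ms \<^bold>\<triangleright> h) \<cdot> expand M Ms \<epsilon> Q"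
    by (simp add: expand_def)
  ultimately show ?thesis
    by (simp add: cotr_def del: Comp_reassoc)
qed

end

context coshadow
begin

context
  fixes M Ms \<eta>\<^sub>M \<epsilon>\<^sub>M N Ns \<eta>\<^sub>N \<epsilon>\<^sub>N Q\<^sub>1 Q\<^sub>2 P\<^sub>1 P\<^sub>2 f g R S V W
  assumes M: "zigzag_pair M Ms \<eta>\<^sub>M \<epsilon>\<^sub>M" and N: "zigzag_pair N Ns \<eta>\<^sub>N \<epsilon>\<^sub>N"
    and ends [simp]: "Src B M = R" "Src B Ms = S" "Src B N = W" "Src B Ns = V"
    and Q\<^sub>1 [simp]: "Q\<^sub>1 \<in> Obj B" "Src B Q\<^sub>1 = V" "Trg B Q\<^sub>1 = S"
    and Q\<^sub>2 [simp]: "Q\<^sub>2 \<in> Obj B" "Src B Q\<^sub>2 = V" "Trg B Q\<^sub>2 = S"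
    and P\<^sub>1 [simp]: "P\<^sub>1 \<in> Obj B" "Src B P\<^sub>1 = W" "Trg B P\<^sub>1 = R"
    and P\<^sub>2 [simp]: "P\<^sub>2 \<in> Obj B" "Src B P\<^sub>2 = W" "Trg B P\<^sub>2 = R"
    and f [simp]: "f \<in> Arr B" "Dom B f = M \<triangleright> Q\<^sub>1" "Cod B f = P\<^sub>1 \<triangleleft> N"
    and g [simp]: "g \<in> Arr B" "Dom B g = P\<^sub>2 \<odot> M" "Cod B g = N \<odot> Q\<^sub>2"
begin

text \<open>
  The 2-cells of the two cotraces are regrouped by the four identities for expansions and
  collapses, which leaves \<open>f\<close>, the mate of \<open>g\<close> and canonical 2-cells; then \<open>\<theta>\<close> moves from \<open>Ms\<close> to \<open>Ns\<close>.
\<close>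

lemma cotr_cyclic:
  "inv\<^bsub>T\<^esub> (\<theta>\<^bsub>K\<^esub> P\<^sub>2 P\<^sub>1) \<cdot>\<^bsub>T\<^esub> cotr B T K M Ms \<eta>\<^sub>M \<epsilon>\<^sub>M (Q\<^sub>1 \<triangleleft> Q\<^sub>2) (P\<^sub>1 \<triangleleft> P\<^sub>2)
      (tL B P\<^sub>2 M P\<^sub>1 \<cdot> (\<one> P\<^sub>1 \<^bold>\<triangleleft> g) \<cdot> inv (tL B N Q\<^sub>2 P\<^sub>1) \<cdot> (f \<^bold>\<triangleleft> \<one> Q\<^sub>2) \<cdot> inv (aLR B M Q\<^sub>1 Q\<^sub>2))
    = cotr B T K N Ns \<eta>\<^sub>N \<epsilon>\<^sub>N (Q\<^sub>2 \<triangleright> Q\<^sub>1) (P\<^sub>2 \<triangleright> P\<^sub>1)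
      (inv (aLR B P\<^sub>2 P\<^sub>1 N) \<cdot> (\<one> P\<^sub>2 \<^bold>\<triangleright> f) \<cdot> tR B P\<^sub>2 M Q\<^sub>1 \<cdot> (g \<^bold>\<triangleright> \<one> Q\<^sub>1) \<cdot> inv (tR B N Q\<^sub>2 Q\<^sub>1))
      \<cdot>\<^bsub>T\<^esub> inv\<^bsub>T\<^esub> (\<theta>\<^bsub>K\<^esub> Q\<^sub>2 Q\<^sub>1)"
proof -
  have M_ty [simp]: "M \<in> Obj B" "Ms \<in> Obj B" "Trg B M = S" "Trg B Ms = R"
    using zigzag_pair_typing[OF M] by simp_all
  have N_ty [simp]: "N \<in> Obj B" "Ns \<in> Obj B" "Trg B N = V" "Trg B Ns = W"
    using zigzag_pair_typing[OF N] by simp_all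
  define g' where "g' = mate M Ms \<eta>\<^sub>M N Ns \<epsilon>\<^sub>N P\<^sub>2 Q\<^sub>2 g"
  have g'_ty [simp]: "g' \<in> Arr B" "Dom B g' = Ns \<odot> P\<^sub>2" "Cod B g' = Q\<^sub>2 \<odot> Ms"
    using mate_typing[OF M N, of P\<^sub>2 Q\<^sub>2 g g'] by (simp_all add: g'_def)

  \<comment> \<open>\<open>E\<^sub>M\<close> and \<open>C\<^sub>M\<close> belong to the cotrace along \<open>M\<close>, \<open>E\<^sub>N\<close> and \<open>C\<^sub>N\<close> to the one along \<open>N\<close>; \<open>E\<close> and \<open>C\<close> remain\<close>
  define E where "E = expand M Ms \<epsilon>\<^sub>M Q\<^sub>1"
  have [simp]: "E \<in> Arr B" "Dom B E = Q\<^sub>1" "Cod B E = Ms \<triangleright> (M \<triangleright> Q\<^sub>1)"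
    unfolding E_def by (simp_all add: expand_typing[OF M])
  define E\<^sub>M where "E\<^sub>M = expand M Ms \<epsilon>\<^sub>M (Q\<^sub>1 \<triangleleft> Q\<^sub>2)"
  have [simp]: "E\<^sub>M \<in> Arr B" "Dom B E\<^sub>M = Q\<^sub>1 \<triangleleft> Q\<^sub>2" "Cod B E\<^sub>M = Ms \<triangleright> (M \<triangleright> (Q\<^sub>1 \<triangleleft> Q\<^sub>2))"
    unfolding E\<^sub>M_def by (simp_all add: expand_typing[OF M])
  define E\<^sub>N where "E\<^sub>N = expand N Ns \<epsilon>\<^sub>N (Q\<^sub>2 \<triangleright> Q\<^sub>1)"
  have [simp]: "E\<^sub>N \<in> Arr B" "Dom B E\<^sub>N = Q\<^sub>2 \<triangleright> Q\<^sub>1" "Cod B E\<^sub>N = Ns \<triangleright> (N \<triangleright> (Q\<^sub>2 \<triangleright> Q\<^sub>1))"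
    unfolding E\<^sub>N_def by (simp_all add: expand_typing[OF N])
  define C where "C = collapse N Ns \<eta>\<^sub>N P\<^sub>1"
  have [simp]: "C \<in> Arr B" "Dom B C = (P\<^sub>1 \<triangleleft> N) \<triangleleft> Ns" "Cod B C = P\<^sub>1"
    unfolding C_def by (simp_all add: collapse_typing[OF N])
  define C\<^sub>M where "C\<^sub>M = collapse M Ms \<eta>\<^sub>M (P\<^sub>1 \<triangleleft> P\<^sub>2)"
  have [simp]: "C\<^sub>M \<in> Arr B" "Dom B C\<^sub>M = ((P\<^sub>1 \<triangleleft> P\<^sub>2) \<triangleleft> M) \<triangleleft> Ms" "Cod B C\<^sub>M = P\<^sub>1 \<triangleleft> P\<^sub>2"
    unfolding C\<^sub>M_def by (simp_all add: collapse_typing[OF M])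
  define C\<^sub>N where "C\<^sub>N = collapse N Ns \<eta>\<^sub>N (P\<^sub>2 \<triangleright> P\<^sub>1)"
  have [simp]: "C\<^sub>N \<in> Arr B" "Dom B C\<^sub>N = ((P\<^sub>2 \<triangleright> P\<^sub>1) \<triangleleft> N) \<triangleleft> Ns" "Cod B C\<^sub>N = P\<^sub>2 \<triangleright> P\<^sub>1"
    unfolding C\<^sub>N_def by (simp_all add: collapse_typing[OF N])

  \<comment> \<open>the parts of the two 2-cells that contain \<open>g\<close>, with the canonical 2-cells around them\<close>
  define k\<^sub>L where "k\<^sub>L = tL B P\<^sub>2 M P\<^sub>1 \<cdot> ((\<one> P\<^sub>1 \<^bold>\<triangleleft> g) \<cdot> inv (tL B N Q\<^sub>2 P\<^sub>1))"
  have [simp]: "k\<^sub>L \<in> Arr B" "Dom B k\<^sub>L = (P\<^sub>1 \<triangleleft> N) \<triangleleft> Q\<^sub>2" "Cod B k\<^sub>L = (P\<^sub>1 \<triangleleft> P\<^sub>2) \<triangleleft> M"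
    by (simp_all add: k\<^sub>L_def)
  define k\<^sub>R where "k\<^sub>R = tR B P\<^sub>2 M Q\<^sub>1 \<cdot> ((g \<^bold>\<triangleright> \<one> Q\<^sub>1) \<cdot> inv (tR B N Q\<^sub>2 Q\<^sub>1))"
  have [simp]: "k\<^sub>R \<in> Arr B" "Dom B k\<^sub>R = N \<triangleright> (Q\<^sub>2 \<triangleright> Q\<^sub>1)" "Cod B k\<^sub>R = P\<^sub>2 \<triangleright> (M \<triangleright> Q\<^sub>1)"
    by (simp_all add: k\<^sub>R_def)
  define a\<^sub>1 where "a\<^sub>1 = aLR B M Q\<^sub>1 Q\<^sub>2"
  have [simp]: "a\<^sub>1 \<in> Arr B" "Dom B a\<^sub>1 = (M \<triangleright> Q\<^sub>1) \<triangleleft> Q\<^sub>2" "Cod B a\<^sub>1 = M \<triangleright> (Q\<^sub>1 \<triangleleft> Q\<^sub>2)" "iso_arrow B a\<^sub>1"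
    by (simp_all add: a\<^sub>1_def)
  define a\<^sub>2 where "a\<^sub>2 = aLR B P\<^sub>2 P\<^sub>1 N"
  have [simp]: "a\<^sub>2 \<in> Arr B" "Dom B a\<^sub>2 = (P\<^sub>2 \<triangleright> P\<^sub>1) \<triangleleft> N" "Cod B a\<^sub>2 = P\<^sub>2 \<triangleright> (P\<^sub>1 \<triangleleft> N)" "iso_arrow B a\<^sub>2"
    by (simp_all add: a\<^sub>2_def)
  define b\<^sub>1 where "b\<^sub>1 = aLR B Ms (M \<triangleright> Q\<^sub>1) Q\<^sub>2"
  have [simp]: "b\<^sub>1 \<in> Arr B" "Dom B b\<^sub>1 = (Ms \<triangleright> (M \<triangleright> Q\<^sub>1)) \<triangleleft> Q\<^sub>2" "Cod B b\<^sub>1 = Ms \<triangleright> ((M \<triangleright> Q\<^sub>1) \<triangleleft> Q\<^sub>2)"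
    by (simp_all add: b\<^sub>1_def)
  define b\<^sub>2 where "b\<^sub>2 = aLR B P\<^sub>2 (P\<^sub>1 \<triangleleft> N) Ns"
  have [simp]: "b\<^sub>2 \<in> Arr B" "Dom B b\<^sub>2 = (P\<^sub>2 \<triangleright> (P\<^sub>1 \<triangleleft> N)) \<triangleleft> Ns" "Cod B b\<^sub>2 = P\<^sub>2 \<triangleright> ((P\<^sub>1 \<triangleleft> N) \<triangleleft> Ns)"
    by (simp_all add: b\<^sub>2_def)
  define l\<^sub>1 where "l\<^sub>1 = inv (tL B Q\<^sub>2 Ms (M \<triangleright> Q\<^sub>1))"
  have [simp]: "l\<^sub>1 \<in> Arr B" "Dom B l\<^sub>1 = ((M \<triangleright> Q\<^sub>1) \<triangleleft> Q\<^sub>2) \<triangleleft> Ms" "Cod B l\<^sub>1 = (M \<triangleright> Q\<^sub>1) \<triangleleft> (Q\<^sub>2 \<odot> Ms)"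
    by (simp_all add: l\<^sub>1_def)
  define l\<^sub>2 where "l\<^sub>2 = tL B Ns P\<^sub>2 (P\<^sub>1 \<triangleleft> N)"
  have [simp]: "l\<^sub>2 \<in> Arr B" "Dom B l\<^sub>2 = (P\<^sub>1 \<triangleleft> N) \<triangleleft> (Ns \<odot> P\<^sub>2)" "Cod B l\<^sub>2 = ((P\<^sub>1 \<triangleleft> N) \<triangleleft> Ns) \<triangleleft> P\<^sub>2"
    by (simp_all add: l\<^sub>2_def)
  define r\<^sub>1 where "r\<^sub>1 = inv (tR B Q\<^sub>2 Ms (M \<triangleright> Q\<^sub>1))"
  have [simp]: "r\<^sub>1 \<in> Arr B" "Dom B r\<^sub>1 = Q\<^sub>2 \<triangleright> (Ms \<triangleright> (M \<triangleright> Q\<^sub>1))" "Cod B r\<^sub>1 = (Q\<^sub>2 \<odot> Ms) \<triangleright> (M \<triangleright> Q\<^sub>1)"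
    by (simp_all add: r\<^sub>1_def)
  define r\<^sub>2 where "r\<^sub>2 = tR B Ns P\<^sub>2 (P\<^sub>1 \<triangleleft> N)"
  have [simp]: "r\<^sub>2 \<in> Arr B" "Dom B r\<^sub>2 = (Ns \<odot> P\<^sub>2) \<triangleright> (P\<^sub>1 \<triangleleft> N)" "Cod B r\<^sub>2 = Ns \<triangleright> (P\<^sub>2 \<triangleright> (P\<^sub>1 \<triangleleft> N))"
    by (simp_all add: r\<^sub>2_def)

  define F\<^sub>L where "F\<^sub>L = k\<^sub>L \<cdot> (f \<^bold>\<triangleleft> \<one> Q\<^sub>2)"
  have [simp]: "F\<^sub>L \<in> Arr B" "Dom B F\<^sub>L = (M \<triangleright> Q\<^sub>1) \<triangleleft> Q\<^sub>2" "Cod B F\<^sub>L = (P\<^sub>1 \<triangleleft> P\<^sub>2) \<triangleleft> M"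
    by (simp_all add: F\<^sub>L_def)
  define F\<^sub>R where "F\<^sub>R = (\<one> P\<^sub>2 \<^bold>\<triangleright> f) \<cdot> k\<^sub>R"
  have [simp]: "F\<^sub>R \<in> Arr B" "Dom B F\<^sub>R = N \<triangleright> (Q\<^sub>2 \<triangleright> Q\<^sub>1)" "Cod B F\<^sub>R = P\<^sub>2 \<triangleright> (P\<^sub>1 \<triangleleft> N)"
    by (simp_all add: F\<^sub>R_def)

  define G where "G = (\<one> Ns \<^bold>\<triangleright> F\<^sub>R) \<cdot> E\<^sub>N"
  have [simp]: "G \<in> Arr B" "Dom B G = Q\<^sub>2 \<triangleright> Q\<^sub>1" "Cod B G = Ns \<triangleright> (P\<^sub>2 \<triangleright> (P\<^sub>1 \<triangleleft> N))"
    by (simp_all add: G_def)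

  \<comment> \<open>regrouping the 2-cells before and after \<open>\<theta>\<close>, for the left-hand and the right-hand side\<close>
  have EL: "(\<one> Ms \<^bold>\<triangleright> (F\<^sub>L \<cdot> inv a\<^sub>1)) \<cdot> E\<^sub>M = (\<one> Ms \<^bold>\<triangleright> F\<^sub>L) \<cdot> (b\<^sub>1 \<cdot> (E \<^bold>\<triangleleft> \<one> Q\<^sub>2))"
  proof -
    have "E\<^sub>M = (\<one> Ms \<^bold>\<triangleright> a\<^sub>1) \<cdot> (b\<^sub>1 \<cdot> (E \<^bold>\<triangleleft> \<one> Q\<^sub>2))"
      unfolding E\<^sub>M_def a\<^sub>1_def b\<^sub>1_def E_def by (rule expand_LHom[OF M, symmetric]) simp_all
    moreover have i: "(\<one> Ms \<^bold>\<triangleright> (F\<^sub>L \<cdot> inv a\<^sub>1)) \<cdot> (\<one> Ms \<^bold>\<triangleright> a\<^sub>1) = \<one> Ms \<^bold>\<triangleright> F\<^sub>L"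
      by (simp add: RHom2_interchange)
    ultimately show ?thesis
      by (simp add: Comp_extend[OF i])
  qed
  have CL: "C\<^sub>M \<cdot> (F\<^sub>L \<^bold>\<triangleleft> \<one> Ms) = (C \<^bold>\<triangleleft> \<one> P\<^sub>2) \<cdot> (l\<^sub>2 \<cdot> ((f \<^bold>\<triangleleft> g') \<cdot> l\<^sub>1))"
  proof -
    let ?l = "inv (tL B Q\<^sub>2 Ms (P\<^sub>1 \<triangleleft> N))"
    have l: "?l \<cdot> ((f \<^bold>\<triangleleft> \<one> Q\<^sub>2) \<^bold>\<triangleleft> \<one> Ms) = (f \<^bold>\<triangleleft> \<one> (Q\<^sub>2 \<odot> Ms)) \<cdot> l\<^sub>1"
      unfolding l\<^sub>1_def by (rule inv_square) (simp_all add: tL_natural)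
    have s: "(\<one> (P\<^sub>1 \<triangleleft> N) \<^bold>\<triangleleft> g') \<cdot> (f \<^bold>\<triangleleft> \<one> (Q\<^sub>2 \<odot> Ms)) = f \<^bold>\<triangleleft> g'"
      by (rule LHom2_split) simp_all
    have "C\<^sub>M \<cdot> (F\<^sub>L \<^bold>\<triangleleft> \<one> Ms) = (C\<^sub>M \<cdot> (k\<^sub>L \<^bold>\<triangleleft> \<one> Ms)) \<cdot> ((f \<^bold>\<triangleleft> \<one> Q\<^sub>2) \<^bold>\<triangleleft> \<one> Ms)"
      by (simp add: F\<^sub>L_def LHom2_Comp_left)
    also have "C\<^sub>M \<cdot> (k\<^sub>L \<^bold>\<triangleleft> \<one> Ms) = (C \<^bold>\<triangleleft> \<one> P\<^sub>2) \<cdot> (l\<^sub>2 \<cdot> ((\<one> (P\<^sub>1 \<triangleleft> N) \<^bold>\<triangleleft> g') \<cdot> ?l))"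
      unfolding C\<^sub>M_def k\<^sub>L_def C_def l\<^sub>2_def
      by (rule collapse_mate[OF M N]) (simp_all add: g'_def)
    finally show ?thesis
      by (simp add: l Comp_extend[OF s])
  qed
  have CR: "C\<^sub>N \<cdot> (inv a\<^sub>2 \<^bold>\<triangleleft> \<one> Ns) = (\<one> P\<^sub>2 \<^bold>\<triangleright> C) \<cdot> b\<^sub>2"
  proof -
    have "C\<^sub>N = (\<one> P\<^sub>2 \<^bold>\<triangleright> C) \<cdot> (b\<^sub>2 \<cdot> (a\<^sub>2 \<^bold>\<triangleleft> \<one> Ns))"
      unfolding C\<^sub>N_def a\<^sub>2_def b\<^sub>2_def C_def by (rule collapse_RHom[OF N, symmetric]) simp_all
    then show ?thesis
      by (simp add: LHom2_interchange)
  qed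
  have ER: "(\<one> Ns \<^bold>\<triangleright> F\<^sub>R) \<cdot> E\<^sub>N = r\<^sub>2 \<cdot> ((g' \<^bold>\<triangleright> f) \<cdot> (r\<^sub>1 \<cdot> (\<one> Q\<^sub>2 \<^bold>\<triangleright> E)))"
  proof -
    let ?r = "tR B Ns P\<^sub>2 (M \<triangleright> Q\<^sub>1)"
    have r: "(\<one> Ns \<^bold>\<triangleright> (\<one> P\<^sub>2 \<^bold>\<triangleright> f)) \<cdot> ?r = r\<^sub>2 \<cdot> (\<one> (Ns \<odot> P\<^sub>2) \<^bold>\<triangleright> f)"
      unfolding r\<^sub>2_def by (rule tR_natural[symmetric]) simp_all
    have s: "(\<one> (Ns \<odot> P\<^sub>2) \<^bold>\<triangleright> f) \<cdot> (g' \<^bold>\<triangleright> \<one> (M \<triangleright> Q\<^sub>1)) = g' \<^bold>\<triangleright> f"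
      by (rule RHom2_split) simp_all
    have "(\<one> Ns \<^bold>\<triangleright> F\<^sub>R) \<cdot> E\<^sub>N = (\<one> Ns \<^bold>\<triangleright> (\<one> P\<^sub>2 \<^bold>\<triangleright> f)) \<cdot> ((\<one> Ns \<^bold>\<triangleright> k\<^sub>R) \<cdot> E\<^sub>N)"
      by (simp add: F\<^sub>R_def RHom2_Comp_right)
    also have "(\<one> Ns \<^bold>\<triangleright> k\<^sub>R) \<cdot> E\<^sub>N = ?r \<cdot> ((g' \<^bold>\<triangleright> \<one> (M \<triangleright> Q\<^sub>1)) \<cdot> (r\<^sub>1 \<cdot> (\<one> Q\<^sub>2 \<^bold>\<triangleright> E)))"
      unfolding k\<^sub>R_def E\<^sub>N_def r\<^sub>1_def E_def
      by (rule expand_mate[OF M N]) (simp_all add: g'_def)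
    finally show ?thesis
      by (simp add: Comp_extend[OF r] Comp_extend[OF s])
  qed

  have cotr_M: "cotr B T K M Ms \<eta>\<^sub>M \<epsilon>\<^sub>M (Q\<^sub>1 \<triangleleft> Q\<^sub>2) (P\<^sub>1 \<triangleleft> P\<^sub>2)
      (tL B P\<^sub>2 M P\<^sub>1 \<cdot> (\<one> P\<^sub>1 \<^bold>\<triangleleft> g) \<cdot> inv (tL B N Q\<^sub>2 P\<^sub>1) \<cdot> (f \<^bold>\<triangleleft> \<one> Q\<^sub>2) \<cdot> inv (aLR B M Q\<^sub>1 Q\<^sub>2))
    = Csh2\<^bsub>K\<^esub> C\<^sub>M \<cdot>\<^bsub>T\<^esub> (\<theta>\<^bsub>K\<^esub> Ms ((P\<^sub>1 \<triangleleft> P\<^sub>2) \<triangleleft> M) \<cdot>\<^bsub>T\<^esub> Csh2\<^bsub>K\<^esub> ((\<one> Ms \<^bold>\<triangleright> (F\<^sub>L \<cdot> inv a\<^sub>1)) \<cdot> E\<^sub>M))"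
  proof -
    have "tL B P\<^sub>2 M P\<^sub>1 \<cdot> (\<one> P\<^sub>1 \<^bold>\<triangleleft> g) \<cdot> inv (tL B N Q\<^sub>2 P\<^sub>1) \<cdot> (f \<^bold>\<triangleleft> \<one> Q\<^sub>2) \<cdot> inv (aLR B M Q\<^sub>1 Q\<^sub>2) = F\<^sub>L \<cdot> inv a\<^sub>1"
      by (simp add: F\<^sub>L_def k\<^sub>L_def a\<^sub>1_def)
    then show ?thesis
      unfolding C\<^sub>M_def E\<^sub>M_def by (simp add: cotr_eq[OF M])
  qed
  have cotr_N: "cotr B T K N Ns \<eta>\<^sub>N \<epsilon>\<^sub>N (Q\<^sub>2 \<triangleright> Q\<^sub>1) (P\<^sub>2 \<triangleright> P\<^sub>1)
      (inv (aLR B P\<^sub>2 P\<^sub>1 N) \<cdot> (\<one> P\<^sub>2 \<^bold>\<triangleright> f) \<cdot> tR B P\<^sub>2 M Q\<^sub>1 \<cdot> (g \<^bold>\<triangleright> \<one> Q\<^sub>1) \<cdot> inv (tR B N Q\<^sub>2 Q\<^sub>1))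
    = Csh2\<^bsub>K\<^esub> C\<^sub>N \<cdot>\<^bsub>T\<^esub> (\<theta>\<^bsub>K\<^esub> Ns ((P\<^sub>2 \<triangleright> P\<^sub>1) \<triangleleft> N) \<cdot>\<^bsub>T\<^esub> Csh2\<^bsub>K\<^esub> ((\<one> Ns \<^bold>\<triangleright> (inv a\<^sub>2 \<cdot> F\<^sub>R)) \<cdot> E\<^sub>N))"
  proof -
    have "inv (aLR B P\<^sub>2 P\<^sub>1 N) \<cdot> (\<one> P\<^sub>2 \<^bold>\<triangleright> f) \<cdot> tR B P\<^sub>2 M Q\<^sub>1 \<cdot> (g \<^bold>\<triangleright> \<one> Q\<^sub>1) \<cdot> inv (tR B N Q\<^sub>2 Q\<^sub>1) = inv a\<^sub>2 \<cdot> F\<^sub>R"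
      by (simp add: F\<^sub>R_def k\<^sub>R_def a\<^sub>2_def)
    then show ?thesis
      unfolding C\<^sub>N_def E\<^sub>N_def by (simp add: cotr_eq[OF N])
  qed

  \<comment> \<open>\<open>\<theta>\<close> passes 2-cells by naturality; \<open>h1\<close> and \<open>h2\<close> are where the 1-cell of \<open>\<theta>\<close> changes\<close>
  have t1: "\<theta>\<^bsub>K\<^esub> Ms ((P\<^sub>1 \<triangleleft> P\<^sub>2) \<triangleleft> M) \<cdot>\<^bsub>T\<^esub> Csh2\<^bsub>K\<^esub> (\<one> Ms \<^bold>\<triangleright> F\<^sub>L)
      = Csh2\<^bsub>K\<^esub> (F\<^sub>L \<^bold>\<triangleleft> \<one> Ms) \<cdot>\<^bsub>T\<^esub> \<theta>\<^bsub>K\<^esub> Ms ((M \<triangleright> Q\<^sub>1) \<triangleleft> Q\<^sub>2)"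
    by (rule theta_nat) simp_all
  have h1: "Csh2\<^bsub>K\<^esub> l\<^sub>1 \<cdot>\<^bsub>T\<^esub> (\<theta>\<^bsub>K\<^esub> Ms ((M \<triangleright> Q\<^sub>1) \<triangleleft> Q\<^sub>2) \<cdot>\<^bsub>T\<^esub> Csh2\<^bsub>K\<^esub> b\<^sub>1)
      = \<theta>\<^bsub>K\<^esub> (Q\<^sub>2 \<odot> Ms) (M \<triangleright> Q\<^sub>1) \<cdot>\<^bsub>T\<^esub> (Csh2\<^bsub>K\<^esub> r\<^sub>1 \<cdot>\<^bsub>T\<^esub> inv\<^bsub>T\<^esub> (\<theta>\<^bsub>K\<^esub> Q\<^sub>2 (Ms \<triangleright> (M \<triangleright> Q\<^sub>1))))"
    unfolding l\<^sub>1_def b\<^sub>1_def r\<^sub>1_def by (rule theta_HComp_inv) simp_all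
  have t2: "inv\<^bsub>T\<^esub> (\<theta>\<^bsub>K\<^esub> Q\<^sub>2 (Ms \<triangleright> (M \<triangleright> Q\<^sub>1))) \<cdot>\<^bsub>T\<^esub> Csh2\<^bsub>K\<^esub> (E \<^bold>\<triangleleft> \<one> Q\<^sub>2)
      = Csh2\<^bsub>K\<^esub> (\<one> Q\<^sub>2 \<^bold>\<triangleright> E) \<cdot>\<^bsub>T\<^esub> inv\<^bsub>T\<^esub> (\<theta>\<^bsub>K\<^esub> Q\<^sub>2 Q\<^sub>1)"
    by (rule theta_inv_nat) simp_all
  have t3: "Csh2\<^bsub>K\<^esub> (f \<^bold>\<triangleleft> g') \<cdot>\<^bsub>T\<^esub> \<theta>\<^bsub>K\<^esub> (Q\<^sub>2 \<odot> Ms) (M \<triangleright> Q\<^sub>1)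
      = \<theta>\<^bsub>K\<^esub> (Ns \<odot> P\<^sub>2) (P\<^sub>1 \<triangleleft> N) \<cdot>\<^bsub>T\<^esub> Csh2\<^bsub>K\<^esub> (g' \<^bold>\<triangleright> f)"
    by (rule theta_nat[symmetric]) simp_all
  have h2: "Csh2\<^bsub>K\<^esub> l\<^sub>2 \<cdot>\<^bsub>T\<^esub> \<theta>\<^bsub>K\<^esub> (Ns \<odot> P\<^sub>2) (P\<^sub>1 \<triangleleft> N)
      = \<theta>\<^bsub>K\<^esub> P\<^sub>2 ((P\<^sub>1 \<triangleleft> N) \<triangleleft> Ns) \<cdot>\<^bsub>T\<^esub> (Csh2\<^bsub>K\<^esub> b\<^sub>2 \<cdot>\<^bsub>T\<^esub> (\<theta>\<^bsub>K\<^esub> Ns (P\<^sub>2 \<triangleright> (P\<^sub>1 \<triangleleft> N)) \<cdot>\<^bsub>T\<^esub> Csh2\<^bsub>K\<^esub> r\<^sub>2))"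
    unfolding l\<^sub>2_def b\<^sub>2_def r\<^sub>2_def by (rule theta_HComp_left) simp_all
  have t4: "Csh2\<^bsub>K\<^esub> (C \<^bold>\<triangleleft> \<one> P\<^sub>2) \<cdot>\<^bsub>T\<^esub> \<theta>\<^bsub>K\<^esub> P\<^sub>2 ((P\<^sub>1 \<triangleleft> N) \<triangleleft> Ns) = \<theta>\<^bsub>K\<^esub> P\<^sub>2 P\<^sub>1 \<cdot>\<^bsub>T\<^esub> Csh2\<^bsub>K\<^esub> (\<one> P\<^sub>2 \<^bold>\<triangleright> C)"
    by (rule theta_nat[symmetric]) simp_all
  have t5: "\<theta>\<^bsub>K\<^esub> Ns ((P\<^sub>2 \<triangleright> P\<^sub>1) \<triangleleft> N) \<cdot>\<^bsub>T\<^esub> Csh2\<^bsub>K\<^esub> (\<one> Ns \<^bold>\<triangleright> inv a\<^sub>2)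
      = Csh2\<^bsub>K\<^esub> (inv a\<^sub>2 \<^bold>\<triangleleft> \<one> Ns) \<cdot>\<^bsub>T\<^esub> \<theta>\<^bsub>K\<^esub> Ns (P\<^sub>2 \<triangleright> (P\<^sub>1 \<triangleleft> N))"
    by (rule theta_nat) simp_all

  let ?\<theta> = "\<theta>\<^bsub>K\<^esub> Ms ((M \<triangleright> Q\<^sub>1) \<triangleleft> Q\<^sub>2)"
  let ?\<theta>' = "\<theta>\<^bsub>K\<^esub> Ns (P\<^sub>2 \<triangleright> (P\<^sub>1 \<triangleleft> N))"
  let ?i = "inv\<^bsub>T\<^esub> (\<theta>\<^bsub>K\<^esub> Q\<^sub>2 Q\<^sub>1)"
  define x where "x = Csh2\<^bsub>K\<^esub> (E \<^bold>\<triangleleft> \<one> Q\<^sub>2)"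
  have [simp]: "x \<in> Arr T" "Dom T x = Csh\<^bsub>K\<^esub> (Q\<^sub>1 \<triangleleft> Q\<^sub>2)" "Cod T x = Csh\<^bsub>K\<^esub> ((Ms \<triangleright> (M \<triangleright> Q\<^sub>1)) \<triangleleft> Q\<^sub>2)"
    by (simp_all add: x_def)
  \<comment> \<open>\<open>y\<close>, \<open>z\<close> and \<open>w\<close> are what \<open>\<theta>\<close> is composed with as it moves to the left end\<close>
  define y where "y = Csh2\<^bsub>K\<^esub> r\<^sub>1 \<cdot>\<^bsub>T\<^esub> (Csh2\<^bsub>K\<^esub> (\<one> Q\<^sub>2 \<^bold>\<triangleright> E) \<cdot>\<^bsub>T\<^esub> ?i)"
  have [simp]: "y \<in> Arr T" "Dom T y = Csh\<^bsub>K\<^esub> (Q\<^sub>1 \<triangleleft> Q\<^sub>2)" "Cod T y = Csh\<^bsub>K\<^esub> ((Q\<^sub>2 \<odot> Ms) \<triangleright> (M \<triangleright> Q\<^sub>1))"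
    by (simp_all add: y_def)
  define z where "z = Csh2\<^bsub>K\<^esub> (g' \<^bold>\<triangleright> f) \<cdot>\<^bsub>T\<^esub> y"
  have [simp]: "z \<in> Arr T" "Dom T z = Csh\<^bsub>K\<^esub> (Q\<^sub>1 \<triangleleft> Q\<^sub>2)" "Cod T z = Csh\<^bsub>K\<^esub> ((Ns \<odot> P\<^sub>2) \<triangleright> (P\<^sub>1 \<triangleleft> N))"
    by (simp_all add: z_def)
  define w where "w = Csh2\<^bsub>K\<^esub> b\<^sub>2 \<cdot>\<^bsub>T\<^esub> (?\<theta>' \<cdot>\<^bsub>T\<^esub> (Csh2\<^bsub>K\<^esub> r\<^sub>2 \<cdot>\<^bsub>T\<^esub> z))"
  have [simp]: "w \<in> Arr T" "Dom T w = Csh\<^bsub>K\<^esub> (Q\<^sub>1 \<triangleleft> Q\<^sub>2)" "Cod T w = Csh\<^bsub>K\<^esub> (P\<^sub>2 \<triangleright> ((P\<^sub>1 \<triangleleft> N) \<triangleleft> Ns))"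
    by (simp_all add: w_def)

  have L1: "Csh2\<^bsub>K\<^esub> C\<^sub>M \<cdot>\<^bsub>T\<^esub> (\<theta>\<^bsub>K\<^esub> Ms ((P\<^sub>1 \<triangleleft> P\<^sub>2) \<triangleleft> M) \<cdot>\<^bsub>T\<^esub> Csh2\<^bsub>K\<^esub> ((\<one> Ms \<^bold>\<triangleright> (F\<^sub>L \<cdot> inv a\<^sub>1)) \<cdot> E\<^sub>M))
      = Csh2\<^bsub>K\<^esub> (C\<^sub>M \<cdot> (F\<^sub>L \<^bold>\<triangleleft> \<one> Ms)) \<cdot>\<^bsub>T\<^esub> (?\<theta> \<cdot>\<^bsub>T\<^esub> (Csh2\<^bsub>K\<^esub> b\<^sub>1 \<cdot>\<^bsub>T\<^esub> x))"
    unfolding EL by (simp add: Csh2_Comp' T.Comp_extend[OF t1] flip: x_def)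
  have L2: "Csh2\<^bsub>K\<^esub> l\<^sub>1 \<cdot>\<^bsub>T\<^esub> (?\<theta> \<cdot>\<^bsub>T\<^esub> (Csh2\<^bsub>K\<^esub> b\<^sub>1 \<cdot>\<^bsub>T\<^esub> x)) = \<theta>\<^bsub>K\<^esub> (Q\<^sub>2 \<odot> Ms) (M \<triangleright> Q\<^sub>1) \<cdot>\<^bsub>T\<^esub> y"
    using T.Comp_extend[OF h1, of x] by (simp add: t2[folded x_def] y_def)
  have L3: "Csh2\<^bsub>K\<^esub> (f \<^bold>\<triangleleft> g') \<cdot>\<^bsub>T\<^esub> (\<theta>\<^bsub>K\<^esub> (Q\<^sub>2 \<odot> Ms) (M \<triangleright> Q\<^sub>1) \<cdot>\<^bsub>T\<^esub> y) = \<theta>\<^bsub>K\<^esub> (Ns \<odot> P\<^sub>2) (P\<^sub>1 \<triangleleft> N) \<cdot>\<^bsub>T\<^esub> z"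
    using T.Comp_extend[OF t3, of y] by (simp add: z_def)
  have L4: "Csh2\<^bsub>K\<^esub> l\<^sub>2 \<cdot>\<^bsub>T\<^esub> (\<theta>\<^bsub>K\<^esub> (Ns \<odot> P\<^sub>2) (P\<^sub>1 \<triangleleft> N) \<cdot>\<^bsub>T\<^esub> z) = \<theta>\<^bsub>K\<^esub> P\<^sub>2 ((P\<^sub>1 \<triangleleft> N) \<triangleleft> Ns) \<cdot>\<^bsub>T\<^esub> w"
    using T.Comp_extend[OF h2, of z] by (simp add: w_def)
  have L5: "Csh2\<^bsub>K\<^esub> (C \<^bold>\<triangleleft> \<one> P\<^sub>2) \<cdot>\<^bsub>T\<^esub> (\<theta>\<^bsub>K\<^esub> P\<^sub>2 ((P\<^sub>1 \<triangleleft> N) \<triangleleft> Ns) \<cdot>\<^bsub>T\<^esub> w) = \<theta>\<^bsub>K\<^esub> P\<^sub>2 P\<^sub>1 \<cdot>\<^bsub>T\<^esub> (Csh2\<^bsub>K\<^esub> (\<one> P\<^sub>2 \<^bold>\<triangleright> C) \<cdot>\<^bsub>T\<^esub> w)"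
    using T.Comp_extend[OF t4, of w] by simp
  have "inv\<^bsub>T\<^esub> (\<theta>\<^bsub>K\<^esub> P\<^sub>2 P\<^sub>1) \<cdot>\<^bsub>T\<^esub> (Csh2\<^bsub>K\<^esub> (C\<^sub>M \<cdot> (F\<^sub>L \<^bold>\<triangleleft> \<one> Ms)) \<cdot>\<^bsub>T\<^esub> (?\<theta> \<cdot>\<^bsub>T\<^esub> (Csh2\<^bsub>K\<^esub> b\<^sub>1 \<cdot>\<^bsub>T\<^esub> x)))
      = Csh2\<^bsub>K\<^esub> (\<one> P\<^sub>2 \<^bold>\<triangleright> C) \<cdot>\<^bsub>T\<^esub> w"
    unfolding CL by (simp add: Csh2_Comp' L2 L3 L4 L5)
  also have "\<dots> = Csh2\<^bsub>K\<^esub> (C\<^sub>N \<cdot> (inv a\<^sub>2 \<^bold>\<triangleleft> \<one> Ns)) \<cdot>\<^bsub>T\<^esub> (?\<theta>' \<cdot>\<^bsub>T\<^esub> (Csh2\<^bsub>K\<^esub> r\<^sub>2 \<cdot>\<^bsub>T\<^esub> z))"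
    unfolding CR w_def by (simp add: Csh2_Comp')
  also have "Csh2\<^bsub>K\<^esub> r\<^sub>2 \<cdot>\<^bsub>T\<^esub> z = Csh2\<^bsub>K\<^esub> G \<cdot>\<^bsub>T\<^esub> ?i"
    unfolding G_def ER z_def y_def by (simp add: Csh2_Comp')
  also have "Csh2\<^bsub>K\<^esub> (C\<^sub>N \<cdot> (inv a\<^sub>2 \<^bold>\<triangleleft> \<one> Ns)) \<cdot>\<^bsub>T\<^esub> (?\<theta>' \<cdot>\<^bsub>T\<^esub> (Csh2\<^bsub>K\<^esub> G \<cdot>\<^bsub>T\<^esub> ?i))
      = (Csh2\<^bsub>K\<^esub> C\<^sub>N \<cdot>\<^bsub>T\<^esub> (\<theta>\<^bsub>K\<^esub> Ns ((P\<^sub>2 \<triangleright> P\<^sub>1) \<triangleleft> N) \<cdot>\<^bsub>T\<^esub> Csh2\<^bsub>K\<^esub> ((\<one> Ns \<^bold>\<triangleright> inv a\<^sub>2) \<cdot> G))) \<cdot>\<^bsub>T\<^esub> ?i"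
    by (simp add: Csh2_Comp' T.Comp_extend[OF t5])
  also have "(\<one> Ns \<^bold>\<triangleright> inv a\<^sub>2) \<cdot> G = (\<one> Ns \<^bold>\<triangleright> (inv a\<^sub>2 \<cdot> F\<^sub>R)) \<cdot> E\<^sub>N"
    by (simp add: G_def RHom2_Comp_right)
  finally show ?thesis
    unfolding cotr_M cotr_N L1 .
qed

end

end

theorem proposition5p5:
  fixes B :: "('o, 'm, 'c, 'z) closed_bicat_scheme" (structure)
    and T :: "('x, 'y, 'w) cat_scheme"
    and K :: "('m, 'c, 'x, 'y, 'v) coshadow_data_scheme"
  assumes "coshadow B T K"
    and "M \<in> Cell1 R S" and "dual_pair B M Ms \<eta>\<^sub>M \<epsilon>\<^sub>M"
    and "N \<in> Cell1 W V" and "dual_pair B N Ns \<eta>\<^sub>N \<epsilon>\<^sub>N"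
    and "Q\<^sub>1 \<in> Cell1 V S" and "Q\<^sub>2 \<in> Cell1 V S"
    and "P\<^sub>1 \<in> Cell1 W R" and "P\<^sub>2 \<in> Cell1 W R"
    and "f \<in> Hom (M \<triangleright> Q\<^sub>1) (P\<^sub>1 \<triangleleft> N)"
    and "g \<in> Hom (P\<^sub>2 \<odot> M) (N \<odot> Q\<^sub>2)"
  shows "inv\<^bsub>T\<^esub> (\<theta>\<^bsub>K\<^esub> P\<^sub>2 P\<^sub>1)
           \<cdot>\<^bsub>T\<^esub> cotr B T K M Ms \<eta>\<^sub>M \<epsilon>\<^sub>M (Q\<^sub>1 \<triangleleft> Q\<^sub>2) (P\<^sub>1 \<triangleleft> P\<^sub>2)
                (tL B P\<^sub>2 M P\<^sub>1 \<cdot> (\<one> P\<^sub>1 \<^bold>\<triangleleft> g) \<cdot> inv (tL B N Q\<^sub>2 P\<^sub>1) \<cdot> (f \<^bold>\<triangleleft> \<one> Q\<^sub>2) \<cdot> inv (aLR B M Q\<^sub>1 Q\<^sub>2))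
         = cotr B T K N Ns \<eta>\<^sub>N \<epsilon>\<^sub>N (Q\<^sub>2 \<triangleright> Q\<^sub>1) (P\<^sub>2 \<triangleright> P\<^sub>1)
                (inv (aLR B P\<^sub>2 P\<^sub>1 N) \<cdot> (\<one> P\<^sub>2 \<^bold>\<triangleright> f) \<cdot> tR B P\<^sub>2 M Q\<^sub>1 \<cdot> (g \<^bold>\<triangleright> \<one> Q\<^sub>1) \<cdot> inv (tR B N Q\<^sub>2 Q\<^sub>1))
           \<cdot>\<^bsub>T\<^esub> inv\<^bsub>T\<^esub> (\<theta>\<^bsub>K\<^esub> Q\<^sub>2 Q\<^sub>1)"
proof -
  interpret coshadow B T K by fact
  have [simp]: "Trg B M = S" "Trg B N = V" using assms by (simp_all add: Cell1_def)
  note M = zigzag_pair_if_dual_pair[OF assms(3)] and N = zigzag_pair_if_dual_pair[OF assms(5)]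
  have "Src B Ms = S" "Src B Ns = V"
    using zigzag_pair_typing(3)[OF M] zigzag_pair_typing(3)[OF N] by simp_all
  then show ?thesis
    by (intro cotr_cyclic[OF M N]) (use assms in \<open>simp_all add: Cell1_def Hom_def\<close>)
qed

end
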